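(* Let $p\ge 3$ be a prime, let $k\ge1$ be an integer, and let $J,J_1\in\mathbb{Q}_p$ satisfy $|J|_p\le\frac1p$ and $0<|J_1|_p\le\frac1p$. Then there exists a unique translation-invariant $p$-adic Gibbs measure for the $p$-adic Ising-Vannimenus model with coupling constants $J,J_1$ on the Cayley tree $\Gamma^k_+$ of order $k$.
   Context: Notation: $\mathbb{Q}_p$ is the field of $p$-adic numbers with norm $|\cdot|_p$, $\exp_p(x)=\sum_{n\ge0}x^n/n!$ (convergent for $|x|_p<p^{-1/(p-1)}$), and $\mathcal{E}_p=\{x\in\mathbb{Q}_p: |x|_p=1,\ |x-1|_p<p^{-1/(p-1)}\}$. Put $a=\exp_p(J)$, $b=\exp_p(J_1)$. Tree: $\Gamma^k_+=(V,L)$ is the semi-infinite Cayley tree of order $k$ with root $x^0$: the root has $k$ edges and every other vertex has exactly $k+1$ edges. $d$ is the graph distance, $W_n=\{x\in V: d(x,x^0)=n\}$, $V_n=\bigcup_{m=0}^n W_m$, $L_n$ is the set of edges with both endpoints in $V_n$, and for $x\in W_n$, $S(x)=\{y\in W_{n+1}: d(x,y)=1\}$ (so $|S(x)|=k$). Edges are written $\langle x,y\rangle$ with $y\in S(x)$. Vertices $x,y$ are prolonged next-nearest neighbors, written $\rangle x,y\langle$, if $d(x,y)=2$ and $x\in W_{m-2}$, $y\in W_m$ for some $m$. Model: spins take values in $\Phi=\{-1,+1\}$; $\Omega=\Phi^V$, $\Omega_{V_n}=\Phi^{V_n}$, $\Omega_{W_n}=\Phi^{W_n}$; for $\sigma\in\Omega_{V_{n-1}}$,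 $\omega\in\Omega_{W_n}$, $\sigma\vee\omega\in\Omega_{V_n}$ is their concatenation. The Hamiltonian is $$H_n(\sigma)=J\sum_{\langle x,y\rangle\in L_n}\sigma(x)\sigma(y)+J_1\sum_{\rangle x,y\langle:\ x,y\in V_n}\sigma(x)\sigma(y),\quad \sigma\in\Omega_{V_n}.$$ Measures: a $p$-adic measure is a finitely additive $\mathbb{Q}_p$-valued set function on an algebra of sets; it is a probability measure if the whole space has measure $1$. Given $\mathbf{h}:\langle x,y\rangle\mapsto \mathbf{h}_{xy}=(h_{xy,++},h_{xy,+-},h_{xy,-+},h_{xy,--})\in\mathbb{Q}_p^4$ on $L$ (such that all expressions below are defined), put for $n\ge1$, $\sigma\in\Omega_{V_n}$ $$\mu^{(n)}_{\mathbf{h}}(\sigma)=\frac{1}{Z^{(\mathbf{h})}_n}\exp_p(H_n(\sigma))\prod_{x\in W_{n-1},\,y\in S(x)}\big(h_{xy,\sigma(x)\sigma(y)}\big)^{\sigma(x)\sigma(y)},$$ where the subscript $\sigma(x)\sigma(y)$ of $h$ denotes the ordered pair of signs of $\sigma(x)$ and $\sigma(y)$, the exponent is the product of the spins, and $Z^{(\mathbf{h})}_n$ is the normalizing factor (the sum of the same expressions over all $\sigma\in\Omega_{V_n}$). If the compatibility condition $\sum_{\omega\in\Omega_{W_n}}\mu^{(n)}_{\mathbf{h}}(\sigma\vee\omega)=\mu^{(n-1)}_{\mathbf{h}}(\sigma)$ holds for all $n\ge2$ and $\sigma\in\Omega_{V_{n-1}}$, there is a unique $p$-adic probability measure $\mu_{\mathbf{h}}$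 on $\Omega$ (on the algebra of cylinder sets) with $\mu_{\mathbf{h}}(\{\sigma:\sigma|_{V_n}=\sigma_n\})=\mu^{(n)}_{\mathbf{h}}(\sigma_n)$ for all $n\ge 1$; it is called a $p$-adic quasi Gibbs measure. It is called a $p$-adic Gibbs measure if it is given by such an $\mathbf{h}$ with $\mathbf{h}_{xy}\in\mathcal{E}_p^4$ for all $\langle x,y\rangle\in L$. To $\mathbf{h}$ one associates $\mathbf{u}=\{\mathbf{u}_{xy}\}$, $\mathbf{u}_{xy}=(u_{xy,1},u_{xy,2},u_{xy,3})$, with $u_{xy,1}=a^2h_{xy,++}h_{xy,-+}$, $u_{xy,2}=a^2h_{xy,--}h_{xy,-+}$, $u_{xy,3}=a^2h_{xy,++}h_{xy,+-}$; the measure $\mu_{\mathbf{h}}$ depends only on $\mathbf{u}$ and is written $\mu_{\mathbf{u}}$. The function $\mathbf{u}$ is translation-invariant if $\mathbf{u}_{xy}=\mathbf{u}_{zw}$ for all $\langle x,y\rangle,\langle z,w\rangle\in L$, and a $p$-adic Gibbs measure $\mu_{\mathbf{u}}$ is translation-invariant if $\mathbf{u}$ is translation-invariant. *)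

theory Defs
  imports "HOL-Analysis.Analysis" "Berlekamp_Zassenhaus.Finite_Field"
begin

section \<open>The p-adic absolute value on the rationals\<close>

definition padic_abs :: "nat \<Rightarrow> rat \<Rightarrow> real" where
  "padic_abs p r = (if r = 0 then 0 else
     real p powi (int (multiplicity (int p) (snd (quotient_of r)))
                  - int (multiplicity (int p) (fst (quotient_of r)))))"

definition padic_cauchy :: "nat \<Rightarrow> (nat \<Rightarrow> rat) \<Rightarrow> bool" where
  "padic_cauchy p X \<longleftrightarrow>
     (\<forall>e>0. \<exists>N. \<forall>m\<ge>N. \<forall>n\<ge>N. padic_abs p (X m - X n) < e)"

definition padic_null :: "nat \<Rightarrow> (nat \<Rightarrow> rat) \<Rightarrow> bool" where
  "padic_null p X \<longleftrightarrow> (\<lambda>n. padic_abs p (X n)) \<longlonglongrightarrow> 0"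

lemma padic_abs_0 [simp]: "padic_abs p 0 = 0"
  by (simp add: padic_abs_def)

lemma padic_abs_frac:
  assumes p: "prime p" and ab: "a \<noteq> 0" "b \<noteq> 0"
  shows "padic_abs p (of_int a / of_int b)
         = real p powi (int (multiplicity (int p) b) - int (multiplicity (int p) a))"
proof -
  obtain c d where cd: "quotient_of (of_int a / of_int b :: rat) = (c, d)"
    by (cases "quotient_of (of_int a / of_int b :: rat)")
  have d: "d > 0" using quotient_of_denom_pos[OF cd] .
  have eq: "of_int a / of_int b = (of_int c / of_int d :: rat)" using quotient_of_div[OF cd] .
  with d ab have c: "c \<noteq> 0" by auto
  have "(of_int (a * d) :: rat) = of_int (c * b)" using eq d ab by (simp add: field_simps)
  hence "a * d = c * b" by (simp only: of_int_eq_iff)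
  hence "multiplicity (int p) (a * d) = multiplicity (int p) (c * b)" by simp
  moreover have "prime_elem (int p)" using p by simp
  ultimately have "multiplicity (int p) a + multiplicity (int p) d
                   = multiplicity (int p) c + multiplicity (int p) b"
    using ab c d by (simp add: prime_elem_multiplicity_mult_distrib)
  hence "int (multiplicity (int p) d) - int (multiplicity (int p) c)
         = int (multiplicity (int p) b) - int (multiplicity (int p) a)" by linarith
  thus ?thesis using cd ab by (simp add: padic_abs_def)
qed

lemma rat_frac:
  fixes r :: rat
  obtains a b :: int where "r = of_int a / of_int b" "b \<noteq> 0"
proof -
  obtain a b where ab: "quotient_of r = (a, b)" by (cases "quotient_of r")
  show thesis using that quotient_of_div[OF ab] quotient_of_denom_pos[OF ab] by simp
qed

context
  fixes p :: nat
  assumes p: "prime p"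
begin

lemma padic_abs_nonneg [simp]: "0 \<le> padic_abs p r"
  by (simp add: padic_abs_def)

lemma padic_abs_eq_0_iff [simp]: "padic_abs p r = 0 \<longleftrightarrow> r = 0"
  using prime_gt_0_nat[OF p] by (auto simp: padic_abs_def power_int_eq_0_iff)

lemma padic_abs_1 [simp]: "padic_abs p 1 = 1"
  by (simp add: padic_abs_def)

lemma padic_abs_mult: "padic_abs p (r * s) = padic_abs p r * padic_abs p s"
proof (cases "r = 0 \<or> s = 0")
  case False
  obtain a b where r: "r = of_int a / of_int b" "b \<noteq> 0" by (rule rat_frac)
  obtain c d where s: "s = of_int c / of_int d" "d \<noteq> 0" by (rule rat_frac)
  have nz: "a \<noteq> 0" "c \<noteq> 0" using False r s by auto
  have pe: "prime_elem (int p)" using p by simp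
  have rs: "r * s = of_int (a * c) / of_int (b * d)" by (simp add: r s)
  let ?v = "\<lambda>x. int (multiplicity (int p) x)"
  have "padic_abs p (r * s) = real p powi (?v (b * d) - ?v (a * c))"
    unfolding rs using nz r(2) s(2) by (intro padic_abs_frac p) auto
  also have "?v (b * d) - ?v (a * c) = (?v b - ?v a) + (?v d - ?v c)"
    using nz r(2) s(2) by (simp add: prime_elem_multiplicity_mult_distrib[OF pe])
  also have "real p powi \<dots> = real p powi (?v b - ?v a) * real p powi (?v d - ?v c)"
    using prime_gt_0_nat[OF p] by (intro power_int_add) auto
  also have "\<dots> = padic_abs p r * padic_abs p s"
    unfolding r(1) s(1) using nz r(2) s(2) by (simp only: padic_abs_frac[OF p] simp_thms)
  finally show ?thesis .
qed auto

lemma padic_abs_minus [simp]: "padic_abs p (- r) = padic_abs p r"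
proof -
  have "padic_abs p (-1) * padic_abs p (-1) = 1"
    using padic_abs_mult[of "-1" "-1"] by simp
  hence "padic_abs p (-1) = 1"
    using padic_abs_nonneg[of "-1"] by (simp add: square_eq_1_iff)
  thus ?thesis using padic_abs_mult[of "-1" r] by simp
qed

lemma padic_abs_minus_commute: "padic_abs p (r - s) = padic_abs p (s - r)"
  using padic_abs_minus[of "r - s"] by simp

lemma padic_abs_inverse: "padic_abs p (inverse r) = inverse (padic_abs p r)"
proof (cases "r = 0")
  case False
  hence "padic_abs p r * padic_abs p (inverse r) = 1"
    using padic_abs_mult[of r "inverse r"] by simp
  thus ?thesis using inverse_unique by metis
qed auto

lemma padic_abs_ultra: "padic_abs p (r + s) \<le> max (padic_abs p r) (padic_abs p s)"
proof (cases "r = 0 \<or> s = 0 \<or> r + s = 0")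
  case False
  obtain a b where r: "r = of_int a / of_int b" "b \<noteq> 0" by (rule rat_frac)
  obtain c d where s: "s = of_int c / of_int d" "d \<noteq> 0" by (rule rat_frac)
  let ?x = "a * d" and ?y = "c * b" and ?m = "b * d"
  let ?v = "multiplicity (int p)"
  have r': "r = of_int ?x / of_int ?m" and s': "s = of_int ?y / of_int ?m"
    and rs: "r + s = of_int (?x + ?y) / of_int ?m"
    using r s by (auto simp: field_simps)
  have nz: "?x \<noteq> 0" "?y \<noteq> 0" "?m \<noteq> 0" "?x + ?y \<noteq> 0"
    using False r(2) s(2) r' s' rs by (fastforce simp del: of_int_mult of_int_add)+
  have p1: "real p \<ge> 1" using prime_gt_0_nat[OF p] by simp
  have "int p ^ min (?v ?x) (?v ?y) dvd ?x + ?y"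
    by (intro dvd_add multiplicity_dvd') auto
  moreover have "\<not> is_unit (int p)" using p prime_gt_1_nat by fastforce
  ultimately have "min (?v ?x) (?v ?y) \<le> ?v (?x + ?y)"
    using nz by (intro multiplicity_geI) auto
  moreover have "padic_abs p r = real p powi (int (?v ?m) - int (?v ?x))"
    unfolding r' using nz by (intro padic_abs_frac p)
  moreover have "padic_abs p s = real p powi (int (?v ?m) - int (?v ?y))"
    unfolding s' using nz by (intro padic_abs_frac p)
  moreover have "padic_abs p (r + s) = real p powi (int (?v ?m) - int (?v (?x + ?y)))"
    unfolding rs using nz by (intro padic_abs_frac p)
  ultimately show ?thesis
    using p1 by (auto simp: le_max_iff_disj min_le_iff_disj intro!: power_int_increasing)
qed (auto simp: le_max_iff_disj)

lemma padic_abs_diff_ultra: "padic_abs p (r - s) \<le> max (padic_abs p r) (padic_abs p s)"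
  using padic_abs_ultra[of r "- s"] by simp

lemma padic_abs_eqI:
  assumes "padic_abs p (r - s) < padic_abs p s"
  shows "padic_abs p r = padic_abs p s"
  using assms padic_abs_ultra[of "r - s" s] padic_abs_diff_ultra[of r "r - s"] by auto

lemma padic_null_const_iff [simp]: "padic_null p (\<lambda>n. c) \<longleftrightarrow> c = 0"
  by (simp add: padic_null_def LIMSEQ_const_iff)

lemma padic_null_add:
  assumes "padic_null p X" "padic_null p Y"
  shows "padic_null p (\<lambda>n. X n + Y n)"
proof -
  have "(\<lambda>n. max (padic_abs p (X n)) (padic_abs p (Y n))) \<longlonglongrightarrow> max 0 0"
    using assms unfolding padic_null_def by (intro tendsto_max)
  hence lim: "(\<lambda>n. max (padic_abs p (X n)) (padic_abs p (Y n))) \<longlonglongrightarrow> 0" by simp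
  show ?thesis unfolding padic_null_def
    by (rule Lim_null_comparison[OF _ lim]) (simp add: padic_abs_ultra)
qed

lemma padic_null_minus: "padic_null p X \<Longrightarrow> padic_null p (\<lambda>n. - X n)"
  by (simp add: padic_null_def)

lemma padic_null_diff:
  "padic_null p X \<Longrightarrow> padic_null p Y \<Longrightarrow> padic_null p (\<lambda>n. X n - Y n)"
  using padic_null_add[of X "\<lambda>n. - Y n"] padic_null_minus by simp

lemma padic_cauchyD:
  assumes "padic_cauchy p X" "e > 0"
  obtains N where "\<And>m n. m \<ge> N \<Longrightarrow> n \<ge> N \<Longrightarrow> padic_abs p (X m - X n) < e"
  using assms unfolding padic_cauchy_def by blast

lemma padic_cauchy_const [simp]: "padic_cauchy p (\<lambda>n. c)"
  by (simp add: padic_cauchy_def)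

lemma padic_cauchy_abs_cases:
  assumes X: "padic_cauchy p X"
  obtains "padic_null p X"
    | c where "\<not> padic_null p X" "c > 0" "eventually (\<lambda>n. padic_abs p (X n) = c) sequentially"
proof (cases "padic_null p X")
  case False
  then obtain e where e: "e > 0" "\<And>N. \<exists>n\<ge>N. padic_abs p (X n) \<ge> e"
    unfolding padic_null_def LIMSEQ_def by (auto simp: not_less)
  obtain N where N: "\<And>m n. m \<ge> N \<Longrightarrow> n \<ge> N \<Longrightarrow> padic_abs p (X m - X n) < e"
    using padic_cauchyD[OF X e(1)] by blast
  obtain k where k: "k \<ge> N" "padic_abs p (X k) \<ge> e" using e(2) by blast
  have "padic_abs p (X n) = padic_abs p (X k)" if "n \<ge> N" for n
    using N[OF that k(1)] k(2) by (intro padic_abs_eqI) simp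
  hence "eventually (\<lambda>n. padic_abs p (X n) = padic_abs p (X k)) sequentially"
    by (auto simp: eventually_sequentially)
  moreover have "padic_abs p (X k) > 0" using e(1) k(2) by simp
  ultimately show thesis using that(2) False by blast
qed (use that in blast)

lemma padic_cauchy_abs_convergent:
  assumes "padic_cauchy p X"
  shows "convergent (\<lambda>n. padic_abs p (X n))"
  using padic_cauchy_abs_cases[OF assms]
proof cases
  case 1
  thus ?thesis unfolding padic_null_def by (rule convergentI)
next
  case (2 c)
  thus ?thesis by (intro convergentI[of _ c] tendsto_eventually)
qed

lemma padic_cauchy_bounded:
  assumes "padic_cauchy p X"
  obtains B where "B > 0" "\<And>n. padic_abs p (X n) \<le> B"
proof -
  have "Bseq (\<lambda>n. padic_abs p (X n))"
    using padic_cauchy_abs_convergent[OF assms] by (rule convergent_imp_Bseq)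
  thus thesis using that by (auto simp: Bseq_def)
qed

lemma padic_null_mult_bounded:
  assumes "padic_cauchy p X" "padic_null p Y"
  shows "padic_null p (\<lambda>n. X n * Y n)"
proof -
  obtain B where B: "B > 0" "\<And>n. padic_abs p (X n) \<le> B"
    using padic_cauchy_bounded[OF assms(1)] by blast
  have "(\<lambda>n. B * padic_abs p (Y n)) \<longlonglongrightarrow> B * 0"
    using assms(2) unfolding padic_null_def by (intro tendsto_intros)
  hence lim: "(\<lambda>n. B * padic_abs p (Y n)) \<longlonglongrightarrow> 0" by simp
  show ?thesis unfolding padic_null_def
    by (rule Lim_null_comparison[OF _ lim]) (simp add: padic_abs_mult B mult_right_mono)
qed

lemma padic_cauchy_add:
  assumes "padic_cauchy p X" "padic_cauchy p Y"
  shows "padic_cauchy p (\<lambda>n. X n + Y n)"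
  unfolding padic_cauchy_def
proof (intro allI impI)
  fix e :: real assume e: "e > 0"
  obtain N where N: "\<And>m n. m \<ge> N \<Longrightarrow> n \<ge> N \<Longrightarrow> padic_abs p (X m - X n) < e"
    using padic_cauchyD[OF assms(1) e] by blast
  obtain M where M: "\<And>m n. m \<ge> M \<Longrightarrow> n \<ge> M \<Longrightarrow> padic_abs p (Y m - Y n) < e"
    using padic_cauchyD[OF assms(2) e] by blast
  have "padic_abs p (X m + Y m - (X n + Y n)) < e" if "m \<ge> max N M" "n \<ge> max N M" for m n
    using padic_abs_ultra[of "X m - X n" "Y m - Y n"] N[of m n] M[of m n] that
    by (simp add: algebra_simps)
  thus "\<exists>N. \<forall>m\<ge>N. \<forall>n\<ge>N. padic_abs p (X m + Y m - (X n + Y n)) < e" by blast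
qed

lemma padic_cauchy_minus: "padic_cauchy p X \<Longrightarrow> padic_cauchy p (\<lambda>n. - X n)"
  unfolding padic_cauchy_def by (simp add: padic_abs_minus_commute)

lemma padic_cauchy_mult:
  assumes "padic_cauchy p X" "padic_cauchy p Y"
  shows "padic_cauchy p (\<lambda>n. X n * Y n)"
  unfolding padic_cauchy_def
proof (intro allI impI)
  fix e :: real assume e: "e > 0"
  obtain A where A: "A > 0" "\<And>n. padic_abs p (X n) \<le> A"
    using padic_cauchy_bounded[OF assms(1)] by blast
  obtain B where B: "B > 0" "\<And>n. padic_abs p (Y n) \<le> B"
    using padic_cauchy_bounded[OF assms(2)] by blast
  obtain N where N: "\<And>m n. m \<ge> N \<Longrightarrow> n \<ge> N \<Longrightarrow> padic_abs p (X m - X n) < e / B"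
    using padic_cauchyD[OF assms(1), of "e / B"] e B by auto
  obtain M where M: "\<And>m n. m \<ge> M \<Longrightarrow> n \<ge> M \<Longrightarrow> padic_abs p (Y m - Y n) < e / A"
    using padic_cauchyD[OF assms(2), of "e / A"] e A by auto
  have "padic_abs p (X m * Y m - X n * Y n) < e" if mn: "m \<ge> max N M" "n \<ge> max N M" for m n
  proof -
    have "padic_abs p (X m * (Y m - Y n)) \<le> A * padic_abs p (Y m - Y n)"
      by (simp add: padic_abs_mult A mult_right_mono)
    also have "\<dots> < A * (e / A)" using M[of m n] mn A by (intro mult_strict_left_mono) auto
    finally have 1: "padic_abs p (X m * (Y m - Y n)) < e" using A by simp
    have "padic_abs p ((X m - X n) * Y n) \<le> padic_abs p (X m - X n) * B"
      by (simp add: padic_abs_mult B mult_left_mono)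
    also have "\<dots> < e / B * B" using N[of m n] mn B by (intro mult_strict_right_mono) auto
    finally have 2: "padic_abs p ((X m - X n) * Y n) < e" using B by simp
    have "X m * Y m - X n * Y n = X m * (Y m - Y n) + (X m - X n) * Y n"
      by (simp add: algebra_simps)
    thus ?thesis using padic_abs_ultra[of "X m * (Y m - Y n)" "(X m - X n) * Y n"] 1 2 by simp
  qed
  thus "\<exists>N. \<forall>m\<ge>N. \<forall>n\<ge>N. padic_abs p (X m * Y m - X n * Y n) < e" by blast
qed

lemma padic_cauchy_inverse:
  assumes "padic_cauchy p X" "\<not> padic_null p X"
  shows "padic_cauchy p (\<lambda>n. inverse (X n))"
  using padic_cauchy_abs_cases[OF assms(1)]
proof cases
  case (2 c)
  obtain M where M: "\<And>n. n \<ge> M \<Longrightarrow> padic_abs p (X n) = c"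
    using 2 by (auto simp: eventually_sequentially)
  show ?thesis unfolding padic_cauchy_def
  proof (intro allI impI)
    fix e :: real assume e: "e > 0"
    have "e * c * c > 0" using e 2 by simp
    then obtain N where
      N: "\<And>m n. m \<ge> N \<Longrightarrow> n \<ge> N \<Longrightarrow> padic_abs p (X m - X n) < e * c * c"
      using padic_cauchyD[OF assms(1)] by blast
    have "padic_abs p (inverse (X m) - inverse (X n)) < e"
      if mn: "m \<ge> max N M" "n \<ge> max N M" for m n
    proof -
      have c: "padic_abs p (X m) = c" "padic_abs p (X n) = c" using M mn by auto
      hence nz: "X m \<noteq> 0" "X n \<noteq> 0" using 2 by auto
      have "inverse (X m) - inverse (X n) = (X n - X m) * inverse (X m) * inverse (X n)"
        using nz by (simp add: field_simps)
      hence "padic_abs p (inverse (X m) - inverse (X n))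
             = padic_abs p (X n - X m) * inverse c * inverse c"
        by (simp only: padic_abs_mult padic_abs_inverse c)
      also have "\<dots> < e * c * c * inverse c * inverse c"
        using N[of n m] mn 2 by (intro mult_strict_right_mono) auto
      also have "\<dots> = e" using 2 by (simp add: field_simps)
      finally show ?thesis .
    qed
    thus "\<exists>N. \<forall>m\<ge>N. \<forall>n\<ge>N. padic_abs p (inverse (X m) - inverse (X n)) < e" by blast
  qed
qed (use assms in blast)

lemma padic_null_inverse_mult:
  assumes "padic_cauchy p X" "\<not> padic_null p X"
  shows "padic_null p (\<lambda>n. inverse (X n) * X n - 1)"
  using padic_cauchy_abs_cases[OF assms(1)]
proof cases
  case (2 c)
  have "eventually (\<lambda>n. padic_abs p (inverse (X n) * X n - 1) = 0) sequentially"
    using 2(3)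
  proof eventually_elim
    case (elim n)
    hence "X n \<noteq> 0" using \<open>c > 0\<close> by auto
    thus ?case by simp
  qed
  thus ?thesis unfolding padic_null_def by (rule tendsto_eventually)
qed (use assms in blast)

end

section \<open>The field of p-adic numbers\<close>

text \<open>
  The prime is the cardinality of the index type \<open>'p\<close>, and the field is the completion of
  the rationals: Cauchy sequences for the p-adic absolute value modulo null sequences.
\<close>

typedef (overloaded) 'p padic_seq = "{X. padic_cauchy CARD('p::prime_card) X}"
  by (rule exI[of _ "\<lambda>_. 0"]) (simp add: prime_card)

setup_lifting type_definition_padic_seq

lift_definition padic_seq_equiv :: "'p::prime_card padic_seq \<Rightarrow> 'p padic_seq \<Rightarrow> bool"
  is "\<lambda>X Y. padic_null CARD('p) (\<lambda>n. X n - Y n)" .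

lemma equivp_padic_seq_equiv: "equivp (padic_seq_equiv :: 'p::prime_card padic_seq \<Rightarrow> _)"
proof (rule equivpI)
  note p = prime_card[where 'a='p]
  show "reflp (padic_seq_equiv :: 'p padic_seq \<Rightarrow> _)"
    by (rule reflpI, transfer) (simp add: p)
  show "symp (padic_seq_equiv :: 'p padic_seq \<Rightarrow> _)"
    by (rule sympI, transfer) (auto dest: padic_null_minus[OF p])
  show "transp (padic_seq_equiv :: 'p padic_seq \<Rightarrow> _)"
    by (rule transpI, transfer) (auto dest: padic_null_add[OF p])
qed

quotient_type (overloaded) 'p padic = "'p::prime_card padic_seq" / padic_seq_equiv
  by (rule equivp_padic_seq_equiv)

lift_definition seq_const :: "rat \<Rightarrow> 'p::prime_card padic_seq" is "\<lambda>c n. c"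
  by (simp add: prime_card)

lift_definition seq_add :: "'p::prime_card padic_seq \<Rightarrow> 'p padic_seq \<Rightarrow> 'p padic_seq"
  is "\<lambda>X Y n. X n + Y n" by (rule padic_cauchy_add[OF prime_card])

lift_definition seq_minus :: "'p::prime_card padic_seq \<Rightarrow> 'p padic_seq"
  is "\<lambda>X n. - X n" by (rule padic_cauchy_minus[OF prime_card])

lift_definition seq_mult :: "'p::prime_card padic_seq \<Rightarrow> 'p padic_seq \<Rightarrow> 'p padic_seq"
  is "\<lambda>X Y n. X n * Y n" by (rule padic_cauchy_mult[OF prime_card])

lift_definition seq_inverse :: "'p::prime_card padic_seq \<Rightarrow> 'p padic_seq"
  is "\<lambda>X. if padic_null CARD('p) X then (\<lambda>n. 0) else (\<lambda>n. inverse (X n))"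
  by (auto simp: prime_card padic_cauchy_inverse)

lift_definition seq_norm :: "'p::prime_card padic_seq \<Rightarrow> real"
  is "\<lambda>X. lim (\<lambda>n. padic_abs CARD('p) (X n))" .

lemma seq_mult_cong:
  fixes A B C D :: "'p::prime_card padic_seq"
  assumes "padic_seq_equiv A B" "padic_seq_equiv C D"
  shows "padic_seq_equiv (seq_mult A C) (seq_mult B D)"
  using assms
proof (transfer, goal_cases)
  case (1 A B C D)
  note p = prime_card[where 'a='p]
  have "padic_null CARD('p) (\<lambda>n. A n * (C n - D n) + D n * (A n - B n))"
    using 1 by (intro padic_null_add padic_null_mult_bounded p)
  thus ?case by (simp add: algebra_simps)
qed

lemma seq_inverse_cong:
  fixes A B :: "'p::prime_card padic_seq"
  assumes "padic_seq_equiv A B"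
  shows "padic_seq_equiv (seq_inverse A) (seq_inverse B)"
  using assms
proof (transfer, goal_cases)
  case (1 X Y)
  note p = prime_card[where 'a='p]
  have iff: "padic_null CARD('p) X \<longleftrightarrow> padic_null CARD('p) Y"
    using padic_null_add[OF p 1(3), of Y] padic_null_diff[OF p, of X "\<lambda>n. X n - Y n"] 1(3)
    by auto
  show ?case
  proof (cases "padic_null CARD('p) X")
    case False
    let ?i = "\<lambda>n. inverse (X n)" and ?j = "\<lambda>n. inverse (Y n)"
    have c: "padic_cauchy CARD('p) ?i" "padic_cauchy CARD('p) ?j"
      using 1 False iff by (auto intro: padic_cauchy_inverse[OF p])
    have X1: "padic_null CARD('p) (\<lambda>n. ?i n * X n - 1)"
      using 1 False by (intro padic_null_inverse_mult p)
    have Y1: "padic_null CARD('p) (\<lambda>n. ?j n * Y n - 1)"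
      using 1 False iff by (intro padic_null_inverse_mult p) auto
    note mult = padic_null_mult_bounded[OF p]
    have "padic_null CARD('p) (\<lambda>n. ?j n * (?i n * X n - 1) - ?i n * (?j n * Y n - 1)
             - ?i n * (?j n * (X n - Y n)))"
      by (intro padic_null_diff[OF p] mult[OF c(2) X1] mult[OF c(1) Y1]
            mult[OF c(1) mult[OF c(2) 1(3)]])
    hence "padic_null CARD('p) (\<lambda>n. ?i n - ?j n)" by (simp add: algebra_simps)
    thus ?thesis using False iff by simp
  qed (use iff p in auto)
qed

lemma seq_norm_cong:
  fixes A B :: "'p::prime_card padic_seq"
  assumes "padic_seq_equiv A B"
  shows "seq_norm A = seq_norm B"
  using assms
proof (transfer, goal_cases)
  case (1 X Y)
  note p = prime_card[where 'a='p]
  let ?a = "padic_abs CARD('p)"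
  obtain x where x: "(\<lambda>n. ?a (X n)) \<longlonglongrightarrow> x"
    using padic_cauchy_abs_convergent[OF p 1(1)] by (auto simp: convergent_def)
  have "\<bar>?a (X n) - ?a (Y n)\<bar> \<le> ?a (X n - Y n)" for n
  proof -
    have "?a (X n) \<le> max (?a (X n - Y n)) (?a (Y n))"
      using padic_abs_ultra[OF p, of "X n - Y n" "Y n"] by simp
    moreover have "?a (Y n) \<le> max (?a (X n)) (?a (X n - Y n))"
      using padic_abs_diff_ultra[OF p, of "X n" "X n - Y n"] by simp
    moreover have "?a (X n) \<ge> 0" "?a (Y n) \<ge> 0" "?a (X n - Y n) \<ge> 0"
      by (simp_all add: padic_abs_nonneg[OF p])
    ultimately show ?thesis by linarith
  qed
  hence "eventually (\<lambda>n. norm (?a (X n) - ?a (Y n)) \<le> ?a (X n - Y n)) sequentially"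
    by (simp only: real_norm_def eventually_True)
  from Lim_null_comparison[OF this 1(3)[unfolded padic_null_def]]
  have "(\<lambda>n. ?a (X n) - ?a (Y n)) \<longlonglongrightarrow> 0" .
  from tendsto_diff[OF x this] have "(\<lambda>n. ?a (Y n)) \<longlonglongrightarrow> x" by simp
  with x show ?case by (simp add: limI)
qed

instantiation padic :: (prime_card) field
begin

lift_definition zero_padic :: "'a padic" is "seq_const 0" .

lift_definition one_padic :: "'a padic" is "seq_const 1" .

lift_definition plus_padic :: "'a padic \<Rightarrow> 'a padic \<Rightarrow> 'a padic" is seq_add
proof (transfer, goal_cases)
  case (1 A B C D)
  have "padic_null CARD('a) (\<lambda>n. (A n - B n) + (C n - D n))"
    using 1 by (intro padic_null_add prime_card)
  thus ?case by (simp add: algebra_simps)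
qed

lift_definition uminus_padic :: "'a padic \<Rightarrow> 'a padic" is seq_minus
  by transfer (auto dest: padic_null_minus[OF prime_card])

lift_definition times_padic :: "'a padic \<Rightarrow> 'a padic \<Rightarrow> 'a padic" is seq_mult
  by (rule seq_mult_cong)

lift_definition inverse_padic :: "'a padic \<Rightarrow> 'a padic" is seq_inverse
  by (rule seq_inverse_cong)

definition "x - y = x + - y" for x y :: "'a padic"

definition "x div y = x * inverse y" for x y :: "'a padic"

instance
proof
  note p = prime_card[where 'a='a]
  fix a b c :: "'a padic"
  show "a + b = b + a"
    by (transfer, transfer) (simp add: algebra_simps p)
  show "(a + b) + c = a + (b + c)"
    by (transfer, transfer) (simp add: algebra_simps p)
  show "0 + a = a"
    by (transfer, transfer) (simp add: p)
  show "- a + a = 0"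
    by (transfer, transfer) (simp add: p)
  show "a - b = a + - b"
    by (rule minus_padic_def)
  show "(a * b) * c = a * (b * c)"
    by (transfer, transfer) (simp add: algebra_simps p)
  show "a * b = b * a"
    by (transfer, transfer) (simp add: algebra_simps p)
  show "1 * a = a"
    by (transfer, transfer) (simp add: p)
  show "(a + b) * c = a * c + b * c"
    by (transfer, transfer) (simp add: algebra_simps p)
  show "(0::'a padic) \<noteq> 1"
    by (transfer, transfer) (simp add: p)
  show "a \<noteq> 0 \<Longrightarrow> inverse a * a = 1"
    by (transfer, transfer) (auto simp: p padic_null_inverse_mult)
  show "a div b = a * inverse b"
    by (rule divide_padic_def)
  show "inverse (0::'a padic) = 0"
    by (transfer, transfer) (simp add: p)
qed

end

lemma of_nat_padic: "of_nat n = abs_padic (seq_const (of_nat n) :: 'p::prime_card padic_seq)"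
proof (induction n)
  case (Suc n)
  have "abs_padic (seq_const (of_nat (Suc n)) :: 'p padic_seq)
        = abs_padic (seq_add (seq_const 1) (seq_const (of_nat n)))"
    by (rule arg_cong[of _ _ abs_padic], transfer) auto
  thus ?case by (simp add: Suc one_padic_def plus_padic.abs_eq)
qed (simp add: zero_padic_def)

instance padic :: (prime_card) field_char_0
proof
  show "inj (of_nat :: nat \<Rightarrow> 'a padic)"
  proof (rule injI)
    fix m n assume "(of_nat m :: 'a padic) = of_nat n"
    hence "padic_seq_equiv (seq_const (of_nat m)) (seq_const (of_nat n) :: 'a padic_seq)"
      by (simp add: of_nat_padic padic.abs_eq_iff)
    thus "m = n" by transfer (simp add: prime_card)
  qed
qed

lemma padic_seq_norm_LIMSEQ:
  assumes "padic_cauchy CARD('p::prime_card) X"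
  shows "(\<lambda>n. padic_abs CARD('p) (X n)) \<longlonglongrightarrow> lim (\<lambda>n. padic_abs CARD('p) (X n))"
  using padic_cauchy_abs_convergent[OF prime_card assms] by (simp add: convergent_LIMSEQ_iff)

lift_definition padic_norm :: "'p::prime_card padic \<Rightarrow> real" is seq_norm
  by (rule seq_norm_cong)

lemma padic_norm_ultra: "padic_norm (x + y) \<le> max (padic_norm x) (padic_norm y)" for x y :: "'p::prime_card padic"
proof (transfer, transfer, goal_cases)
  case (1 X Y)
  note p = prime_card[where 'a='p]
  show ?case
    by (rule LIMSEQ_le[OF padic_seq_norm_LIMSEQ[OF padic_cauchy_add[OF p 1]]
          tendsto_max[OF padic_seq_norm_LIMSEQ[OF 1(1)] padic_seq_norm_LIMSEQ[OF 1(2)]]])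
       (auto simp: padic_abs_ultra[OF p])
qed

lemma padic_norm_mult: "padic_norm (x * y) = padic_norm x * padic_norm y" for x y :: "'p::prime_card padic"
proof (transfer, transfer, goal_cases)
  case (1 X Y)
  note p = prime_card[where 'a='p]
  have "(\<lambda>n. padic_abs CARD('p) (X n * Y n)) \<longlonglongrightarrow>
        lim (\<lambda>n. padic_abs CARD('p) (X n)) * lim (\<lambda>n. padic_abs CARD('p) (Y n))"
    unfolding padic_abs_mult[OF p] by (intro tendsto_mult padic_seq_norm_LIMSEQ 1)
  thus ?case by (rule limI)
qed

lemma padic_norm_minus: "padic_norm (- x) = padic_norm x" for x :: "'p::prime_card padic"
  by (transfer, transfer) (simp add: padic_abs_minus[OF prime_card])

lemma padic_norm_eq_0_iff: "padic_norm x = 0 \<longleftrightarrow> x = 0" for x :: "'p::prime_card padic"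
proof (transfer, transfer, goal_cases)
  case (1 X)
  have "lim (\<lambda>n. padic_abs CARD('p) (X n)) = 0 \<longleftrightarrow> padic_null CARD('p) X"
    unfolding padic_null_def
    using padic_seq_norm_LIMSEQ[OF 1] LIMSEQ_unique by metis
  thus ?case by simp
qed

lemma padic_norm_nonneg: "0 \<le> padic_norm x" for x :: "'p::prime_card padic"
proof (transfer, transfer, goal_cases)
  case (1 X)
  show ?case
    by (rule LIMSEQ_le_const[OF padic_seq_norm_LIMSEQ[OF 1]])
       (simp add: padic_abs_nonneg[OF prime_card])
qed

instantiation padic :: (prime_card) metric_space
begin

definition "dist x y = padic_norm (x - y)" for x y :: "'a padic"

definition uniformity_padic_def [code del]:
  "(uniformity :: ('a padic \<times> 'a padic) filter) =
     (INF e\<in>{0<..}. principal {(x, y). dist x y < e})"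

definition open_padic_def [code del]:
  "open (U :: 'a padic set) \<longleftrightarrow>
     (\<forall>x\<in>U. eventually (\<lambda>(x', y). x' = x \<longrightarrow> y \<in> U) uniformity)"

instance
proof
  fix x y z :: "'a padic"
  show "dist x y = 0 \<longleftrightarrow> x = y" by (simp add: dist_padic_def padic_norm_eq_0_iff)
  have "padic_norm (x - y) \<le> max (padic_norm (x - z)) (padic_norm (y - z))"
    using padic_norm_ultra[of "x - z" "- (y - z)"] padic_norm_minus[of "y - z"] by simp
  thus "dist x y \<le> dist x z + dist y z"
    using padic_norm_nonneg[of "x - z"] padic_norm_nonneg[of "y - z"]
    by (simp add: dist_padic_def)
qed (simp_all add: uniformity_padic_def open_padic_def)

end

lemma of_rat_padic: "of_rat q = abs_padic (seq_const q :: 'p::prime_card padic_seq)"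
proof -
  let ?K = "\<lambda>q. abs_padic (seq_const q :: 'p padic_seq)"
  have K_mult: "?K (q * r) = ?K q * ?K r" for q r
  proof -
    have "seq_const (q * r) = seq_mult (seq_const q) (seq_const r :: 'p padic_seq)"
      by transfer auto
    thus ?thesis by (simp add: times_padic.abs_eq)
  qed
  have K_minus: "?K (- q) = - ?K q" for q
  proof -
    have "seq_const (- q) = seq_minus (seq_const q :: 'p padic_seq)" by transfer auto
    thus ?thesis by (simp add: uminus_padic.abs_eq)
  qed
  have K_int: "?K (of_int n) = of_int n" for n
    by (cases n) (simp_all add: K_minus of_nat_padic del: of_nat_Suc)
  obtain a b where ab: "q = of_int a / of_int b" "b \<noteq> 0" by (rule rat_frac)
  have "?K q * of_int b = ?K (of_int a)" using ab by (simp add: K_int[symmetric] K_mult[symmetric])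
  hence "?K q = of_int a / of_int b" using ab(2) by (simp add: eq_divide_eq K_int)
  thus ?thesis by (simp add: ab(1) of_rat_divide)
qed

lemma padic_norm_of_rat: "padic_norm (of_rat q :: 'p::prime_card padic) = padic_abs CARD('p) q"
  unfolding of_rat_padic padic_norm.abs_eq by transfer simp

lemma padic_norm_abs_diff:
  fixes A B :: "'p::prime_card padic_seq"
  shows "padic_norm (abs_padic A - abs_padic B)
         = lim (\<lambda>n. padic_abs CARD('p) (Rep_padic_seq A n - Rep_padic_seq B n))"
  unfolding minus_padic_def uminus_padic.abs_eq plus_padic.abs_eq padic_norm.abs_eq
  by (simp add: seq_norm.rep_eq seq_add.rep_eq seq_minus.rep_eq)

lemma padic_rat_dense:
  fixes x :: "'p::prime_card padic"
  assumes "e > 0"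
  obtains q where "padic_norm (x - of_rat q) < e"
proof -
  note p = prime_card[where 'a='p]
  obtain A where A: "x = abs_padic A" by (metis Quotient_abs_rep Quotient_padic)
  define X where "X = Rep_padic_seq A"
  have X: "padic_cauchy CARD('p) X" using Rep_padic_seq[of A] by (simp add: X_def)
  obtain N where N: "\<And>m n. m \<ge> N \<Longrightarrow> n \<ge> N \<Longrightarrow> padic_abs CARD('p) (X m - X n) < e / 2"
    using padic_cauchyD[OF p X, of "e / 2"] assms by auto
  have "padic_cauchy CARD('p) (\<lambda>n. X n + - X N)"
    using X by (intro padic_cauchy_add padic_cauchy_const p)
  from padic_seq_norm_LIMSEQ[OF this]
  have "lim (\<lambda>n. padic_abs CARD('p) (X n + - X N)) \<le> e / 2"
    by (rule LIMSEQ_le_const2) (use N in \<open>auto intro!: exI[of _ N] less_imp_le\<close>)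
  hence "padic_norm (x - of_rat (X N)) < e"
    using assms by (simp add: A of_rat_padic padic_norm_abs_diff seq_const.rep_eq X_def)
  thus thesis by (rule that)
qed

instance padic :: (prime_card) complete_space
proof
  note p = prime_card[where 'a='a]
  fix F :: "nat \<Rightarrow> 'a padic" assume F: "Cauchy F"
  have "\<exists>q. padic_norm (F n - of_rat q) < inverse (real (Suc n))" for n
    using padic_rat_dense[of "inverse (real (Suc n))" "F n"] by auto
  then obtain r where r: "\<And>n. padic_norm (F n - of_rat (r n)) < inverse (real (Suc n))" by metis
  have small: "eventually (\<lambda>n. padic_norm (F n - of_rat (r n)) < e) sequentially" if "e > 0" for e
    using order_tendstoD(2)[OF LIMSEQ_inverse_real_of_nat that] 
    by eventually_elim (use r less_trans in blast)
  have r_cauchy: "padic_cauchy CARD('a) r"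
    unfolding padic_cauchy_def
  proof (intro allI impI)
    fix e :: real assume e: "e > 0"
    obtain N where N: "\<And>n. n \<ge> N \<Longrightarrow> padic_norm (F n - of_rat (r n)) < e"
      using small[OF e] by (auto simp: eventually_sequentially)
    obtain M where M: "\<And>m n. m \<ge> M \<Longrightarrow> n \<ge> M \<Longrightarrow> padic_norm (F m - F n) < e"
      using F e unfolding Cauchy_def dist_padic_def by blast
    have "padic_abs CARD('a) (r m - r n) < e" if mn: "m \<ge> max N M" "n \<ge> max N M" for m n
    proof -
      let ?A = "F m - of_rat (r m)" and ?B = "F m - F n" and ?C = "F n - of_rat (r n)"
      have "of_rat (r m - r n) = - ?A + (?B + ?C)"
        by (simp add: of_rat_diff)
      hence "padic_norm (of_rat (r m - r n) :: 'a padic)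
             \<le> max (padic_norm ?A) (padic_norm (?B + ?C))"
        using padic_norm_ultra[of "- ?A" "?B + ?C"] padic_norm_minus[of ?A] by simp
      also have "\<dots> \<le> max (padic_norm ?A) (max (padic_norm ?B) (padic_norm ?C))"
        by (intro max.mono order.refl padic_norm_ultra)
      also have "\<dots> < e" using N[of m] N[of n] M[of m n] mn by simp
      finally show ?thesis by (simp only: padic_norm_of_rat)
    qed
    thus "\<exists>N. \<forall>m\<ge>N. \<forall>n\<ge>N. padic_abs CARD('a) (r m - r n) < e" by blast
  qed
  define L where "L = abs_padic (Abs_padic_seq r :: 'a padic_seq)"
  have rL: "eventually (\<lambda>n. padic_norm (of_rat (r n) - L) < e) sequentially" if e: "e > 0" for e
  proof -
    obtain N where N: "\<And>m n. m \<ge> N \<Longrightarrow> n \<ge> N \<Longrightarrow> padic_abs CARD('a) (r m - r n) < e / 2"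
      using padic_cauchyD[OF p r_cauchy, of "e / 2"] e by auto
    have "padic_norm (of_rat (r n) - L) < e" if n: "n \<ge> N" for n
    proof -
      have rep: "Rep_padic_seq (Abs_padic_seq r :: 'a padic_seq) = r"
        using r_cauchy by (simp add: Abs_padic_seq_inverse)
      have "padic_norm (of_rat (r n) - L) = lim (\<lambda>m. padic_abs CARD('a) (r n + - r m))"
        by (simp add: L_def of_rat_padic padic_norm_abs_diff seq_const.rep_eq rep)
      moreover have "padic_cauchy CARD('a) (\<lambda>m. r n + - r m)"
        using r_cauchy by (intro padic_cauchy_add padic_cauchy_minus padic_cauchy_const p)
      from padic_seq_norm_LIMSEQ[OF this]
      have "lim (\<lambda>m. padic_abs CARD('a) (r n + - r m)) \<le> e / 2"
        by (rule LIMSEQ_le_const2) (use N n in \<open>auto intro!: exI[of _ N] less_imp_le\<close>)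
      ultimately show ?thesis using e by simp
    qed
    thus ?thesis by (auto simp: eventually_sequentially)
  qed
  have "F \<longlonglongrightarrow> L"
  proof (rule tendstoI)
    fix e :: real assume "e > 0"
    from small[OF this] rL[OF this] show "eventually (\<lambda>n. dist (F n) L < e) sequentially"
    proof eventually_elim
      case (elim n)
      thus ?case using padic_norm_ultra[of "F n - of_rat (r n)" "of_rat (r n) - L"]
        by (simp add: dist_padic_def)
    qed
  qed
  thus "convergent F" by (rule convergentI)
qed

definition padic_exp_radius :: "'p::prime_card itself \<Rightarrow> real" where
  "padic_exp_radius _ = real CARD('p) powr (- 1 / (real CARD('p) - 1))"

definition padic_exp :: "'p::prime_card padic \<Rightarrow> 'p padic" where
  "padic_exp x = (\<Sum>n. x ^ n / fact n)"

definition padic_E :: "'p::prime_card padic set" where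
  "padic_E = {x. padic_norm x = 1 \<and> padic_norm (x - 1) < padic_exp_radius TYPE('p)}"

section \<open>The semi-infinite Cayley tree of order k\<close>

text \<open>
  Vertices are the finite words over \<open>{..<k}\<close>; the root is the empty word, and the neighbours
  of a word are its one-letter extensions and, unless it is the root, the word without its last
  letter.
\<close>

type_synonym vertex = "nat list"

definition tree_vertices :: "nat \<Rightarrow> vertex set" where
  "tree_vertices k = {x. set x \<subseteq> {..<k}}"

definition tree_adj :: "nat \<Rightarrow> (vertex \<times> vertex) set" where
  "tree_adj k = {(x, y). x \<in> tree_vertices k \<and> y \<in> tree_vertices k \<and>
                         (\<exists>i. y = x @ [i] \<or> x = y @ [i])}"

lemma tree_degree:
  assumes "x \<in> tree_vertices k"
  shows "card {y. (x, y) \<in> tree_adj k} = (if x = [] then k else k + 1)"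
proof -
  let ?C = "(\<lambda>i. x @ [i]) ` {..<k}" and ?P = "if x = [] then {} else {butlast x}"
  have "{y. (x, y) \<in> tree_adj k} = ?C \<union> ?P"
    using assms by (cases x rule: rev_cases) (auto simp: tree_adj_def tree_vertices_def)
  moreover have "card ?C = k"
    by (subst card_image) (auto simp: inj_on_def)
  moreover have "?C \<inter> ?P = {}"
  proof -
    have "length y = length x + 1" if "y \<in> ?C" for y using that by auto
    moreover have "length y \<le> length x" if "y \<in> ?P" for y using that by (auto split: if_splits)
    ultimately show ?thesis by fastforce
  qed
  moreover have "card (?C \<union> ?P) = card ?C + card ?P"
    using calculation by (intro card_Un_disjoint) auto
  ultimately show ?thesis by simp
qed

definition tree_dist :: "nat \<Rightarrow> vertex \<Rightarrow> vertex \<Rightarrow> nat" where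
  "tree_dist k x y = (LEAST n. (x, y) \<in> tree_adj k ^^ n)"

lemma tree_dist_root:
  assumes "x \<in> tree_vertices k"
  shows "tree_dist k x [] = length x"
  unfolding tree_dist_def
proof (rule Least_equality)
  show "(x, []) \<in> tree_adj k ^^ length x"
    using assms
  proof (induction x rule: rev_induct)
    case (snoc i x)
    hence "(x @ [i], x) \<in> tree_adj k" "(x, []) \<in> tree_adj k ^^ length x"
      by (auto simp: tree_adj_def tree_vertices_def)
    hence "(x @ [i], []) \<in> tree_adj k ^^ Suc (length x)" by (rule relpow_Suc_I2)
    thus ?case by simp
  qed simp
next
  have "length x \<le> length y + n" if "(x, y) \<in> tree_adj k ^^ n" for n y
    using that
  proof (induction n arbitrary: y)
    case (Suc n)
    then obtain z where "(x, z) \<in> tree_adj k ^^ n" "(z, y) \<in> tree_adj k" by auto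
    with Suc.IH[of z] show ?case by (auto simp: tree_adj_def)
  qed simp
  thus "length x \<le> n" if "(x, []) \<in> tree_adj k ^^ n" for n using that by fastforce
qed

definition level :: "nat \<Rightarrow> nat \<Rightarrow> vertex set" where
  "level k n = {x \<in> tree_vertices k. tree_dist k x [] = n}"

definition tree_ball :: "nat \<Rightarrow> nat \<Rightarrow> vertex set" where
  "tree_ball k n = (\<Union>m\<le>n. level k m)"

definition successors :: "nat \<Rightarrow> vertex \<Rightarrow> vertex set" where
  "successors k x = {y \<in> level k (tree_dist k x [] + 1). tree_dist k x y = 1}"

text \<open>An edge is represented by the ordered pair \<open>(x, y)\<close> with \<open>y\<close> a successor of \<open>x\<close>.\<close>

definition tree_edges :: "nat \<Rightarrow> (vertex \<times> vertex) set" where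
  "tree_edges k = {(x, y). x \<in> tree_vertices k \<and> y \<in> successors k x}"

definition ball_edges :: "nat \<Rightarrow> nat \<Rightarrow> (vertex \<times> vertex) set" where
  "ball_edges k n = {(x, y) \<in> tree_edges k. x \<in> tree_ball k n \<and> y \<in> tree_ball k n}"

definition prolonged_pairs :: "nat \<Rightarrow> nat \<Rightarrow> (vertex \<times> vertex) set" where
  "prolonged_pairs k n = {(x, y). x \<in> tree_ball k n \<and> y \<in> tree_ball k n \<and> tree_dist k x y = 2 \<and>
                                  (\<exists>m. x \<in> level k m \<and> y \<in> level k (m + 2))}"

section \<open>The p-adic Ising-Vannimenus model\<close>

definition configs :: "vertex set \<Rightarrow> (vertex \<Rightarrow> int) set" where
  "configs A = A \<rightarrow>\<^sub>E {-1, 1}"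

definition hamiltonian ::
  "nat \<Rightarrow> 'p::prime_card padic \<Rightarrow> 'p padic \<Rightarrow> nat \<Rightarrow> (vertex \<Rightarrow> int) \<Rightarrow> 'p padic" where
  "hamiltonian k J J1 n \<sigma> =
     J * (\<Sum>(x, y)\<in>ball_edges k n. of_int (\<sigma> x) * of_int (\<sigma> y))
     + J1 * (\<Sum>(x, y)\<in>prolonged_pairs k n. of_int (\<sigma> x) * of_int (\<sigma> y))"

text \<open>\<open>h x y s t\<close> is the component of the vector at the edge \<open>(x, y)\<close> with signs \<open>s, t\<close>.\<close>

type_synonym 'p boundary = "vertex \<Rightarrow> vertex \<Rightarrow> int \<Rightarrow> int \<Rightarrow> 'p padic"

definition gibbs_weight ::
  "nat \<Rightarrow> 'p::prime_card padic \<Rightarrow> 'p padic \<Rightarrow> 'p boundary \<Rightarrow> nat \<Rightarrow> (vertex \<Rightarrow> int) \<Rightarrow> 'p padic"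
  where
  "gibbs_weight k J J1 h n \<sigma> =
     padic_exp (hamiltonian k J J1 n \<sigma>) *
     (\<Prod>x\<in>level k (n - 1). \<Prod>y\<in>successors k x. h x y (\<sigma> x) (\<sigma> y) powi (\<sigma> x * \<sigma> y))"

definition partition_function ::
  "nat \<Rightarrow> 'p::prime_card padic \<Rightarrow> 'p padic \<Rightarrow> 'p boundary \<Rightarrow> nat \<Rightarrow> 'p padic" where
  "partition_function k J J1 h n = (\<Sum>\<sigma>\<in>configs (tree_ball k n). gibbs_weight k J J1 h n \<sigma>)"

definition finite_gibbs ::
  "nat \<Rightarrow> 'p::prime_card padic \<Rightarrow> 'p padic \<Rightarrow> 'p boundary \<Rightarrow> nat \<Rightarrow> (vertex \<Rightarrow> int) \<Rightarrow> 'p padic"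
  where
  "finite_gibbs k J J1 h n \<sigma> = gibbs_weight k J J1 h n \<sigma> / partition_function k J J1 h n"

text \<open>
  All expressions are defined: the exponentials converge, the components raised to the power
  \<open>-1\<close> are nonzero, and so are the normalizing factors.
\<close>

definition boundary_defined ::
  "nat \<Rightarrow> 'p::prime_card padic \<Rightarrow> 'p padic \<Rightarrow> 'p boundary \<Rightarrow> bool" where
  "boundary_defined k J J1 h \<longleftrightarrow>
     (\<forall>n\<ge>1. \<forall>\<sigma>\<in>configs (tree_ball k n).
        padic_norm (hamiltonian k J J1 n \<sigma>) < padic_exp_radius TYPE('p)) \<and>
     (\<forall>(x, y)\<in>tree_edges k. h x y 1 (-1) \<noteq> 0 \<and> h x y (-1) 1 \<noteq> 0) \<and>
     (\<forall>n\<ge>1. partition_function k J J1 h n \<noteq> 0)"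

definition compatible ::
  "nat \<Rightarrow> 'p::prime_card padic \<Rightarrow> 'p padic \<Rightarrow> 'p boundary \<Rightarrow> bool" where
  "compatible k J J1 h \<longleftrightarrow>
     (\<forall>n\<ge>2. \<forall>\<sigma>\<in>configs (tree_ball k (n - 1)).
        (\<Sum>\<omega>\<in>configs (level k n).
           finite_gibbs k J J1 h n (merge (tree_ball k (n - 1)) (level k n) (\<sigma>, \<omega>)))
        = finite_gibbs k J J1 h (n - 1) \<sigma>)"

definition padic_measure :: "'a set \<Rightarrow> 'a set set \<Rightarrow> ('a set \<Rightarrow> 'p::prime_card padic) \<Rightarrow> bool" where
  "padic_measure \<Omega> M \<mu> \<longleftrightarrow> Sigma_Algebra.algebra \<Omega> M \<and> Measure_Space.additive M \<mu>"

definition padic_prob :: "'a set \<Rightarrow> 'a set set \<Rightarrow> ('a set \<Rightarrow> 'p::prime_card padic) \<Rightarrow> bool" where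
  "padic_prob \<Omega> M \<mu> \<longleftrightarrow> padic_measure \<Omega> M \<mu> \<and> \<mu> \<Omega> = 1"

definition cylinder_sets :: "nat \<Rightarrow> (vertex \<Rightarrow> int) set set" where
  "cylinder_sets k = {{\<sigma> \<in> configs (tree_vertices k). restrict \<sigma> (tree_ball k n) \<in> B} | n B.
                        B \<subseteq> configs (tree_ball k n)}"

text \<open>
  A measure on the cylinder algebra is a function on that algebra only; extensionality fixes the
  values of the total HOL function elsewhere, so that uniqueness of the measure makes sense.
\<close>

definition quasi_gibbs_measure ::
  "nat \<Rightarrow> 'p::prime_card padic \<Rightarrow> 'p padic \<Rightarrow> 'p boundary \<Rightarrow> ((vertex \<Rightarrow> int) set \<Rightarrow> 'p padic) \<Rightarrow> bool"
  where
  "quasi_gibbs_measure k J J1 h \<mu> \<longleftrightarrow>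
     boundary_defined k J J1 h \<and> compatible k J J1 h \<and>
     \<mu> \<in> extensional (cylinder_sets k) \<and>
     padic_prob (configs (tree_vertices k)) (cylinder_sets k) \<mu> \<and>
     (\<forall>n\<ge>1. \<forall>s\<in>configs (tree_ball k n).
        \<mu> {\<sigma> \<in> configs (tree_vertices k). restrict \<sigma> (tree_ball k n) = s}
        = finite_gibbs k J J1 h n s)"

definition gibbs_measure ::
  "nat \<Rightarrow> 'p::prime_card padic \<Rightarrow> 'p padic \<Rightarrow> 'p boundary \<Rightarrow> ((vertex \<Rightarrow> int) set \<Rightarrow> 'p padic) \<Rightarrow> bool"
  where
  "gibbs_measure k J J1 h \<mu> \<longleftrightarrow>
     quasi_gibbs_measure k J J1 h \<mu> \<and>
     (\<forall>(x, y)\<in>tree_edges k. \<forall>s\<in>{-1, 1}. \<forall>t\<in>{-1, 1}. h x y s t \<in> padic_E)"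

definition boundary_u ::
  "'p::prime_card padic \<Rightarrow> 'p boundary \<Rightarrow> vertex \<Rightarrow> vertex \<Rightarrow> 'p padic \<times> 'p padic \<times> 'p padic" where
  "boundary_u J h x y =
     ((padic_exp J)\<^sup>2 * h x y 1 1 * h x y (-1) 1,
      (padic_exp J)\<^sup>2 * h x y (-1) (-1) * h x y (-1) 1,
      (padic_exp J)\<^sup>2 * h x y 1 1 * h x y 1 (-1))"

definition u_translation_invariant ::
  "nat \<Rightarrow> (vertex \<Rightarrow> vertex \<Rightarrow> 'p::prime_card padic \<times> 'p padic \<times> 'p padic) \<Rightarrow> bool" where
  "u_translation_invariant k u \<longleftrightarrow>
     (\<forall>(x, y)\<in>tree_edges k. \<forall>(z, w)\<in>tree_edges k. u x y = u z w)"

definition translation_invariant_gibbs_measure ::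
  "nat \<Rightarrow> 'p::prime_card padic \<Rightarrow> 'p padic \<Rightarrow> ((vertex \<Rightarrow> int) set \<Rightarrow> 'p padic) \<Rightarrow> bool" where
  "translation_invariant_gibbs_measure k J J1 \<mu> \<longleftrightarrow>
     (\<exists>h. gibbs_measure k J J1 h \<mu> \<and> u_translation_invariant k (boundary_u J h))"

end

theory Submission
  imports Defs
begin

text \<open>
  Write \<open>g\<^bsub>xy\<^esub>(s, t) = h\<^bsub>xy,st\<^esub>\<^bsup>st\<^esup>\<close>. The vector \<open>\<^bold>u\<^bsub>xy\<^esub>\<close> determines \<open>g\<^bsub>xy\<^esub>\<close> up to a scalar factor, and such factors
  cancel in the finite-volume measures. Summing the weights over one more level replaces
  \<open>\<Prod> g(\<sigma>(x), \<sigma>(y))\<close> by \<open>\<Prod> F(\<sigma>(x), \<sigma>(y)) ^ k\<close> with \<open>F(s, t) = \<Sum>\<^sub>e a\<^bsup>te\<^esup> b\<^bsup>se\<^esup> g(t, e)\<close>, so for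
  translation-invariant \<open>\<^bold>u\<close> compatibility says that a power of \<open>F ^ k / g\<close> is constant. As \<open>1 + p\<int>\<^sub>p\<close>
  is torsion-free for odd \<open>p\<close>, this amounts to \<open>F ^ k = l * g\<close>. In terms of ratios of values of \<open>g\<close> this
  is a system of powers of Moebius maps with coefficients in \<open>1 + p\<int>\<^sub>p\<close>, whose determinants are
  divisible by \<open>p\<close>: hence uniqueness, and a solution with \<open>g(s, t) = g(-s, -t)\<close> comes from Banach's
  fixed-point theorem in one variable.
\<close>

section \<open>The p-adic norm\<close>

text \<open>Since \<open>h\<close> enters with exponent 1 or -1, the components of \<open>u\<close>
  divided by \<open>a^2\<close> are the ratios g(+,+)/g(-,+), g(-,-)/g(-,+) and g(+,+)/g(+,-); this
  is why \<open>u\<close> fixes \<open>g\<close> exactly up to a factor. Every element of 1 + pZ_p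
  is congruent to 1, so a sum of two of them is congruent to 2 and is a unit for odd p. No
  denominator of a Moebius map can then vanish, and a partition function, being congruent to a power
  of 2, is a unit as well. A determinant is a difference of two products from 1 + pZ_p, which is
  where the contraction factor 1/p comes from; raising to the power k does not spoil it. Existence
  needs a self-map, whereas uniqueness only compares two given solutions. For \<open>g\<close>
  invariant under the global spin flip, substituting -e for e in the sum shows F(-s,-t) = F(s,t), so
  the four equations pair up and only the ratio w = g(+,+)/g(+,-) remains. Uniqueness is proved
  among all \<open>g\<close>, symmetric or not.\<close>

lemma padic_norm_0 [simp]: "padic_norm (0 :: 'p::prime_card padic) = 0"
  by (simp add: padic_norm_eq_0_iff)

lemma padic_norm_1 [simp]: "padic_norm (1 :: 'p::prime_card padic) = 1"
  using padic_norm_of_rat[of 1, where 'p='p] by (simp add: padic_abs_1[OF prime_card])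

lemma padic_norm_power: "padic_norm (x ^ n) = padic_norm x ^ n" for x :: "'p::prime_card padic"
  by (induction n) (simp_all add: padic_norm_mult)

lemma padic_norm_inverse: "padic_norm (inverse x) = inverse (padic_norm x)"
  for x :: "'p::prime_card padic"
proof (cases "x = 0")
  case False
  hence "padic_norm x * padic_norm (inverse x) = 1"
    by (simp flip: padic_norm_mult)
  thus ?thesis by (metis inverse_unique)
qed simp

lemma padic_norm_divide: "padic_norm (x / y) = padic_norm x / padic_norm y"
  for x y :: "'p::prime_card padic"
  by (simp add: divide_inverse padic_norm_mult padic_norm_inverse)

lemma padic_norm_diff_le: "padic_norm (x - y) \<le> max (padic_norm x) (padic_norm y)"
  for x y :: "'p::prime_card padic"
  using padic_norm_ultra[of x "- y"] by (simp add: padic_norm_minus)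

lemma padic_norm_minus_commute: "padic_norm (x - y) = padic_norm (y - x)"
  for x y :: "'p::prime_card padic"
  using padic_norm_minus[of "x - y"] by simp

lemma padic_norm_diff_triangle: "padic_norm (x - z) \<le> max (padic_norm (x - y)) (padic_norm (y - z))"
  for x y z :: "'p::prime_card padic"
  using padic_norm_ultra[of "x - y" "y - z"] by simp

lemma padic_norm_eqI:
  fixes x y :: "'p::prime_card padic"
  assumes "padic_norm (x - y) < padic_norm y"
  shows "padic_norm x = padic_norm y"
  using assms padic_norm_ultra[of "x - y" y] padic_norm_diff_le[of x "x - y"] by auto

lemma padic_norm_sum_le:
  fixes f :: "'a \<Rightarrow> 'p::prime_card padic"
  assumes "0 \<le> B" "\<And>i. i \<in> A \<Longrightarrow> padic_norm (f i) \<le> B"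
  shows "padic_norm (sum f A) \<le> B"
  using assms
proof (induction A rule: infinite_finite_induct)
  case (insert i A)
  hence "padic_norm (f i) \<le> B" "padic_norm (sum f A) \<le> B" by simp_all
  hence "max (padic_norm (f i)) (padic_norm (sum f A)) \<le> B" by simp
  with padic_norm_ultra[of "f i" "sum f A"] insert.hyps show ?case by (metis order_trans sum.insert)
qed simp_all

lemma padic_norm_of_nat:
  assumes "0 < n"
  shows "padic_norm (of_nat n :: 'p::prime_card padic) = (1 / real CARD('p)) ^ multiplicity CARD('p) n"
proof -
  have "padic_norm (of_nat n :: 'p padic) = padic_abs CARD('p) (of_int (int n) / of_int 1)"
    using padic_norm_of_rat[of "of_nat n", where 'p='p] by simp
  also have "\<dots> = real CARD('p) powi - int (multiplicity (int CARD('p)) (int n))"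
    using assms by (subst padic_abs_frac[OF prime_card]) auto
  also have "multiplicity (int CARD('p)) (int n) = multiplicity CARD('p) n"
    by (simp add: multiplicity_def flip: of_nat_power)
  finally show ?thesis by (simp add: power_int_minus power_one_over inverse_eq_divide)
qed

lemma padic_norm_of_nat_le: "padic_norm (of_nat n :: 'p::prime_card padic) \<le> 1"
  using zero_less_card_finite[where 'a='p]
  by (cases "n = 0") (simp_all add: padic_norm_of_nat power_le_one Suc_leI)

lemma padic_norm_of_int_le: "padic_norm (of_int n :: 'p::prime_card padic) \<le> 1"
  by (cases n) (simp_all only: of_int_of_nat_eq of_int_minus padic_norm_minus padic_norm_of_nat_le)

text \<open>The largest power of p dividing \<open>n\<close> is at most \<open>n\<close>. This
  controls the denominators in the binomial expansion behind
  \<open>padic_E_power_eq_1\<close>.\<close>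

lemma padic_norm_of_nat_ge:
  assumes "0 < n"
  shows "1 / real n \<le> padic_norm (of_nat n :: 'p::prime_card padic)"
proof -
  have "CARD('p) ^ multiplicity CARD('p) n \<le> n"
    using assms by (intro dvd_imp_le multiplicity_dvd) auto
  hence "real CARD('p) ^ multiplicity CARD('p) n \<le> real n"
    by (metis of_nat_le_iff of_nat_power)
  thus ?thesis using assms prime_gt_0_nat[OF prime_card[where 'a='p]]
    by (simp add: padic_norm_of_nat power_one_over frac_le)
qed

text \<open>The norm is discrete: a nonzero \<open>x\<close> has the norm of any rational close
  enough to it, hence an integer power of p. Strict bounds such as the exponential radius thereby
  sharpen to 1/p.\<close>

lemma padic_norm_less_1:
  fixes x :: "'p::prime_card padic"
  assumes "padic_norm x < 1"
  shows "padic_norm x \<le> 1 / real CARD('p)"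
proof (cases "x = 0")
  case False
  hence "padic_norm x > 0" using padic_norm_eq_0_iff[of x] padic_norm_nonneg[of x] by linarith
  then obtain q where "padic_norm (x - of_rat q) < padic_norm x" using padic_rat_dense by blast
  hence "padic_norm (of_rat q - x) < padic_norm x" by (simp add: padic_norm_minus_commute)
  hence eq: "padic_norm x = padic_abs CARD('p) q"
    using padic_norm_eqI[of "of_rat q" x] by (simp add: padic_norm_of_rat)
  moreover have "q \<noteq> 0" using \<open>padic_norm x > 0\<close> eq by auto
  ultimately obtain m where m: "padic_norm x = real CARD('p) powi m"
    by (auto simp: padic_abs_def)
  have p: "real CARD('p) > 1" using prime_gt_1_nat[OF prime_card[where 'a='p]] by simp
  have "m < 0"
  proof (rule ccontr)
    assume "\<not> m < 0"
    hence "real CARD('p) powi 0 \<le> real CARD('p) powi m" using p by (intro power_int_increasing) auto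
    thus False using m assms by simp
  qed
  hence "real CARD('p) powi m \<le> real CARD('p) powi (-1)" using p by (intro power_int_increasing) auto
  thus ?thesis using m by (simp add: inverse_eq_divide)
qed simp

section \<open>Ultrametric series and the p-part of factorials\<close>

lemma padic_tendsto_iff:
  fixes X :: "nat \<Rightarrow> 'p::prime_card padic"
  shows "X \<longlonglongrightarrow> L \<longleftrightarrow> (\<lambda>n. padic_norm (X n - L)) \<longlonglongrightarrow> 0"
  by (subst tendsto_dist_iff) (simp add: dist_padic_def)

text \<open>By the ultrametric inequality a block of terms is no larger than its largest term, so
  null terms already make the partial sums Cauchy.\<close>

lemma padic_summable:
  fixes f :: "nat \<Rightarrow> 'p::prime_card padic"
  assumes "(\<lambda>n. padic_norm (f n)) \<longlonglongrightarrow> 0"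
  shows "summable f"
proof -
  have "Cauchy (\<lambda>n. sum f {..<n})"
  proof (rule metric_CauchyI)
    fix e :: real assume e: "0 < e"
    then obtain N where N: "\<And>n. n \<ge> N \<Longrightarrow> padic_norm (f n) < e / 2"
      using order_tendstoD(2)[OF assms, of "e / 2"] by (auto simp: eventually_sequentially)
    have *: "dist (sum f {..<m}) (sum f {..<n}) < e" if "N \<le> m" "m \<le> n" for m n
    proof -
      have "sum f {..<n} - sum f {..<m} = sum f {m..<n}"
        using that sum_diff_nat_ivl[of 0 m n f] by (simp add: atLeast0LessThan)
      moreover have "padic_norm (sum f {m..<n}) \<le> e / 2"
        using e N that by (intro padic_norm_sum_le) (auto intro!: less_imp_le)
      ultimately have "padic_norm (sum f {..<n} - sum f {..<m}) < e" using e by simp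
      thus ?thesis by (simp only: dist_padic_def padic_norm_minus_commute)
    qed
    have "dist (sum f {..<m}) (sum f {..<n}) < e" if "N \<le> m" "N \<le> n" for m n
      using *[of m n] *[of n m] that by (cases "m \<le> n") (simp_all add: dist_commute)
    thus "\<exists>M. \<forall>m\<ge>M. \<forall>n\<ge>M. dist (sum f {..<m}) (sum f {..<n}) < e" by blast
  qed
  thus ?thesis by (simp add: summable_iff_convergent Cauchy_convergent_iff)
qed

lemma padic_suminf_tail:
  fixes f :: "nat \<Rightarrow> 'p::prime_card padic"
  assumes "summable f" "0 < B" "\<And>n. n \<ge> N \<Longrightarrow> padic_norm (f n) \<le> B"
  shows "padic_norm (suminf f - sum f {..<N}) \<le> B"
proof -
  have "(\<lambda>n. padic_norm (sum f {..<n} - suminf f)) \<longlonglongrightarrow> 0"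
    using summable_LIMSEQ[OF assms(1)] by (simp add: padic_tendsto_iff)
  hence "eventually (\<lambda>n. padic_norm (sum f {..<n} - suminf f) < B) sequentially"
    using assms(2) by (rule order_tendstoD(2))
  then obtain M where M: "\<And>n. n \<ge> M \<Longrightarrow> padic_norm (sum f {..<n} - suminf f) < B"
    by (auto simp: eventually_sequentially)
  define n where "n = max M N"
  have "sum f {..<n} - sum f {..<N} = sum f {N..<n}"
    using sum_diff_nat_ivl[of 0 N n f] by (simp add: atLeast0LessThan n_def)
  hence "padic_norm (sum f {..<n} - sum f {..<N}) \<le> B"
    using assms padic_norm_sum_le[of B "{N..<n}" f] by simp
  moreover have "padic_norm (suminf f - sum f {..<n}) \<le> B"
    using M[of n] by (simp add: padic_norm_minus_commute n_def)
  ultimately show ?thesis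
    using padic_norm_diff_triangle[of "suminf f" "sum f {..<N}" "sum f {..<n}"] by simp
qed

lemma multiplicity_fact_le:
  fixes p :: nat
  assumes "prime p"
  shows "(p - 1) * multiplicity p (fact n :: nat) \<le> n"
proof -
  \<comment> \<open>One step of Legendre's formula: the multiples of p up to \<open>n\<close>
    contribute one factor p each, and dividing p out of them leaves the factorial of
    \<open>n div p\<close>. Iterating by strong induction gives the bound.\<close>
  have legendre: "multiplicity p (fact n :: nat) = n div p + multiplicity p (fact (n div p) :: nat)" for n
  proof (induction n)
    case (Suc n)
    have "multiplicity p (fact (Suc n) :: nat) = multiplicity p (Suc n) + multiplicity p (fact n :: nat)"
      unfolding fact_Suc using assms by (simp add: prime_elem_multiplicity_mult_distrib del: mult_Suc)
    also have "\<dots> = multiplicity p (Suc n) + n div p + multiplicity p (fact (n div p) :: nat)"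
      using Suc by simp
    also have "\<dots> = Suc n div p + multiplicity p (fact (Suc n div p) :: nat)"
    proof (cases "p dvd Suc n")
      case True
      then obtain q where q: "Suc n = p * q" by blast
      then obtain r where r: "q = Suc r" by (cases q) auto
      have p: "p > 0" "p \<noteq> 1" using assms prime_gt_1_nat[of p] by auto
      hence dn: "Suc n div p = Suc r" using q r by simp
      hence "n div p = r" using div_Suc[of n p] True by (simp add: dvd_eq_mod_eq_0)
      moreover have "multiplicity p (Suc n) = Suc (multiplicity p (Suc r))"
        unfolding q r using assms p by (intro multiplicity_times_same) auto
      moreover have "multiplicity p (fact (Suc r) :: nat) = multiplicity p (Suc r) + multiplicity p (fact r :: nat)"
        unfolding fact_Suc using assms by (simp add: prime_elem_multiplicity_mult_distrib del: mult_Suc)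
      ultimately show ?thesis by (simp only: dn)
    next
      case False
      hence "Suc n div p = n div p" using div_Suc[of n p] by (simp add: dvd_eq_mod_eq_0)
      thus ?thesis using False by (simp add: not_dvd_imp_multiplicity_0)
    qed
    finally show ?case .
  qed simp
  show ?thesis
  proof (induction n rule: less_induct)
    case (less n)
    show ?case
    proof (cases "n = 0")
      case False
      have p: "p > 1" using assms by (rule prime_gt_1_nat)
      hence "n div p < n" using False by simp
      from less[OF this] have "(p - 1) * multiplicity p (fact n :: nat) \<le> (p - 1) * (n div p) + n div p"
        by (subst legendre) (simp add: distrib_left)
      also have "\<dots> = p * (n div p)" using p by (simp add: algebra_simps)
      also have "\<dots> \<le> n" by simp
      finally show ?thesis .
    qed simp
  qed
qed

section \<open>The group \<open>1 + p\<int>\<^sub>p\<close> and the exponential\<close>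

lemma binomial_exp_sum:
  fixes x y :: "'a::field_char_0"
  shows "(x + y) ^ n / fact n = (\<Sum>i\<le>n. (x ^ i / fact i) * (y ^ (n - i) / fact (n - i)))"
proof -
  have "(x + y) ^ n / fact n = (\<Sum>i\<le>n. of_nat (n choose i) * x ^ i * y ^ (n - i) / fact n)"
    by (simp add: binomial_ring sum_divide_distrib)
  also have "\<dots> = (\<Sum>i\<le>n. (x ^ i / fact i) * (y ^ (n - i) / fact (n - i)))"
    by (intro sum.cong) (simp_all add: binomial_fact)
  finally show ?thesis .
qed

context
  assumes p3: "CARD('p::prime_card) \<ge> 3"
begin

lemma padic_norm_2: "padic_norm (2 :: 'p padic) = 1"
proof -
  have "\<not> CARD('p) dvd 2" using p3 by (auto dest: dvd_imp_le)
  thus ?thesis using padic_norm_of_nat[of 2, where 'p='p]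
    by (simp add: not_dvd_imp_multiplicity_0)
qed

text \<open>The exponent -1/(p-1) lies strictly between -1 and 0 because p >= 3. As norms below 1
  are at most 1/p, \<open>padic_E\<close> is then exactly 1 + pZ_p; for p = 2 the radius would equal
  1/p and the set would shrink.\<close>

lemma padic_exp_radius_bounds:
  "1 / real CARD('p) < padic_exp_radius TYPE('p)" "padic_exp_radius TYPE('p) < 1"
proof -
  have p: "real CARD('p) > 1" using p3 by simp
  have "1 / real CARD('p) = real CARD('p) powr (-1)" using p by (simp add: powr_minus_divide)
  also have "\<dots> < padic_exp_radius TYPE('p)"
    unfolding padic_exp_radius_def using p p3 by (intro powr_less_mono) (auto simp: field_simps)
  finally show "1 / real CARD('p) < padic_exp_radius TYPE('p)" .
  have "padic_exp_radius TYPE('p) < real CARD('p) powr 0"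
    unfolding padic_exp_radius_def using p p3 by (intro powr_less_mono) (auto simp: field_simps)
  thus "padic_exp_radius TYPE('p) < 1" using p by simp
qed

lemma padic_E_iff: "(x :: 'p padic) \<in> padic_E \<longleftrightarrow> padic_norm (x - 1) \<le> 1 / real CARD('p)"
proof
  assume "x \<in> padic_E"
  thus "padic_norm (x - 1) \<le> 1 / real CARD('p)"
    using padic_exp_radius_bounds(2) by (intro padic_norm_less_1) (simp add: padic_E_def)
next
  assume *: "padic_norm (x - 1) \<le> 1 / real CARD('p)"
  also have "\<dots> < 1" using p3 by simp
  finally have "padic_norm x = 1" using padic_norm_eqI[of x 1] by simp
  thus "x \<in> padic_E" using * padic_exp_radius_bounds(1) by (simp add: padic_E_def)
qed

lemma padic_E_iff_less: "(x :: 'p padic) \<in> padic_E \<longleftrightarrow> padic_norm (x - 1) < 1"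
proof -
  have "1 / real CARD('p) < 1" using p3 by simp
  thus ?thesis unfolding padic_E_iff by (metis order_le_less_trans padic_norm_less_1)
qed

lemma padic_E_norm: "(x :: 'p padic) \<in> padic_E \<Longrightarrow> padic_norm x = 1"
  by (simp add: padic_E_def)

lemma padic_E_nonzero: "(x :: 'p padic) \<in> padic_E \<Longrightarrow> x \<noteq> 0"
  by (auto simp: padic_E_def)

lemma padic_E_1: "(1 :: 'p padic) \<in> padic_E"
  by (simp add: padic_E_iff)

lemma padic_E_mult: "x * y \<in> padic_E" if "x \<in> padic_E" "y \<in> padic_E" for x y :: "'p padic"
proof -
  have "padic_norm (x * y - 1) \<le> max (padic_norm (x * (y - 1))) (padic_norm (x - 1))"
    by (rule order.trans[OF _ padic_norm_ultra]) (simp add: algebra_simps)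
  also have "\<dots> < 1" using that by (simp add: padic_norm_mult padic_E_norm) (simp add: padic_E_iff_less)
  finally show ?thesis by (simp add: padic_E_iff_less)
qed

lemma padic_E_inverse: "inverse x \<in> padic_E" if "x \<in> padic_E" for x :: "'p padic"
proof -
  have "inverse x - 1 = - (inverse x * (x - 1))"
    using padic_E_nonzero[OF that] by (simp add: algebra_simps)
  thus ?thesis using that
    by (simp add: padic_E_iff padic_norm_minus padic_norm_mult padic_norm_inverse padic_E_norm)
qed

lemma padic_E_divide: "x / y \<in> padic_E" if "x \<in> padic_E" "y \<in> padic_E" for x y :: "'p padic"
  using that by (simp add: divide_inverse padic_E_mult padic_E_inverse)

lemma padic_E_power: "x ^ n \<in> padic_E" if "x \<in> padic_E" for x :: "'p padic"
  by (induction n) (simp_all add: padic_E_1 padic_E_mult that)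

lemma padic_E_powi: "x powi n \<in> padic_E" if "x \<in> padic_E" for x :: "'p padic"
  using that by (simp add: power_int_def padic_E_power padic_E_inverse)

lemma padic_E_prod: "(\<And>i. i \<in> A \<Longrightarrow> f i \<in> padic_E) \<Longrightarrow> prod f A \<in> padic_E"
  for f :: "'a \<Rightarrow> 'p padic"
  by (induction A rule: infinite_finite_induct) (simp_all add: padic_E_1 padic_E_mult)

lemma padic_E_diff_norm: "padic_norm (x - y) \<le> 1 / real CARD('p)"
  if "x \<in> padic_E" "y \<in> padic_E" for x y :: "'p padic"
  using that padic_norm_diff_triangle[of x y 1]
  by (auto simp: padic_E_iff padic_norm_minus_commute[of 1 y])

text \<open>The sum is congruent to 2 modulo p, and 2 is a unit for odd p. All later nonvanishing of
  denominators rests on this.\<close>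

lemma padic_E_sum_norm: "padic_norm (x + y) = 1"
  if "x \<in> padic_E" "y \<in> padic_E" for x y :: "'p padic"
proof -
  have "padic_norm ((x + y) - 2) \<le> max (padic_norm (x - 1)) (padic_norm (y - 1))"
    using padic_norm_ultra[of "x - 1" "y - 1"] by (simp add: algebra_simps)
  also have "\<dots> < 1" using that by (simp add: padic_E_iff_less)
  finally show ?thesis using padic_norm_eqI[of "x + y" 2] by (simp add: padic_norm_2)
qed

lemma padic_E_sum_nonzero: "x + y \<noteq> 0"
  if "x \<in> padic_E" "y \<in> padic_E" for x y :: "'p padic"
  using padic_E_sum_norm[OF that] by auto

text \<open>Sums of two elements are near 2 and leave \<open>padic_E\<close>, but their quotients
  return to it; Moebius maps with coefficients in \<open>padic_E\<close> therefore preserve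
  \<open>padic_E\<close>.\<close>

lemma padic_E_sum_divide: "(x + y) / (z + w) \<in> padic_E"
  if "x \<in> padic_E" "y \<in> padic_E" "z \<in> padic_E" "w \<in> padic_E" for x y z w :: "'p padic"
proof -
  have "(x + y) / (z + w) - 1 = ((x - z) + (y - w)) / (z + w)"
    using padic_E_sum_nonzero[of z w] that by (simp add: field_simps)
  moreover have "padic_norm ((x - z) + (y - w)) \<le> 1 / real CARD('p)"
    using padic_norm_ultra[of "x - z" "y - w"] padic_E_diff_norm[of x z] padic_E_diff_norm[of y w] that
    by simp
  ultimately show ?thesis using padic_E_sum_norm[of z w] that
    by (simp add: padic_E_iff padic_norm_divide)
qed

text \<open>
  Since \<open>i * (k choose i) = k * (k - 1 choose i - 1)\<close>, the binomial expansion of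
  \<open>(1 + y) ^ k - 1\<close> is \<open>k * y\<close> times a unit: \<open>y ^ (i - 1) / i\<close> has norm at most
  \<open>i / p ^ (i - 1) < 1\<close> for \<open>i \<ge> 2\<close>. This fails for \<open>p = 2\<close>, where \<open>-1\<close> is a torsion element.
\<close>

lemma padic_E_power_eq_1:
  fixes x :: "'p padic"
  assumes x: "x \<in> padic_E" and k: "k \<ge> 1" and eq: "x ^ k = 1"
  shows "x = 1"
proof (rule ccontr)
  assume "x \<noteq> 1"
  define y where "y = x - 1"
  have y: "y \<noteq> 0" "padic_norm y \<le> 1 / real CARD('p)"
    using \<open>x \<noteq> 1\<close> x by (simp_all add: y_def padic_E_iff)
  obtain n where n: "k = Suc n" using k by (cases k) auto
  \<comment> \<open>The terms of \<open>(1 + y) ^ k - 1\<close> are \<open>k * y * c i\<close> with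
    \<open>c 0 = 1\<close>, so the factor \<open>k * y\<close> can be cancelled and the remaining
    sum has to vanish.\<close>
  define c where "c = (\<lambda>i. of_nat (n choose i) * y ^ i / of_nat (Suc i) :: 'p padic)"
  have "1 = (y + 1) ^ k" using eq by (simp add: y_def)
  also have "\<dots> = 1 + (\<Sum>i\<le>n. of_nat (k choose Suc i) * y ^ Suc i)"
    unfolding binomial_ring n by (subst sum.atMost_Suc_shift) simp
  also have "(\<Sum>i\<le>n. of_nat (k choose Suc i) * y ^ Suc i) = (\<Sum>i\<le>n. of_nat k * y * c i)"
  proof (intro sum.cong refl)
    fix i
    have "of_nat (Suc i) * of_nat (k choose Suc i) = (of_nat k * of_nat (n choose i) :: 'p padic)"
      unfolding n by (metis Suc_times_binomial_eq mult.commute of_nat_mult)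
    hence "of_nat (k choose Suc i) = (of_nat k * of_nat (n choose i) / of_nat (Suc i) :: 'p padic)"
      by (metis nonzero_mult_div_cancel_left of_nat_neq_0)
    thus "of_nat (k choose Suc i) * y ^ Suc i = of_nat k * y * c i"
      by (simp add: c_def)
  qed
  finally have "sum c {..n} = 0"
    using y(1) k by (simp flip: sum_distrib_left)
  moreover have "padic_norm (sum c {..n}) = 1"
  proof -
    have "padic_norm (c i) \<le> 1 / real CARD('p)" if i: "i \<in> {1..n}" for i
    proof (rule padic_norm_less_1)
      have "padic_norm (c i) = padic_norm (of_nat (n choose i) :: 'p padic) * padic_norm y ^ i
              / padic_norm (of_nat (Suc i) :: 'p padic)"
        by (simp add: c_def padic_norm_mult padic_norm_divide padic_norm_power del: of_nat_Suc)
      also have "\<dots> \<le> 1 * (1 / real CARD('p)) ^ i / (1 / real (Suc i))"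
        using y(2) by (intro frac_le mult_mono power_mono padic_norm_of_nat_ge)
          (simp_all add: padic_norm_nonneg padic_norm_of_nat_le del: of_nat_Suc)
      also have "\<dots> \<le> real (Suc i) * (1 / 3) ^ i"
        using p3 by (simp add: field_simps power_one_over power_mono del: of_nat_Suc)
      also have "\<dots> < 1"
      proof -
        \<comment> \<open>Strict from \<open>j = 1\<close> on; with base 2 equality would hold at
          \<open>j = 1\<close>, which is how p = 2 drops out.\<close>
        have "Suc j < 3 ^ j" if "j \<ge> 1" for j :: nat
          using that by (induction j rule: dec_induct) auto
        from this[of i] i have "real (Suc i) < 3 ^ i"
          by (metis atLeastAtMost_iff of_nat_less_iff of_nat_numeral of_nat_power)
        thus ?thesis by (simp add: field_simps power_one_over del: of_nat_Suc)
      qed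
      finally show "padic_norm (c i) < 1" .
    qed
    hence "padic_norm (sum c {1..n}) \<le> 1 / real CARD('p)" by (intro padic_norm_sum_le) auto
    moreover have "sum c {..n} = 1 + sum c {1..n}"
      by (simp add: atMost_atLeast0 sum.atLeast_Suc_atMost c_def)
    ultimately have "sum c {..n} \<in> padic_E" by (simp add: padic_E_iff)
    thus ?thesis by (rule padic_E_norm)
  qed
  ultimately show False by simp
qed

section \<open>Convergence and functional equation of the exponential\<close>

lemma padic_exp_term_norm:
  fixes x :: "'p padic"
  assumes "padic_norm x \<le> 1 / real CARD('p)"
  shows "padic_norm (x ^ n / fact n) \<le> (1 / sqrt (real CARD('p))) ^ n"
proof -
  let ?p = "real CARD('p)"
  let ?m = "multiplicity CARD('p) (fact n :: nat)"
  have p: "?p > 1" using p3 by simp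
  \<comment> \<open>As p - 1 >= 2, the factorial loses at most p^(n/2) against the factor p^(-n) of
    \<open>x ^ n\<close>. This is the origin of the ratio 1/sqrt p in the geometric bound.\<close>
  have "2 * ?m \<le> (CARD('p) - 1) * ?m" using p3 by (intro mult_right_mono) auto
  also have "\<dots> \<le> n" by (rule multiplicity_fact_le[OF prime_card])
  finally have m: "2 * ?m \<le> n" .
  have "padic_norm (fact n :: 'p padic) = (1 / ?p) ^ ?m"
    using padic_norm_of_nat[of "fact n", where 'p='p] by simp
  hence "padic_norm (x ^ n / fact n) = padic_norm x ^ n * ?p ^ ?m"
    by (simp add: padic_norm_divide padic_norm_power power_one_over)
  also have "\<dots> \<le> (1 / ?p) ^ n * ?p ^ ?m"
    using assms p by (intro mult_right_mono power_mono) (auto simp: padic_norm_nonneg)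
  also have "?p ^ ?m = sqrt ?p ^ (2 * ?m)" by (simp add: power_mult)
  also have "\<dots> \<le> sqrt ?p ^ n" using p m by (intro power_increasing) auto
  also have "(1 / ?p) ^ n * sqrt ?p ^ n = (1 / sqrt ?p) ^ n"
    using p by (simp add: field_simps flip: power_mult_distrib)
  finally show ?thesis using p by (simp add: mult_left_mono)
qed

lemma padic_exp_summable:
  fixes x :: "'p padic"
  assumes "padic_norm x \<le> 1 / real CARD('p)"
  shows "summable (\<lambda>n. x ^ n / fact n)"
proof (rule padic_summable)
  have lim: "(\<lambda>n. (1 / sqrt (real CARD('p))) ^ n) \<longlonglongrightarrow> 0"
    using p3 by (intro LIMSEQ_power_zero) simp
  show "(\<lambda>n. padic_norm (x ^ n / fact n)) \<longlonglongrightarrow> 0"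
    by (rule Lim_null_comparison[OF _ lim])
      (simp add: padic_exp_term_norm[OF assms] padic_norm_nonneg)
qed

lemma padic_exp_tail:
  fixes x :: "'p padic"
  assumes "padic_norm x \<le> 1 / real CARD('p)"
  shows "padic_norm (padic_exp x - (\<Sum>n<N. x ^ n / fact n)) \<le> (1 / sqrt (real CARD('p))) ^ N"
  unfolding padic_exp_def
proof (rule padic_suminf_tail[OF padic_exp_summable[OF assms]])
  show "0 < (1 / sqrt (real CARD('p))) ^ N" using p3 by simp
  fix n assume "N \<le> n"
  hence "(1 / sqrt (real CARD('p))) ^ n \<le> (1 / sqrt (real CARD('p))) ^ N"
    using p3 by (intro power_decreasing) auto
  thus "padic_norm (x ^ n / fact n) \<le> (1 / sqrt (real CARD('p))) ^ N"
    using padic_exp_term_norm[OF assms, of n] by simp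
qed

text \<open>The tail estimate from the first power on only gives the distance 1/sqrt p from 1, but
  any distance below 1 suffices, by discreteness of the norm.\<close>

lemma padic_exp_in_E:
  fixes x :: "'p padic"
  assumes "padic_norm x \<le> 1 / real CARD('p)"
  shows "padic_exp x \<in> padic_E"
proof -
  have "1 / sqrt (real CARD('p)) < 1" using p3 by simp
  moreover have "padic_norm (padic_exp x - 1) \<le> 1 / sqrt (real CARD('p))"
    using padic_exp_tail[OF assms, of 1] by simp
  ultimately show ?thesis unfolding padic_E_iff_less by (rule order.strict_trans1[rotated])
qed

text \<open>Both sides are compared through truncations at \<open>N\<close>. Every error, including
  the mixed terms of total degree at least \<open>N\<close>, is at most \<open>r ^ N\<close>, and
  \<open>N\<close> is arbitrary.\<close>

lemma padic_exp_add:
  fixes x y :: "'p padic"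
  assumes x: "padic_norm x \<le> 1 / real CARD('p)" and y: "padic_norm y \<le> 1 / real CARD('p)"
  shows "padic_exp (x + y) = padic_exp x * padic_exp y"
proof -
  define r where "r = 1 / sqrt (real CARD('p))"
  have r: "0 < r" "r < 1" using p3 by (simp_all add: r_def)
  define t where "t = (\<lambda>(z :: 'p padic) n. z ^ n / fact n)"
  define S where "S = (\<lambda>z N. sum (t z) {..<N})"
  have xy: "padic_norm (x + y) \<le> 1 / real CARD('p)"
    using padic_norm_ultra[of x y] x y by simp
  have "padic_norm (padic_exp (x + y) - padic_exp x * padic_exp y) \<le> r ^ N" for N
  proof -
    have tail: "padic_norm (padic_exp z - S z N) \<le> r ^ N" if "padic_norm z \<le> 1 / real CARD('p)" for z
      using padic_exp_tail[OF that] by (simp add: S_def t_def r_def)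
    have tn: "padic_norm (t z n) \<le> r ^ n" if "padic_norm z \<le> 1 / real CARD('p)" for z n
      using padic_exp_term_norm[OF that] by (simp add: t_def r_def)
    have Sy: "padic_norm (S y N) \<le> 1"
      unfolding S_def using r by (intro padic_norm_sum_le order.trans[OF tn[OF y]] power_le_one) auto
    have Ex: "padic_norm (padic_exp x) = 1" using padic_E_norm padic_exp_in_E x by blast
    \<comment> \<open>The product of the truncations runs over the square \<open>A\<close>, the
      truncation of exp(x + y) over the triangle \<open>B\<close>; their difference consists of the
      terms with \<open>i + j >= N\<close>.\<close>
    define A where "A = {..<N} \<times> {..<N}"
    define B where "B = {(i, j). i + j < N}"
    have AB: "finite A" "B \<subseteq> A" by (auto simp: A_def B_def)
    have "S x N * S y N = (\<Sum>(i, j)\<in>A. t x i * t y j)"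
      by (simp add: S_def A_def sum_product sum.cartesian_product)
    moreover have "S (x + y) N = (\<Sum>(i, j)\<in>B. t x i * t y j)"
      by (simp add: S_def B_def t_def binomial_exp_sum sum.triangle_reindex)
    ultimately have "S x N * S y N - S (x + y) N = (\<Sum>(i, j)\<in>A - B. t x i * t y j)"
      using AB by (simp add: sum_diff)
    also have "padic_norm \<dots> \<le> r ^ N"
    proof (rule padic_norm_sum_le)
      fix q assume "q \<in> A - B"
      then obtain i j where q: "q = (i, j)" "i + j \<ge> N" by (auto simp: A_def B_def not_less)
      have "padic_norm (t x i * t y j) \<le> r ^ i * r ^ j"
        unfolding padic_norm_mult using r tn x y by (intro mult_mono) (auto simp: padic_norm_nonneg)
      also have "\<dots> \<le> r ^ N" using r q(2) by (simp add: power_decreasing flip: power_add)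
      finally show "padic_norm (case q of (i, j) \<Rightarrow> t x i * t y j) \<le> r ^ N" by (simp add: q)
    qed (use r in simp)
    finally have 1: "padic_norm (S x N * S y N - S (x + y) N) \<le> r ^ N" .
    have 2: "padic_norm (padic_exp x * (padic_exp y - S y N)) \<le> r ^ N"
      using tail[OF y] by (simp add: padic_norm_mult Ex)
    have 3: "padic_norm ((padic_exp x - S x N) * S y N) \<le> r ^ N"
      using mult_mono[OF tail[OF x] Sy] r by (simp add: padic_norm_mult padic_norm_nonneg)
    have "padic_exp (x + y) - padic_exp x * padic_exp y
        = ((padic_exp (x + y) - S (x + y) N) - (S x N * S y N - S (x + y) N))
          - (padic_exp x * (padic_exp y - S y N) + (padic_exp x - S x N) * S y N)"
      by (simp add: algebra_simps)
    also have "padic_norm \<dots> \<le> r ^ N"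
      by (rule order.trans[OF padic_norm_diff_le max.boundedI[OF order.trans[OF padic_norm_diff_le]
            order.trans[OF padic_norm_ultra]]]) (use 1 2 3 tail[OF xy] in simp_all)
    finally show ?thesis .
  qed
  moreover have "(\<lambda>N. r ^ N) \<longlonglongrightarrow> 0" using r by (intro LIMSEQ_power_zero) simp
  ultimately have "padic_norm (padic_exp (x + y) - padic_exp x * padic_exp y) \<le> 0"
    by (intro LIMSEQ_le_const[of "\<lambda>N. r ^ N"]) auto
  thus ?thesis using padic_norm_nonneg[of "padic_exp (x + y) - padic_exp x * padic_exp y"]
    by (simp add: padic_norm_eq_0_iff)
qed

end

section \<open>The fixed-point equation on an edge\<close>

lemma padic_norm_mult_diff_le:
  fixes x x' y y' :: "'p::prime_card padic"
  assumes "padic_norm x' \<le> 1" "padic_norm y \<le> 1" "padic_norm (x - x') \<le> e" "padic_norm (y - y') \<le> e"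
  shows "padic_norm (x * y - x' * y') \<le> e"
proof -
  have "x * y - x' * y' = (x - x') * y + x' * (y - y')" by (simp add: algebra_simps)
  moreover have "padic_norm ((x - x') * y) \<le> e"
    using assms mult_mono[of "padic_norm (x - x')" e "padic_norm y" 1] padic_norm_nonneg[of "x - x'"]
    by (simp add: padic_norm_mult padic_norm_nonneg)
  moreover have "padic_norm (x' * (y - y')) \<le> e"
    using assms mult_mono[of "padic_norm x'" 1 "padic_norm (y - y')" e] padic_norm_nonneg[of "y - y'"]
    by (simp add: padic_norm_mult padic_norm_nonneg)
  ultimately show ?thesis using padic_norm_ultra[of "(x - x') * y" "x' * (y - y')"] by simp
qed

text \<open>Powers are 1-Lipschitz on the unit ball, whatever \<open>k\<close> is, so an outer k-th
  power keeps a contraction factor.\<close>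

lemma padic_norm_power_diff_le:
  fixes x y :: "'p::prime_card padic"
  assumes "padic_norm x \<le> 1" "padic_norm y \<le> 1"
  shows "padic_norm (x ^ k - y ^ k) \<le> padic_norm (x - y)"
proof (induction k)
  case (Suc k)
  show ?case unfolding power_Suc
    using assms Suc by (intro padic_norm_mult_diff_le) (simp_all add: padic_norm_power power_le_one padic_norm_nonneg)
qed (simp add: padic_norm_nonneg)

text \<open>The spins \<open>s\<close>, \<open>t\<close>, \<open>e\<close> sit on three consecutive
  vertices of a path leading away from the root: \<open>a\<close> weighs the nearest-neighbour pair
  (t, e), \<open>b\<close> the prolonged pair (s, e), and the spin \<open>e\<close> of the outermost
  vertex is summed out.\<close>

definition edge_sum :: "'a::field \<Rightarrow> 'a \<Rightarrow> (int \<Rightarrow> int \<Rightarrow> 'a) \<Rightarrow> int \<Rightarrow> int \<Rightarrow> 'a" where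
  "edge_sum a b g s t = (\<Sum>e\<in>{-1, 1}. a powi (t * e) * b powi (s * e) * g t e)"

text \<open>Only \<open>a * b\<close> and \<open>a / b\<close> occur; they are the parameters
  \<open>c\<close> and \<open>d\<close> of the Moebius maps below.\<close>

lemma edge_sum_expand:
  fixes a b :: "'a::field"
  assumes "a \<noteq> 0" "b \<noteq> 0"
  shows "edge_sum a b g 1 1 = (a * b) * g 1 1 + inverse (a * b) * g 1 (-1)"
    and "edge_sum a b g (-1) 1 = (a / b) * g 1 1 + inverse (a / b) * g 1 (-1)"
    and "edge_sum a b g 1 (-1) = inverse (a / b) * g (-1) 1 + (a / b) * g (-1) (-1)"
    and "edge_sum a b g (-1) (-1) = inverse (a * b) * g (-1) 1 + (a * b) * g (-1) (-1)"
  using assms by (simp_all add: edge_sum_def power_int_minus field_simps)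

section \<open>Contraction estimates, existence and uniqueness of the fixed point\<close>

context
  assumes p3: "CARD('p::prime_card) \<ge> 3"
begin

text \<open>The difference equals determinant times \<open>x - y\<close> over two unit denominators,
  and the determinant is a difference of two elements of \<open>padic_E\<close>.\<close>

lemma mobius_contraction:
  fixes \<alpha> \<beta> \<gamma> \<delta> x y :: "'p padic"
  assumes E: "\<alpha> \<in> padic_E" "\<beta> \<in> padic_E" "\<gamma> \<in> padic_E" "\<delta> \<in> padic_E" "x \<in> padic_E" "y \<in> padic_E"
  shows "padic_norm ((\<alpha> * x + \<beta>) / (\<gamma> * x + \<delta>) - (\<alpha> * y + \<beta>) / (\<gamma> * y + \<delta>))
         \<le> padic_norm (x - y) / real CARD('p)"
proof -
  have nz: "\<gamma> * x + \<delta> \<noteq> 0" "\<gamma> * y + \<delta> \<noteq> 0"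
    using E by (simp_all add: padic_E_sum_nonzero[OF p3] padic_E_mult[OF p3])
  have "(\<alpha> * x + \<beta>) / (\<gamma> * x + \<delta>) - (\<alpha> * y + \<beta>) / (\<gamma> * y + \<delta>)
      = ((\<alpha> * x + \<beta>) * (\<gamma> * y + \<delta>) - (\<alpha> * y + \<beta>) * (\<gamma> * x + \<delta>)) / ((\<gamma> * x + \<delta>) * (\<gamma> * y + \<delta>))"
    by (rule diff_frac_eq[OF nz])
  also have "(\<alpha> * x + \<beta>) * (\<gamma> * y + \<delta>) - (\<alpha> * y + \<beta>) * (\<gamma> * x + \<delta>) = (\<alpha> * \<delta> - \<beta> * \<gamma>) * (x - y)"
    by (simp add: algebra_simps)
  also have "padic_norm (\<dots> / ((\<gamma> * x + \<delta>) * (\<gamma> * y + \<delta>))) = padic_norm (\<alpha> * \<delta> - \<beta> * \<gamma>) * padic_norm (x - y)"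
    using E by (simp add: padic_norm_divide padic_norm_mult padic_E_sum_norm[OF p3] padic_E_mult[OF p3])
  also have "\<dots> \<le> 1 / real CARD('p) * padic_norm (x - y)"
    using E by (intro mult_right_mono padic_E_diff_norm[OF p3]) (simp_all add: padic_E_mult[OF p3] padic_norm_nonneg)
  finally show ?thesis by simp
qed

lemma padic_norm_divide_diff_le:
  fixes x x' y y' :: "'p padic"
  assumes "x \<in> padic_E" "x' \<in> padic_E" "y \<in> padic_E" "y' \<in> padic_E"
    "padic_norm (x - x') \<le> e" "padic_norm (y - y') \<le> e"
  shows "padic_norm (x / y - x' / y') \<le> e"
proof -
  have "inverse y - inverse y' = - (inverse y * (y - y') * inverse y')"
    using assms padic_E_nonzero[OF p3] by (intro inverse_diff_inverse) auto
  hence "padic_norm (inverse y - inverse y') = padic_norm (y - y')"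
    using assms by (simp add: padic_norm_minus padic_norm_mult padic_norm_inverse padic_E_norm[OF p3])
  thus ?thesis unfolding divide_inverse using assms
    by (intro padic_norm_mult_diff_le) (simp_all add: padic_norm_inverse padic_E_norm[OF p3])
qed

text \<open>\<open>padic_E\<close> is the closed ball of radius 1/p around 1 in a complete space, so
  Banach's theorem applies with constant 1/p.\<close>

lemma symmetric_fixed_point:
  fixes c d :: "'p padic"
  assumes c: "c \<in> padic_E" and d: "d \<in> padic_E"
  shows "\<exists>w\<in>padic_E. w = ((c * w + inverse c) / (d * w + inverse d)) ^ k"
proof -
  let ?m = "\<lambda>w. (c * w + inverse c) / (d * w + inverse d)"
  have m: "?m w \<in> padic_E" if "w \<in> padic_E" for w
    using c d that by (intro padic_E_sum_divide[OF p3] padic_E_mult[OF p3] padic_E_inverse[OF p3])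
  have "(padic_E :: 'p padic set) = cball 1 (1 / real CARD('p))"
    by (auto simp: padic_E_iff[OF p3] dist_padic_def padic_norm_minus_commute)
  hence "complete (padic_E :: 'p padic set)" by (metis closed_cball complete_eq_closed)
  moreover have "(padic_E :: 'p padic set) \<noteq> {}" using padic_E_1[OF p3] by blast
  moreover have "\<forall>x\<in>padic_E. \<forall>y\<in>padic_E. dist (?m x ^ k) (?m y ^ k) \<le> 1 / real CARD('p) * dist x y"
  proof (intro ballI)
    fix x y :: "'p padic" assume xy: "x \<in> padic_E" "y \<in> padic_E"
    have "padic_norm (?m x ^ k - ?m y ^ k) \<le> padic_norm (?m x - ?m y)"
      using m xy by (intro padic_norm_power_diff_le) (simp_all add: padic_E_norm[OF p3])
    also have "\<dots> \<le> padic_norm (x - y) / real CARD('p)"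
      using c d xy by (intro mobius_contraction padic_E_inverse[OF p3])
    finally show "dist (?m x ^ k) (?m y ^ k) \<le> 1 / real CARD('p) * dist x y"
      by (simp add: dist_padic_def)
  qed
  moreover have "(\<lambda>w. ?m w ^ k) ` padic_E \<subseteq> padic_E" using m padic_E_power[OF p3] by blast
  ultimately have "\<exists>!w\<in>padic_E. ?m w ^ k = w"
    using p3 by (intro Banach_fix[of padic_E "1 / real CARD('p)" "\<lambda>w. ?m w ^ k"]) auto
  thus ?thesis by metis
qed

lemma edge_sum_fixed_point_exists:
  fixes a b :: "'p padic"
  assumes a: "a \<in> padic_E" and b: "b \<in> padic_E"
  shows "\<exists>g. (\<forall>s t. g s t \<in> padic_E) \<and>
           (\<exists>l. \<forall>s\<in>{-1, 1}. \<forall>t\<in>{-1, 1}. edge_sum a b g s t ^ k = l * g s t)"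
proof -
  let ?c = "a * b" and ?d = "a / b"
  obtain w where w: "w \<in> padic_E" "w = ((?c * w + inverse ?c) / (?d * w + inverse ?d)) ^ k"
    using symmetric_fixed_point[of ?c ?d k] a b padic_E_mult[OF p3] padic_E_divide[OF p3] by metis
  \<comment> \<open>With this \<open>g\<close> the edge sum is \<open>?c * w + inverse ?c\<close>
    for equal signs and \<open>?d * w + inverse ?d\<close> for opposite signs. The opposite signs
    force the value of \<open>l\<close>, and the equal signs then say that \<open>w\<close> is the
    fixed point.\<close>
  define g where "g = (\<lambda>s t :: int. if s = t then w else 1)"
  have nz: "?d * w + inverse ?d \<noteq> 0"
    using a b w(1) by (intro padic_E_sum_nonzero[OF p3] padic_E_mult[OF p3] padic_E_inverse[OF p3] padic_E_divide[OF p3])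
  have *: "(?c * w + inverse ?c) ^ k = (?d * w + inverse ?d) ^ k * w"
    using nz by (subst (3) w(2)) (simp add: power_divide)
  have "\<forall>s\<in>{-1, 1}. \<forall>t\<in>{-1, 1}. edge_sum a b g s t ^ k = (?d * w + inverse ?d) ^ k * g s t"
    using a b * by (simp add: edge_sum_expand padic_E_nonzero[OF p3] g_def add.commute)
  moreover have "\<forall>s t. g s t \<in> padic_E" using w(1) padic_E_1[OF p3] by (simp add: g_def)
  ultimately show ?thesis by blast
qed

text \<open>
  The unknowns are \<open>r\<^sub>1 = g\<^sub>+\<^sub>+ / g\<^sub>+\<^sub>-\<close>, \<open>r\<^sub>2 = g\<^sub>-\<^sub>+ / g\<^sub>-\<^sub>-\<close>, \<open>v\<^sub>1 = g\<^sub>+\<^sub>+ / g\<^sub>-\<^sub>+\<close> and \<open>v\<^sub>2 = g\<^sub>+\<^sub>- / g\<^sub>-\<^sub>-\<close>.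
  The last equation is not contracting in \<open>r\<^sub>1\<close>, but it is in \<open>r\<^sub>2\<close> once \<open>r\<^sub>1\<close> is written as
  \<open>r\<^sub>2 * (v\<^sub>1 / v\<^sub>2)\<close>, and \<open>v\<^sub>1\<close>, \<open>v\<^sub>2\<close> are contracting functions of \<open>r\<^sub>1\<close>, \<open>r\<^sub>2\<close>.
\<close>

lemma ratio_system_unique:
  fixes c d :: "'p padic" and r1 r2 v1 v2 q1 q2 w1 w2
  assumes c: "c \<in> padic_E" and d: "d \<in> padic_E"
    and E: "r1 \<in> padic_E" "r2 \<in> padic_E" "v1 \<in> padic_E" "v2 \<in> padic_E"
           "q1 \<in> padic_E" "q2 \<in> padic_E" "w1 \<in> padic_E" "w2 \<in> padic_E"
    and v1: "v1 = ((c * r1 + inverse c) / (d * r1 + inverse d)) ^ k"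
    and v2: "v2 = ((inverse d * r2 + d) / (inverse c * r2 + c)) ^ k"
    and r1: "r1 = r2 * (v1 / v2)"
    and r2: "r2 = (v2 * ((d * r1 + inverse d) / (inverse c * r2 + c))) ^ k"
    and w1: "w1 = ((c * q1 + inverse c) / (d * q1 + inverse d)) ^ k"
    and w2: "w2 = ((inverse d * q2 + d) / (inverse c * q2 + c)) ^ k"
    and q1: "q1 = q2 * (w1 / w2)"
    and q2: "q2 = (w2 * ((d * q1 + inverse d) / (inverse c * q2 + c))) ^ k"
  shows "r2 = q2 \<and> v1 = w1 \<and> v2 = w2"
proof -
  note intros = padic_E_sum_divide[OF p3] padic_E_mult[OF p3] padic_E_inverse[OF p3] padic_E_divide[OF p3]
  note cd = c d padic_E_inverse[OF p3 c] padic_E_inverse[OF p3 d]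
  \<comment> \<open>\<open>D\<close> is the distance of the two solutions in the r-coordinates. All
    coordinates are shown to differ by at most \<open>e\<close>, that is D/p, which leaves only
    \<open>D = 0\<close>.\<close>
  define D where "D = max (padic_norm (r1 - q1)) (padic_norm (r2 - q2))"
  define e where "e = D / real CARD('p)"
  have pow: "padic_norm (x ^ k - y ^ k) \<le> e"
    if "x \<in> padic_E" "y \<in> padic_E" "padic_norm (x - y) \<le> e" for x y :: "'p padic"
    using padic_norm_power_diff_le[of x y k] that by (simp add: padic_E_norm[OF p3])
  have mob: "padic_norm ((\<alpha> * x + \<beta>) / (\<gamma> * x + \<delta>) - (\<alpha> * y + \<beta>) / (\<gamma> * y + \<delta>)) \<le> e"
    if "\<alpha> \<in> padic_E" "\<beta> \<in> padic_E" "\<gamma> \<in> padic_E" "\<delta> \<in> padic_E" "x \<in> padic_E" "y \<in> padic_E"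
      "padic_norm (x - y) \<le> D" for \<alpha> \<beta> \<gamma> \<delta> x y :: "'p padic"
  proof -
    have "padic_norm (x - y) / real CARD('p) \<le> e"
      unfolding e_def using that(7) by (intro divide_right_mono) auto
    thus ?thesis using mobius_contraction[OF that(1-6)] by linarith
  qed
  have D: "padic_norm (r1 - q1) \<le> D" "padic_norm (r2 - q2) \<le> D" by (simp_all add: D_def)
  have dv1: "padic_norm (v1 - w1) \<le> e" unfolding v1 w1
    by (intro pow mob intros cd E D)
  have dv2: "padic_norm (v2 - w2) \<le> e" unfolding v2 w2
    by (intro pow mob intros cd E D)
  have drho: "padic_norm (v1 / v2 - w1 / w2) \<le> e"
    by (intro padic_norm_divide_diff_le E dv1 dv2)
  define K where "K = (\<lambda>\<rho> r. (d * \<rho> * r + inverse d) / (inverse c * r + c))"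
  have K: "(d * r1 + inverse d) / (inverse c * r2 + c) = K (v1 / v2) r2"
    "(d * q1 + inverse d) / (inverse c * q2 + c) = K (w1 / w2) q2"
    unfolding K_def by (subst r1 q1, simp add: mult_ac)+
  have KE: "K (v1 / v2) r2 \<in> padic_E" "K (w1 / w2) q2 \<in> padic_E"
    unfolding K_def by (intro intros cd E)+
  \<comment> \<open>The two arguments of \<open>K\<close> are changed one at a time. In
    \<open>r\<close> it is a contracting Moebius map; in the ratio it is affine with unit slope, and
    the ratios are already known to differ by at most \<open>e\<close>.\<close>
  have dK: "padic_norm (K (v1 / v2) r2 - K (w1 / w2) q2) \<le> e"
  proof -
    have 1: "padic_norm (K (v1 / v2) r2 - K (v1 / v2) q2) \<le> e"
      unfolding K_def by (intro mob intros cd E D)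
    have "K (v1 / v2) q2 - K (w1 / w2) q2 = d * q2 * (v1 / v2 - w1 / w2) / (inverse c * q2 + c)"
      by (simp add: K_def diff_divide_distrib[symmetric] algebra_simps)
    also have "padic_norm \<dots> = padic_norm (v1 / v2 - w1 / w2)"
      using cd E by (simp add: padic_norm_mult padic_norm_divide padic_E_norm[OF p3]
          padic_E_sum_norm[OF p3] padic_E_mult[OF p3])
    finally have 2: "padic_norm (K (v1 / v2) q2 - K (w1 / w2) q2) \<le> e" using drho by simp
    show ?thesis by (rule order.trans[OF padic_norm_diff_triangle max.boundedI[OF 1 2]])
  qed
  have dr2: "padic_norm (r2 - q2) \<le> e"
  proof -
    have "padic_norm (v2 * K (v1 / v2) r2 - w2 * K (w1 / w2) q2) \<le> e"
      by (rule padic_norm_mult_diff_le[OF _ _ dv2 dK]) (simp_all add: E KE padic_E_norm[OF p3])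
    hence "padic_norm ((v2 * K (v1 / v2) r2) ^ k - (w2 * K (w1 / w2) q2) ^ k) \<le> e"
      by (intro pow padic_E_mult[OF p3] E KE)
    thus ?thesis by (simp only: r2[unfolded K, symmetric] q2[unfolded K, symmetric])
  qed
  have dr1: "padic_norm (r1 - q1) \<le> e"
  proof -
    have "padic_norm (r2 * (v1 / v2) - q2 * (w1 / w2)) \<le> e"
      by (rule padic_norm_mult_diff_le[OF _ _ dr2 drho])
        (simp_all add: E padic_E_norm[OF p3] padic_E_divide[OF p3])
    thus ?thesis by (simp only: r1[symmetric] q1[symmetric])
  qed
  have "D \<le> D / real CARD('p)" using dr1 dr2 by (simp add: D_def e_def)
  moreover have "D \<ge> 0" by (simp add: D_def le_max_iff_disj padic_norm_nonneg)
  ultimately have "D = 0"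
  proof -
    have "D * (real CARD('p) - 1) \<le> 0"
      using \<open>D \<le> D / real CARD('p)\<close> p3 by (simp add: field_simps)
    thus ?thesis using \<open>D \<ge> 0\<close> p3 by (simp add: mult_le_0_iff)
  qed
  hence "e = 0" by (simp add: e_def)
  have "x = y" if "padic_norm (x - y) \<le> e" for x y :: "'p padic"
    using that \<open>e = 0\<close> padic_norm_nonneg[of "x - y"] padic_norm_eq_0_iff[of "x - y"] by simp
  thus ?thesis using dr2 dv1 dv2 by blast
qed

text \<open>Dividing two of the four equations cancels \<open>l\<close>. The equations for
  \<open>v1\<close> and \<open>v2\<close> compare sums with the same second sign, whose common
  factor from \<open>g\<close> cancels; in the one for \<open>r2\<close> the second signs differ and
  the factor \<open>v2\<close> survives.\<close>

lemma edge_sum_fixed_point_ratios: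
  fixes a b :: "'p padic" and g
  assumes a: "a \<in> padic_E" and b: "b \<in> padic_E"
    and g: "\<And>s t. s \<in> {-1, 1} \<Longrightarrow> t \<in> {-1, 1} \<Longrightarrow> g s t \<in> padic_E"
    and eq: "\<And>s t. s \<in> {-1, 1} \<Longrightarrow> t \<in> {-1, 1} \<Longrightarrow> edge_sum a b g s t ^ k = l * g s t"
  defines "c \<equiv> a * b" and "d \<equiv> a / b"
    and "r1 \<equiv> g 1 1 / g 1 (-1)" and "r2 \<equiv> g (-1) 1 / g (-1) (-1)"
    and "v1 \<equiv> g 1 1 / g (-1) 1" and "v2 \<equiv> g 1 (-1) / g (-1) (-1)"
  shows "v1 = ((c * r1 + inverse c) / (d * r1 + inverse d)) ^ k"
    and "v2 = ((inverse d * r2 + d) / (inverse c * r2 + c)) ^ k"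
    and "r1 = r2 * (v1 / v2)"
    and "r2 = (v2 * ((d * r1 + inverse d) / (inverse c * r2 + c))) ^ k"
proof -
  have nz: "a \<noteq> 0" "b \<noteq> 0" "g 1 1 \<noteq> 0" "g 1 (-1) \<noteq> 0" "g (-1) 1 \<noteq> 0" "g (-1) (-1) \<noteq> 0"
    using a b g padic_E_nonzero[OF p3] by auto
  have cd: "c \<in> padic_E" "d \<in> padic_E"
    unfolding c_def d_def by (intro padic_E_mult[OF p3] padic_E_divide[OF p3] a b)+
  have F: "edge_sum a b g 1 1 = g 1 (-1) * (c * r1 + inverse c)"
    "edge_sum a b g (-1) 1 = g 1 (-1) * (d * r1 + inverse d)"
    "edge_sum a b g 1 (-1) = g (-1) (-1) * (inverse d * r2 + d)"
    "edge_sum a b g (-1) (-1) = g (-1) (-1) * (inverse c * r2 + c)"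
    unfolding edge_sum_expand[OF nz(1,2)] c_def[symmetric] d_def[symmetric] r1_def r2_def
    using nz by (simp_all add: distrib_left)
  have rE: "r1 \<in> padic_E" "r2 \<in> padic_E"
    unfolding r1_def r2_def using g padic_E_divide[OF p3] by auto
  have "d * r1 + inverse d \<noteq> 0" "inverse c * r2 + c \<noteq> 0"
    by (intro padic_E_sum_nonzero[OF p3] padic_E_mult[OF p3] padic_E_inverse[OF p3] cd rE)+
  hence "edge_sum a b g (-1) 1 \<noteq> 0" unfolding F using nz by simp
  \<comment> \<open>A zero \<open>l\<close> would make the unit \<open>edge_sum a b g (-1) 1\<close>
    a zero of the k-th power.\<close>
  hence l: "l \<noteq> 0" using eq[of "-1" 1] by auto
  have ratio: "(edge_sum a b g s t / edge_sum a b g s' t') ^ k = g s t / g s' t'"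
    if "s \<in> {-1, 1}" "t \<in> {-1, 1}" "s' \<in> {-1, 1}" "t' \<in> {-1, 1}" for s t s' t'
    using that l by (simp add: power_divide eq)
  show "v1 = ((c * r1 + inverse c) / (d * r1 + inverse d)) ^ k"
    using ratio[of 1 1 "-1" 1] nz by (simp add: F v1_def)
  show "v2 = ((inverse d * r2 + d) / (inverse c * r2 + c)) ^ k"
    using ratio[of 1 "-1" "-1" "-1"] nz by (simp add: F v2_def)
  show "r1 = r2 * (v1 / v2)" using nz by (simp add: r1_def r2_def v1_def v2_def)
  show "r2 = (v2 * ((d * r1 + inverse d) / (inverse c * r2 + c))) ^ k"
    using ratio[of "-1" 1 "-1" "-1"] nz by (simp add: F v2_def r2_def)
qed

text \<open>The normalization removes the free scalar: from g(-,+) = 1 the ratio \<open>r2\<close>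
  gives g(-,-), \<open>v1\<close> gives g(+,+), and \<open>v2\<close> then gives g(+,-).\<close>

lemma edge_sum_fixed_point_unique:
  fixes a b :: "'p padic" and g g'
  assumes a: "a \<in> padic_E" and b: "b \<in> padic_E"
    and g: "\<And>s t. s \<in> {-1, 1} \<Longrightarrow> t \<in> {-1, 1} \<Longrightarrow> g s t \<in> padic_E"
    and g': "\<And>s t. s \<in> {-1, 1} \<Longrightarrow> t \<in> {-1, 1} \<Longrightarrow> g' s t \<in> padic_E"
    and eq: "\<And>s t. s \<in> {-1, 1} \<Longrightarrow> t \<in> {-1, 1} \<Longrightarrow> edge_sum a b g s t ^ k = l * g s t"
    and eq': "\<And>s t. s \<in> {-1, 1} \<Longrightarrow> t \<in> {-1, 1} \<Longrightarrow> edge_sum a b g' s t ^ k = l' * g' s t"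
    and norm: "g (-1) 1 = 1" "g' (-1) 1 = 1"
    and st: "s \<in> {-1, 1}" "t \<in> {-1, 1}"
  shows "g s t = g' s t"
proof -
  have E: "g s t / g s' t' \<in> padic_E" "g' s t / g' s' t' \<in> padic_E"
    if "s \<in> {-1, 1}" "t \<in> {-1, 1}" "s' \<in> {-1, 1}" "t' \<in> {-1, 1}" for s t s' t'
    using that g g' by (simp_all only: padic_E_divide[OF p3])
  have "g (-1) 1 / g (-1) (-1) = g' (-1) 1 / g' (-1) (-1) \<and> g 1 1 / g (-1) 1 = g' 1 1 / g' (-1) 1 \<and>
    g 1 (-1) / g (-1) (-1) = g' 1 (-1) / g' (-1) (-1)"
    by (rule ratio_system_unique[OF padic_E_mult[OF p3 a b] padic_E_divide[OF p3 a b] E(1) E(1) E(1) E(1)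
          E(2) E(2) E(2) E(2) edge_sum_fixed_point_ratios[OF a b g eq] edge_sum_fixed_point_ratios[OF a b g' eq']])
       simp_all
  moreover have "g (-1) (-1) \<noteq> 0" "g' (-1) (-1) \<noteq> 0"
    using g g' padic_E_nonzero[OF p3] by auto
  ultimately show ?thesis using st norm by auto
qed

end

section \<open>Levels of the tree and configurations\<close>

lemma level_eq: "level k n = {x. set x \<subseteq> {..<k} \<and> length x = n}"
  using tree_dist_root by (auto simp: level_def tree_vertices_def)

lemma tree_ball_eq: "tree_ball k n = {x. set x \<subseteq> {..<k} \<and> length x \<le> n}"
  by (auto simp: tree_ball_def level_eq)

lemma finite_level: "finite (level k n)"
  unfolding level_eq by (rule finite_lists_length_eq) simp

lemma finite_tree_ball: "finite (tree_ball k n)"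
  unfolding tree_ball_eq by (rule finite_lists_length_le) simp

lemma tree_ball_Suc: "tree_ball k (Suc n) = tree_ball k n \<union> level k (Suc n)"
  by (auto simp: tree_ball_eq level_eq)

lemma tree_ball_level_disjoint: "tree_ball k n \<inter> level k (Suc n) = {}"
  by (auto simp: tree_ball_eq level_eq)

lemma tree_ball_mono: "m \<le> n \<Longrightarrow> tree_ball k m \<subseteq> tree_ball k n"
  by (auto simp: tree_ball_eq)

lemma tree_ball_subset: "tree_ball k n \<subseteq> tree_vertices k"
  by (auto simp: tree_ball_eq tree_vertices_def)

lemma level_subset_tree_ball: "level k n \<subseteq> tree_ball k n"
  by (auto simp: tree_ball_eq level_eq)

lemma butlast_in_level: "y \<in> level k (Suc n) \<Longrightarrow> butlast y \<in> level k n"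
  by (auto simp: level_eq dest: in_set_butlastD)

section \<open>Graph distance, edges and the Hamiltonian in terms of words\<close>

lemma tree_adj_length:
  "(x, y) \<in> tree_adj k ^^ n \<Longrightarrow> length y \<le> length x + n"
  by (induction n arbitrary: y) (fastforce simp: tree_adj_def)+

lemma tree_adj_append: "x @ w \<in> tree_vertices k \<Longrightarrow> (x, x @ w) \<in> tree_adj k ^^ length w"
proof (induction w rule: rev_induct)
  case (snoc i w)
  hence "x @ w \<in> tree_vertices k" "(x @ w, x @ w @ [i]) \<in> tree_adj k"
    by (auto simp: tree_vertices_def tree_adj_def)
  thus ?case using snoc.IH by auto
qed simp

text \<open>\<open>tree_dist\<close> is a \<open>LEAST\<close>, so it is informative only once some
  path is known to exist; here it passes through the root.\<close>

lemma tree_dist_connected: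
  assumes "x \<in> tree_vertices k" "y \<in> tree_vertices k"
  shows "(x, y) \<in> tree_adj k ^^ tree_dist k x y"
proof -
  have "([], x) \<in> (tree_adj k)\<^sup>*" "([], y) \<in> (tree_adj k)\<^sup>*"
    using assms tree_adj_append[of "[]"] by (auto intro: relpow_imp_rtrancl)
  moreover have "sym (tree_adj k)" by (auto simp: sym_def tree_adj_def)
  ultimately have "(x, y) \<in> (tree_adj k)\<^sup>*"
    by (metis rtrancl_trans sym_rtrancl symD)
  hence "\<exists>n. (x, y) \<in> tree_adj k ^^ n" by (rule rtrancl_imp_relpow)
  thus ?thesis unfolding tree_dist_def by (rule LeastI_ex)
qed

text \<open>Each step changes the word length by one. A path of \<open>m\<close> steps that gains
  length \<open>m\<close> never moves towards the root, so its end extends its start.\<close>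

lemma tree_dist_descendant:
  assumes "x \<in> tree_vertices k" "y \<in> tree_vertices k" "length y = length x + m"
  shows "tree_dist k x y = m \<longleftrightarrow> (\<exists>w. y = x @ w)"
proof
  have "\<exists>w. z = x @ w" if "(x, z) \<in> tree_adj k ^^ n" "length z = length x + n" for n z
    using that
  proof (induction n arbitrary: z)
    case (Suc n)
    then obtain u where u: "(x, u) \<in> tree_adj k ^^ n" "(u, z) \<in> tree_adj k" by auto
    from u(1) have "length u \<le> length x + n" by (rule tree_adj_length)
    with u(2) Suc.prems(2) obtain i where "z = u @ [i]" "length u = length x + n"
      by (auto simp: tree_adj_def)
    with Suc.IH[OF u(1)] show ?case by auto
  qed simp
  moreover assume "tree_dist k x y = m"
  ultimately show "\<exists>w. y = x @ w" using tree_dist_connected[OF assms(1,2)] assms(3) by simp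
next
  assume "\<exists>w. y = x @ w"
  then obtain w where w: "y = x @ w" "length w = m" using assms(3) by auto
  show "tree_dist k x y = m" unfolding tree_dist_def
  proof (rule Least_equality)
    show "(x, y) \<in> tree_adj k ^^ m" using tree_adj_append[of x w k] assms(2) w by simp
    show "m \<le> n" if "(x, y) \<in> tree_adj k ^^ n" for n
      using tree_adj_length[OF that] assms(3) by simp
  qed
qed

lemma successors_eq:
  assumes "x \<in> level k n"
  shows "successors k x = {y \<in> level k (Suc n). butlast y = x}"
proof -
  have x: "x \<in> tree_vertices k" "length x = n" using assms by (auto simp: level_eq tree_vertices_def)
  have "tree_dist k x y = 1 \<longleftrightarrow> butlast y = x" if "y \<in> level k (Suc n)" for y
  proof -
    have y: "y \<in> tree_vertices k" "length y = length x + 1"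
      using that x by (auto simp: level_eq tree_vertices_def)
    have "(\<exists>w. y = x @ w) \<longleftrightarrow> butlast y = x"
    proof
      assume "\<exists>w. y = x @ w"
      then obtain w where w: "y = x @ w" "length w = 1" using y(2) by auto
      then obtain i where "y = x @ [i]" by (auto simp: length_Suc_conv)
      thus "butlast y = x" by simp
    next
      assume "butlast y = x"
      hence "y = x @ [last y]" using y(2) by (metis append_butlast_last_id add_is_0 list.size(3) one_neq_zero)
      thus "\<exists>w. y = x @ w" by blast
    qed
    thus ?thesis using tree_dist_descendant[OF x(1) y] by simp
  qed
  thus ?thesis unfolding successors_def using x by (auto simp: tree_dist_root)
qed

lemma card_successors:
  assumes "x \<in> level k n"
  shows "card (successors k x) = k"
proof -
  have "successors k x = (\<lambda>i. x @ [i]) ` {..<k}"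
  proof -
    have "y \<in> (\<lambda>i. x @ [i]) ` {..<k}" if "y \<in> level k (Suc n)" "butlast y = x" for y
    proof -
      have y: "y \<noteq> []" "set y \<subseteq> {..<k}" using that by (auto simp: level_eq)
      have "y = x @ [last y]" using y(1) that(2) by auto
      moreover have "last y \<in> {..<k}" using y last_in_set by blast
      ultimately show ?thesis by blast
    qed
    thus ?thesis using assms unfolding successors_eq[OF assms] by (auto simp: level_eq)
  qed
  thus ?thesis by (simp add: card_image inj_on_def)
qed

text \<open>Each vertex of the next level has exactly one predecessor, so the double product is a
  single one grouped by \<open>butlast\<close>.\<close>

lemma prod_level_successors:
  fixes f :: "vertex \<Rightarrow> vertex \<Rightarrow> 'a::comm_monoid_mult"
  shows "(\<Prod>x\<in>level k n. \<Prod>y\<in>successors k x. f x y) = (\<Prod>y\<in>level k (Suc n). f (butlast y) y)"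
proof -
  have "(\<Prod>x\<in>level k n. \<Prod>y\<in>successors k x. f x y)
      = (\<Prod>x\<in>level k n. \<Prod>y\<in>{y \<in> level k (Suc n). butlast y = x}. f (butlast y) y)"
    by (intro prod.cong) (auto simp: successors_eq)
  also have "\<dots> = (\<Prod>y\<in>level k (Suc n). f (butlast y) y)"
    by (rule prod.group) (auto simp: finite_level butlast_in_level)
  finally show ?thesis .
qed

lemma tree_edges_iff: "(x, y) \<in> tree_edges k \<longleftrightarrow> (\<exists>n. y \<in> level k (Suc n) \<and> x = butlast y)"
proof -
  have "(x, y) \<in> tree_edges k \<longleftrightarrow> x \<in> level k (length x) \<and> y \<in> successors k x"
    by (auto simp: tree_edges_def level_eq tree_vertices_def)
  also have "\<dots> \<longleftrightarrow> x \<in> level k (length x) \<and> y \<in> level k (Suc (length x)) \<and> x = butlast y"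
    by (auto simp: successors_eq)
  also have "\<dots> \<longleftrightarrow> (\<exists>n. y \<in> level k (Suc n) \<and> x = butlast y)"
    using butlast_in_level by (auto simp: level_eq dest: in_set_butlastD)
  finally show ?thesis .
qed

lemma ball_edges_eq: "ball_edges k n = (\<lambda>y. (butlast y, y)) ` (tree_ball k n - {[]})"
proof -
  have "butlast y \<in> tree_ball k n" if "y \<in> tree_ball k n" for y
    using that by (auto simp: tree_ball_eq dest: in_set_butlastD)
  moreover have "(\<exists>m. y \<in> level k (Suc m)) \<longleftrightarrow> y \<noteq> []" if "y \<in> tree_ball k n" for y
    using that by (cases y) (auto simp: level_eq tree_ball_eq)
  ultimately show ?thesis by (auto simp: ball_edges_def tree_edges_iff)
qed

lemma prolonged_pairs_eq:
  "prolonged_pairs k n = (\<lambda>y. (butlast (butlast y), y)) ` {y \<in> tree_ball k n. 2 \<le> length y}"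
proof -
  have *: "(\<exists>w. y = x @ w) \<longleftrightarrow> x = butlast (butlast y)" if "length y = length x + 2" for x y :: vertex
  proof
    assume "\<exists>w. y = x @ w"
    then obtain w where w: "y = x @ w" by blast
    hence "length w = Suc (Suc 0)" using that by simp
    with w obtain i j where "y = x @ [i, j]" by (auto simp: length_Suc_conv)
    thus "x = butlast (butlast y)" by (simp add: butlast_append)
  next
    assume "x = butlast (butlast y)"
    hence "x = take (length x) y" using that by (simp add: butlast_conv_take min_def)
    thus "\<exists>w. y = x @ w" by (metis append_take_drop_id)
  qed
  have "(x, y) \<in> prolonged_pairs k n \<longleftrightarrow> y \<in> tree_ball k n \<and> 2 \<le> length y \<and> x = butlast (butlast y)" for x y
  proof (cases "x \<in> tree_ball k n \<and> y \<in> tree_ball k n \<and> length y = length x + 2")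
    case True
    hence "x \<in> tree_vertices k" "y \<in> tree_vertices k"
      using tree_ball_subset by blast+
    with True have "tree_dist k x y = 2 \<longleftrightarrow> x = butlast (butlast y)"
      using tree_dist_descendant[of x k y 2] * by simp
    thus ?thesis using True by (auto simp: prolonged_pairs_def level_eq tree_ball_eq)
  next
    case False
    have "butlast (butlast y) \<in> tree_ball k n" if "y \<in> tree_ball k n" for y
      using that by (auto simp: tree_ball_eq dest!: in_set_butlastD)
    thus ?thesis using False by (auto simp: prolonged_pairs_def level_eq)
  qed
  thus ?thesis by auto
qed

lemma hamiltonian_eq:
  "hamiltonian k J J1 n \<sigma> =
     J * (\<Sum>y\<in>tree_ball k n - {[]}. of_int (\<sigma> (butlast y)) * of_int (\<sigma> y))
     + J1 * (\<Sum>y\<in>{y \<in> tree_ball k n. 2 \<le> length y}. of_int (\<sigma> (butlast (butlast y))) * of_int (\<sigma> y))"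
  unfolding hamiltonian_def ball_edges_eq prolonged_pairs_eq
  by (subst (1 2) sum.reindex) (auto simp: inj_on_def)

lemma hamiltonian_cong:
  fixes J J1 :: "'a::prime_card padic"
  assumes "\<And>x. x \<in> tree_ball k n \<Longrightarrow> \<sigma> x = \<tau> x"
  shows "hamiltonian k J J1 n \<sigma> = hamiltonian k J J1 n \<tau>"
proof -
  have "butlast y \<in> tree_ball k n" "butlast (butlast y) \<in> tree_ball k n" if "y \<in> tree_ball k n" for y
    using that by (auto simp: tree_ball_eq dest!: in_set_butlastD)
  hence "(\<Sum>y\<in>tree_ball k n - {[]}. of_int (\<sigma> (butlast y)) * of_int (\<sigma> y) :: 'a padic)
      = (\<Sum>y\<in>tree_ball k n - {[]}. of_int (\<tau> (butlast y)) * of_int (\<tau> y))"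
    "(\<Sum>y\<in>{y \<in> tree_ball k n. 2 \<le> length y}. of_int (\<sigma> (butlast (butlast y))) * of_int (\<sigma> y) :: 'a padic)
      = (\<Sum>y\<in>{y \<in> tree_ball k n. 2 \<le> length y}. of_int (\<tau> (butlast (butlast y))) * of_int (\<tau> y))"
    using assms by (intro sum.cong refl; simp)+
  thus ?thesis by (simp only: hamiltonian_eq)
qed

text \<open>For \<open>n >= 1\<close> every vertex of the new level has a grandparent. At
  \<open>n = 0\<close>, \<open>butlast (butlast y)\<close> would still be the root and produce
  spurious \<open>J1\<close> terms.\<close>

lemma hamiltonian_Suc:
  assumes "1 \<le> n"
  shows "hamiltonian k J J1 (Suc n) \<sigma> = hamiltonian k J J1 n \<sigma> +
    (\<Sum>y\<in>level k (Suc n). J * of_int (\<sigma> (butlast y) * \<sigma> y) + J1 * of_int (\<sigma> (butlast (butlast y)) * \<sigma> y))"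
proof -
  have "tree_ball k (Suc n) - {[]} = (tree_ball k n - {[]}) \<union> level k (Suc n)"
    "{y \<in> tree_ball k (Suc n). 2 \<le> length y} = {y \<in> tree_ball k n. 2 \<le> length y} \<union> level k (Suc n)"
    "(tree_ball k n - {[]}) \<inter> level k (Suc n) = {}"
    "{y \<in> tree_ball k n. 2 \<le> length y} \<inter> level k (Suc n) = {}"
    using assms by (auto simp: tree_ball_eq level_eq)
  thus ?thesis unfolding hamiltonian_eq
    by (simp add: sum.union_disjoint finite_tree_ball finite_level sum.distrib
        sum_distrib_left algebra_simps)
qed

section \<open>Configurations on disjoint vertex sets\<close>

lemma configs_values: "\<sigma> \<in> configs A \<Longrightarrow> x \<in> A \<Longrightarrow> \<sigma> x \<in> {-1, 1}"
  by (auto simp: configs_def)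

lemma finite_configs: "finite A \<Longrightarrow> finite (configs A)"
  by (simp add: configs_def finite_PiE)

lemma card_configs: "finite A \<Longrightarrow> card (configs A) = 2 ^ card A"
  by (simp add: configs_def card_PiE numeral_2_eq_2)

lemma restrict_configs: "\<sigma> \<in> configs B \<Longrightarrow> A \<subseteq> B \<Longrightarrow> restrict \<sigma> A \<in> configs A"
  by (fastforce simp: configs_def PiE_iff)

lemma merge_configs:
  "A \<inter> B = {} \<Longrightarrow> \<sigma> \<in> configs A \<Longrightarrow> \<omega> \<in> configs B \<Longrightarrow> merge A B (\<sigma>, \<omega>) \<in> configs (A \<union> B)"
  by (auto simp: configs_def PiE_iff)

lemma sum_configs_fibre:
  assumes AB: "A \<inter> B = {}" and s: "s \<in> configs A"
  shows "(\<Sum>\<tau> | \<tau> \<in> configs (A \<union> B) \<and> restrict \<tau> A = s. f \<tau>) = (\<Sum>\<omega>\<in>configs B. f (merge A B (s, \<omega>)))"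
proof (rule sum.reindex_bij_witness[of _ "\<lambda>\<omega>. merge A B (s, \<omega>)" "\<lambda>\<tau>. restrict \<tau> B"])
  fix \<tau> assume \<tau>: "\<tau> \<in> {\<tau>. \<tau> \<in> configs (A \<union> B) \<and> restrict \<tau> A = s}"
  show "restrict \<tau> B \<in> configs B" using \<tau> by (auto intro: restrict_configs)
  show *: "merge A B (s, restrict \<tau> B) = \<tau>"
  proof
    fix x
    have "restrict \<tau> A x = s x" using \<tau> by simp
    thus "merge A B (s, restrict \<tau> B) x = \<tau> x"
      using \<tau> by (auto simp: merge_def configs_def PiE_iff extensional_def)
  qed
  show "f (merge A B (s, restrict \<tau> B)) = f \<tau>" by (simp only: *)
next
  fix \<omega> assume \<omega>: "\<omega> \<in> configs B"
  hence \<omega>': "restrict \<omega> B = \<omega>" by (auto simp: configs_def)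
  have s': "restrict s A = s" using s by (auto simp: configs_def)
  show "restrict (merge A B (s, \<omega>)) B = \<omega>" using AB \<omega>' by simp
  show "merge A B (s, \<omega>) \<in> {\<tau>. \<tau> \<in> configs (A \<union> B) \<and> restrict \<tau> A = s}"
    using merge_configs[OF AB s \<omega>] AB s' by simp
qed

lemma sum_configs_Un:
  assumes AB: "A \<inter> B = {}" and fin: "finite A" "finite B"
  shows "(\<Sum>\<tau>\<in>configs (A \<union> B). f \<tau>) = (\<Sum>\<sigma>\<in>configs A. \<Sum>\<omega>\<in>configs B. f (merge A B (\<sigma>, \<omega>)))"
proof -
  have "(\<Sum>\<tau>\<in>configs (A \<union> B). f \<tau>)
      = (\<Sum>\<sigma>\<in>configs A. \<Sum>\<tau> | \<tau> \<in> configs (A \<union> B) \<and> restrict \<tau> A = \<sigma>. f \<tau>)"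
    by (rule sum.group[symmetric]) (auto simp: fin finite_configs intro: restrict_configs)
  thus ?thesis using AB by (simp add: sum_configs_fibre)
qed

section \<open>Finite-volume weights and compatibility\<close>

lemma gibbs_weight_eq:
  assumes "1 \<le> n"
  shows "gibbs_weight k J J1 h n \<sigma> = padic_exp (hamiltonian k J J1 n \<sigma>) *
    (\<Prod>y\<in>level k n. h (butlast y) y (\<sigma> (butlast y)) (\<sigma> y) powi (\<sigma> (butlast y) * \<sigma> y))"
proof -
  obtain m where "n = Suc m" using assms by (cases n) auto
  thus ?thesis unfolding gibbs_weight_def by (simp add: prod_level_successors)
qed

text \<open>\<open>g\<close> is common to all edges, while \<open>c\<close> collects the edgewise
  scalar that \<open>u\<close> does not see. It depends on \<open>y\<close> alone because the
  predecessor of \<open>y\<close> is determined.\<close>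

definition edge_factorization ::
  "nat \<Rightarrow> 'p::prime_card boundary \<Rightarrow> (vertex \<Rightarrow> 'p padic) \<Rightarrow> (int \<Rightarrow> int \<Rightarrow> 'p padic) \<Rightarrow> bool" where
  "edge_factorization k h c g \<longleftrightarrow>
     (\<forall>(x, y)\<in>tree_edges k. \<forall>s\<in>{-1, 1}. \<forall>t\<in>{-1, 1}. h x y s t powi (s * t) = c y * g s t)"

lemma edge_factorizationD:
  assumes "edge_factorization k h c g" "y \<in> level k (Suc n)" "s \<in> {-1, 1}" "t \<in> {-1, 1}"
  shows "h (butlast y) y s t powi (s * t) = c y * g s t"
proof -
  have "(butlast y, y) \<in> tree_edges k" using assms(2) by (auto simp: tree_edges_iff)
  thus ?thesis using assms(1,3,4) unfolding edge_factorization_def by blast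
qed

lemma gibbs_weight_factorized:
  assumes "edge_factorization k h c g" "\<sigma> \<in> configs (tree_ball k n)" "1 \<le> n"
  shows "gibbs_weight k J J1 h n \<sigma> = padic_exp (hamiltonian k J J1 n \<sigma>) *
    (\<Prod>y\<in>level k n. c y) * (\<Prod>y\<in>level k n. g (\<sigma> (butlast y)) (\<sigma> y))"
proof -
  obtain m where m: "n = Suc m" using assms(3) by (cases n) auto
  have "h (butlast y) y (\<sigma> (butlast y)) (\<sigma> y) powi (\<sigma> (butlast y) * \<sigma> y)
      = c y * g (\<sigma> (butlast y)) (\<sigma> y)" if y: "y \<in> level k n" for y
  proof -
    have "y \<in> tree_ball k n" "butlast y \<in> tree_ball k n"
      using y level_subset_tree_ball butlast_in_level[of y k m] tree_ball_mono[of m n k]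
      by (auto simp: m)
    hence "\<sigma> y \<in> {-1, 1}" "\<sigma> (butlast y) \<in> {-1, 1}"
      using assms(2) configs_values by blast+
    thus ?thesis using edge_factorizationD[OF assms(1)] y m by blast
  qed
  hence "(\<Prod>y\<in>level k n. h (butlast y) y (\<sigma> (butlast y)) (\<sigma> y) powi (\<sigma> (butlast y) * \<sigma> y))
      = (\<Prod>y\<in>level k n. c y * g (\<sigma> (butlast y)) (\<sigma> y))"
    by (rule prod.cong[OF refl])
  thus ?thesis unfolding gibbs_weight_eq[OF assms(3)] by (simp add: prod.distrib mult.assoc)
qed

lemma padic_norm_mult_of_int_le:
  fixes x :: "'p::prime_card padic"
  assumes "padic_norm x \<le> e"
  shows "padic_norm (x * of_int m) \<le> e"
proof -
  have "padic_norm x * padic_norm (of_int m :: 'p padic) \<le> padic_norm x * 1"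
    by (intro mult_left_mono padic_norm_of_int_le padic_norm_nonneg)
  thus ?thesis using assms by (simp add: padic_norm_mult)
qed

lemma partition_function_Suc:
  "partition_function k J J1 h (Suc n) = (\<Sum>\<sigma>\<in>configs (tree_ball k n). \<Sum>\<omega>\<in>configs (level k (Suc n)).
     gibbs_weight k J J1 h (Suc n) (merge (tree_ball k n) (level k (Suc n)) (\<sigma>, \<omega>)))"
  unfolding partition_function_def tree_ball_Suc
  by (intro sum_configs_Un tree_ball_level_disjoint finite_tree_ball finite_level)

text \<open>The weights for \<open>h\<close> and \<open>h'\<close> differ by the factor
  \<open>C / C'\<close>, which is independent of the configuration and disappears on
  normalization.\<close>

lemma finite_gibbs_cong_factorization:
  assumes "edge_factorization k h c g" "edge_factorization k h' c' g"
    and c: "\<And>x y. (x, y) \<in> tree_edges k \<Longrightarrow> c y \<noteq> 0" "\<And>x y. (x, y) \<in> tree_edges k \<Longrightarrow> c' y \<noteq> 0"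
    and n: "1 \<le> n" and \<sigma>: "\<sigma> \<in> configs (tree_ball k n)"
  shows "finite_gibbs k J J1 h n \<sigma> = finite_gibbs k J J1 h' n \<sigma>"
proof -
  define C where "C = (\<Prod>y\<in>level k n. c y)"
  define C' where "C' = (\<Prod>y\<in>level k n. c' y)"
  obtain m where m: "n = Suc m" using n by (cases n) auto
  have "(butlast y, y) \<in> tree_edges k" if "y \<in> level k n" for y
    using that m by (auto simp: tree_edges_iff)
  hence "\<forall>y\<in>level k n. c y \<noteq> 0 \<and> c' y \<noteq> 0" using c by blast
  hence C: "C \<noteq> 0" "C' \<noteq> 0" by (simp_all add: C_def C'_def finite_level)
  have w: "gibbs_weight k J J1 h n \<sigma> = C / C' * gibbs_weight k J J1 h' n \<sigma>"
    if "\<sigma> \<in> configs (tree_ball k n)" for \<sigma>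
    using C gibbs_weight_factorized[OF assms(1) that n, of J J1] gibbs_weight_factorized[OF assms(2) that n, of J J1]
    by (simp add: C_def C'_def)
  hence "partition_function k J J1 h n = C / C' * partition_function k J J1 h' n"
    unfolding partition_function_def sum_distrib_left by (intro sum.cong refl)
  thus ?thesis using C by (simp add: finite_gibbs_def w[OF \<sigma>])
qed

context
  assumes p3: "CARD('p::prime_card) \<ge> 3"
begin

lemma padic_exp_0: "padic_exp (0 :: 'p padic) = 1"
proof -
  have "padic_exp (0 :: 'p padic) \<noteq> 0"
    by (rule padic_E_nonzero[OF p3 padic_exp_in_E[OF p3]]) simp
  thus ?thesis using padic_exp_add[OF p3, of 0 0] by simp
qed

lemma padic_exp_sum:
  fixes f :: "'a \<Rightarrow> 'p padic"
  assumes "\<And>i. i \<in> A \<Longrightarrow> padic_norm (f i) \<le> 1 / real CARD('p)"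
  shows "padic_exp (sum f A) = (\<Prod>i\<in>A. padic_exp (f i))"
  using assms
proof (induction A rule: infinite_finite_induct)
  case (insert i A)
  have "padic_norm (sum f A) \<le> 1 / real CARD('p)"
    using insert.prems by (intro padic_norm_sum_le) auto
  thus ?case using insert by (simp add: padic_exp_add[OF p3])
qed (simp_all add: padic_exp_0)

lemma padic_exp_spin:
  fixes x :: "'p padic"
  assumes x: "padic_norm x \<le> 1 / real CARD('p)" and e: "e \<in> {-1, 1}"
  shows "padic_exp (x * of_int e) = padic_exp x powi e"
proof -
  have "padic_exp x * padic_exp (- x) = 1"
    using padic_exp_add[OF p3 x, of "- x"] x by (simp add: padic_norm_minus padic_exp_0)
  hence "padic_exp (- x) = inverse (padic_exp x)" by (metis inverse_unique)
  thus ?thesis using e by (auto simp: power_int_minus)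
qed

text \<open>Puts an edge sum into the form required by \<open>padic_E_sum_divide\<close>.\<close>

lemma edge_sum_summands:
  fixes a b :: "'p padic"
  assumes "a \<in> padic_E" "b \<in> padic_E" "\<And>e. e \<in> {-1, 1} \<Longrightarrow> g t e \<in> padic_E"
  obtains x y where "x \<in> padic_E" "y \<in> padic_E" "edge_sum a b g s t = x + y"
proof -
  define f where "f = (\<lambda>e. a powi (t * e) * b powi (s * e) * g t e)"
  have "f e \<in> padic_E" if "e \<in> {-1, 1}" for e
    unfolding f_def using assms that by (intro padic_E_mult[OF p3] padic_E_powi[OF p3])
  moreover have "edge_sum a b g s t = f (-1) + f 1"
    by (simp add: edge_sum_def f_def)
  ultimately show thesis using that by blast
qed

context
  fixes J J1 :: "'p padic" and k :: nat
  assumes J: "padic_norm J \<le> 1 / real CARD('p)"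
    and J1: "padic_norm J1 \<le> 1 / real CARD('p)"
begin

lemma hamiltonian_norm: "padic_norm (hamiltonian k J J1 n \<sigma>) \<le> 1 / real CARD('p)"
proof -
  let ?S = "\<Sum>(x, y)\<in>ball_edges k n. \<sigma> x * \<sigma> y" and ?T = "\<Sum>(x, y)\<in>prolonged_pairs k n. \<sigma> x * \<sigma> y"
  have "hamiltonian k J J1 n \<sigma> = J * of_int ?S + J1 * of_int ?T"
    by (simp add: hamiltonian_def case_prod_unfold)
  moreover have "padic_norm (J * of_int ?S) \<le> 1 / real CARD('p)"
      "padic_norm (J1 * of_int ?T) \<le> 1 / real CARD('p)"
    by (intro padic_norm_mult_of_int_le J J1)+
  ultimately show ?thesis
    using padic_norm_ultra[of "J * of_int ?S" "J1 * of_int ?T"] by (simp only:)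
qed

lemma exp_hamiltonian_Suc:
  assumes n: "1 \<le> n" and \<sigma>: "\<sigma> \<in> configs (tree_ball k (Suc n))"
  shows "padic_exp (hamiltonian k J J1 (Suc n) \<sigma>) = padic_exp (hamiltonian k J J1 n \<sigma>) *
    (\<Prod>y\<in>level k (Suc n). padic_exp J powi (\<sigma> (butlast y) * \<sigma> y) *
                           padic_exp J1 powi (\<sigma> (butlast (butlast y)) * \<sigma> y))"
proof -
  let ?f = "\<lambda>y. J * of_int (\<sigma> (butlast y) * \<sigma> y)" and
      ?f1 = "\<lambda>y. J1 * of_int (\<sigma> (butlast (butlast y)) * \<sigma> y)"
  have norms: "padic_norm (?f y) \<le> 1 / real CARD('p)" "padic_norm (?f1 y) \<le> 1 / real CARD('p)" for y
    by (intro padic_norm_mult_of_int_le J J1)+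
  hence norm: "padic_norm (?f y + ?f1 y) \<le> 1 / real CARD('p)" for y
    using padic_norm_ultra[of "?f y" "?f1 y"] by (meson max.boundedI order_trans)
  have spin: "padic_exp (?f y + ?f1 y) = padic_exp J powi (\<sigma> (butlast y) * \<sigma> y) *
      padic_exp J1 powi (\<sigma> (butlast (butlast y)) * \<sigma> y)" if y: "y \<in> level k (Suc n)" for y
  proof -
    have "z \<in> tree_ball k (Suc n)" if "z \<in> {y, butlast y, butlast (butlast y)}" for z
      using y that by (auto simp: tree_ball_eq level_eq dest!: in_set_butlastD)
    hence "\<sigma> y \<in> {-1, 1}" "\<sigma> (butlast y) \<in> {-1, 1}" "\<sigma> (butlast (butlast y)) \<in> {-1, 1}"
      using configs_values[OF \<sigma>] by blast+
    hence "\<sigma> (butlast y) * \<sigma> y \<in> {-1, 1}" "\<sigma> (butlast (butlast y)) * \<sigma> y \<in> {-1, 1}" by auto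
    thus ?thesis by (simp only: padic_exp_add[OF p3 norms] padic_exp_spin[OF J] padic_exp_spin[OF J1])
  qed
  have "padic_exp (hamiltonian k J J1 (Suc n) \<sigma>) = padic_exp (hamiltonian k J J1 n \<sigma>) *
      padic_exp (\<Sum>y\<in>level k (Suc n). ?f y + ?f1 y)"
    unfolding hamiltonian_Suc[OF n]
    by (intro padic_exp_add[OF p3] hamiltonian_norm padic_norm_sum_le norm) simp
  also have "padic_exp (\<Sum>y\<in>level k (Suc n). ?f y + ?f1 y)
      = (\<Prod>y\<in>level k (Suc n). padic_exp (?f y + ?f1 y))"
    by (intro padic_exp_sum norm)
  also have "\<dots> = (\<Prod>y\<in>level k (Suc n). padic_exp J powi (\<sigma> (butlast y) * \<sigma> y) *
      padic_exp J1 powi (\<sigma> (butlast (butlast y)) * \<sigma> y))"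
    by (intro prod.cong refl spin)
  finally show ?thesis .
qed

text \<open>A new spin interacts only with its parent and grandparent, so the sum over the new level
  splits into one factor per vertex. Siblings contribute equal factors, and every parent has
  \<open>k\<close> children: hence the power \<open>k\<close>.\<close>

lemma sum_gibbs_weight:
  assumes n: "1 \<le> n" and \<sigma>: "\<sigma> \<in> configs (tree_ball k n)" and h: "edge_factorization k h c g"
  shows "(\<Sum>\<omega>\<in>configs (level k (Suc n)).
            gibbs_weight k J J1 h (Suc n) (merge (tree_ball k n) (level k (Suc n)) (\<sigma>, \<omega>)))
    = padic_exp (hamiltonian k J J1 n \<sigma>) * (\<Prod>y\<in>level k (Suc n). c y) *
      (\<Prod>x\<in>level k n. edge_sum (padic_exp J) (padic_exp J1) g (\<sigma> (butlast x)) (\<sigma> x) ^ k)"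
proof -
  let ?L = "level k (Suc n)" and ?B = "tree_ball k n"
  define a where "a = padic_exp J"
  define b where "b = padic_exp J1"
  define f where "f = (\<lambda>y t. c y * (a powi (\<sigma> (butlast y) * t) * b powi (\<sigma> (butlast (butlast y)) * t) *
                                   g (\<sigma> (butlast y)) t))"
  have anc: "butlast y \<in> ?B" "butlast (butlast y) \<in> ?B" if "y \<in> ?L" for y
    using that by (auto simp: tree_ball_eq level_eq dest!: in_set_butlastD)
  have weight: "gibbs_weight k J J1 h (Suc n) (merge ?B ?L (\<sigma>, \<omega>))
      = padic_exp (hamiltonian k J J1 n \<sigma>) * (\<Prod>y\<in>?L. f y (\<omega> y))"
    if \<omega>: "\<omega> \<in> configs ?L" for \<omega>
  proof -
    let ?\<tau> = "merge ?B ?L (\<sigma>, \<omega>)"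
    have \<tau>: "?\<tau> \<in> configs (tree_ball k (Suc n))"
      unfolding tree_ball_Suc by (intro merge_configs tree_ball_level_disjoint \<sigma> \<omega>)
    have vals: "?\<tau> x = \<sigma> x" if "x \<in> ?B" for x using that by (simp add: tree_ball_level_disjoint)
    have vals': "?\<tau> y = \<omega> y" if "y \<in> ?L" for y using that by (simp add: tree_ball_level_disjoint)
    have H: "hamiltonian k J J1 n ?\<tau> = hamiltonian k J J1 n \<sigma>" by (intro hamiltonian_cong vals)
    have "gibbs_weight k J J1 h (Suc n) ?\<tau> = padic_exp (hamiltonian k J J1 n \<sigma>) *
        (\<Prod>y\<in>?L. a powi (?\<tau> (butlast y) * ?\<tau> y) * b powi (?\<tau> (butlast (butlast y)) * ?\<tau> y)) *
        (\<Prod>y\<in>?L. c y) * (\<Prod>y\<in>?L. g (?\<tau> (butlast y)) (?\<tau> y))"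
      using gibbs_weight_factorized[OF h \<tau>, of J J1] exp_hamiltonian_Suc[OF n \<tau>] by (simp add: H a_def b_def)
    also have "\<dots> = padic_exp (hamiltonian k J J1 n \<sigma>) *
        (\<Prod>y\<in>?L. c y * (a powi (?\<tau> (butlast y) * ?\<tau> y) * b powi (?\<tau> (butlast (butlast y)) * ?\<tau> y) *
                       g (?\<tau> (butlast y)) (?\<tau> y)))"
      by (simp add: prod.distrib mult_ac)
    also have "(\<Prod>y\<in>?L. c y * (a powi (?\<tau> (butlast y) * ?\<tau> y) * b powi (?\<tau> (butlast (butlast y)) * ?\<tau> y) *
                       g (?\<tau> (butlast y)) (?\<tau> y))) = (\<Prod>y\<in>?L. f y (\<omega> y))"
      by (intro prod.cong refl) (simp only: f_def vals vals' anc)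
    finally show ?thesis .
  qed
  have "(\<Sum>\<omega>\<in>configs ?L. gibbs_weight k J J1 h (Suc n) (merge ?B ?L (\<sigma>, \<omega>)))
      = padic_exp (hamiltonian k J J1 n \<sigma>) * (\<Sum>\<omega>\<in>configs ?L. \<Prod>y\<in>?L. f y (\<omega> y))"
    by (simp add: weight sum_distrib_left)
  \<comment> \<open>Distributivity: a sum over all spin assignments of a product over vertices is
    the product of the single-spin sums.\<close>
  also have "(\<Sum>\<omega>\<in>configs ?L. \<Prod>y\<in>?L. f y (\<omega> y)) = (\<Prod>y\<in>?L. \<Sum>t\<in>{-1, 1}. f y t)"
    unfolding configs_def by (rule prod_sum_PiE[symmetric]) (simp_all add: finite_level)
  also have "\<dots> = (\<Prod>y\<in>?L. c y * edge_sum a b g (\<sigma> (butlast (butlast y))) (\<sigma> (butlast y)))"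
    by (simp only: f_def edge_sum_def sum_distrib_left)
  also have "\<dots> = (\<Prod>y\<in>?L. c y) * (\<Prod>y\<in>?L. edge_sum a b g (\<sigma> (butlast (butlast y))) (\<sigma> (butlast y)))"
    by (rule prod.distrib)
  also have "(\<Prod>y\<in>?L. edge_sum a b g (\<sigma> (butlast (butlast y))) (\<sigma> (butlast y)))
      = (\<Prod>x\<in>level k n. \<Prod>y\<in>successors k x. edge_sum a b g (\<sigma> (butlast x)) (\<sigma> x))"
    by (rule prod_level_successors[symmetric])
  also have "\<dots> = (\<Prod>x\<in>level k n. edge_sum a b g (\<sigma> (butlast x)) (\<sigma> x) ^ k)"
    by (intro prod.cong refl) (simp add: card_successors)
  finally show ?thesis by (simp add: a_def b_def mult.assoc)
qed

section \<open>Compatibility for boundary conditions with values in \<open>padic_E\<close>\<close>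

lemma gibbs_weight_in_E:
  assumes h: "\<forall>(x, y)\<in>tree_edges k. \<forall>s\<in>{-1, 1}. \<forall>t\<in>{-1, 1}. h x y s t \<in> padic_E"
    and n: "1 \<le> n" and \<sigma>: "\<sigma> \<in> configs (tree_ball k n)"
  shows "gibbs_weight k J J1 h n \<sigma> \<in> padic_E"
proof -
  obtain m where m: "n = Suc m" using n by (cases n) auto
  have "h (butlast y) y (\<sigma> (butlast y)) (\<sigma> y) \<in> padic_E" if y: "y \<in> level k n" for y
  proof -
    have "y \<in> tree_ball k n" "butlast y \<in> tree_ball k n"
      using y level_subset_tree_ball butlast_in_level[of y k m] tree_ball_mono[of m n k]
      by (auto simp: m)
    hence "\<sigma> y \<in> {-1, 1}" "\<sigma> (butlast y) \<in> {-1, 1}"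
      using \<sigma> configs_values by blast+
    moreover have "(butlast y, y) \<in> tree_edges k" using y m by (auto simp: tree_edges_iff)
    ultimately show ?thesis using h by blast
  qed
  thus ?thesis unfolding gibbs_weight_eq[OF n]
    by (intro padic_E_mult[OF p3] padic_exp_in_E[OF p3] hamiltonian_norm padic_E_prod[OF p3] padic_E_powi[OF p3])
qed

text \<open>Every weight is congruent to 1 modulo p, so the sum is congruent to the number of
  configurations, a power of 2.\<close>

lemma partition_function_nonzero:
  assumes h: "\<forall>(x, y)\<in>tree_edges k. \<forall>s\<in>{-1, 1}. \<forall>t\<in>{-1, 1}. h x y s t \<in> padic_E"
    and n: "1 \<le> n"
  shows "partition_function k J J1 h n \<noteq> 0"
proof -
  let ?C = "configs (tree_ball k n)" and ?w = "gibbs_weight k J J1 h n"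
  have "partition_function k J J1 h n - 2 ^ card (tree_ball k n) = (\<Sum>\<sigma>\<in>?C. ?w \<sigma> - 1)"
    by (simp add: partition_function_def sum_subtractf card_configs finite_tree_ball)
  also have "padic_norm \<dots> \<le> 1 / real CARD('p)"
    using gibbs_weight_in_E[OF h n] by (intro padic_norm_sum_le) (auto simp: padic_E_iff[OF p3])
  also have "\<dots> < 1" using p3 by simp
  finally have "padic_norm (partition_function k J J1 h n) = 1"
    using padic_norm_eqI[of "partition_function k J J1 h n" "2 ^ card (tree_ball k n)"]
    by (simp add: padic_norm_power padic_norm_2[OF p3])
  thus ?thesis by auto
qed

lemma boundary_defined_in_E:
  assumes h: "\<forall>(x, y)\<in>tree_edges k. \<forall>s\<in>{-1, 1}. \<forall>t\<in>{-1, 1}. h x y s t \<in> padic_E"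
  shows "boundary_defined k J J1 h"
proof -
  have "h x y s t \<noteq> 0" if "(x, y) \<in> tree_edges k" "s \<in> {-1, 1}" "t \<in> {-1, 1}" for x y s t
    using h that padic_E_nonzero[OF p3] by blast
  thus ?thesis unfolding boundary_defined_def
    using le_less_trans[OF hamiltonian_norm padic_exp_radius_bounds(1)[OF p3]] partition_function_nonzero[OF h]
    by auto
qed

lemma compatible_of_fixed_point:
  assumes h: "\<forall>(x, y)\<in>tree_edges k. \<forall>s\<in>{-1, 1}. \<forall>t\<in>{-1, 1}. h x y s t \<in> padic_E"
    and fact: "edge_factorization k h (\<lambda>_. 1) g"
    and l: "\<And>s t. s \<in> {-1, 1} \<Longrightarrow> t \<in> {-1, 1} \<Longrightarrow>
              edge_sum (padic_exp J) (padic_exp J1) g s t ^ k = l * g s t"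
  shows "compatible k J J1 h"
  unfolding compatible_def
proof (intro allI impI ballI)
  fix N \<sigma> assume "2 \<le> (N :: nat)" and \<sigma>: "\<sigma> \<in> configs (tree_ball k (N - 1))"
  then obtain n where N: "N = Suc n" and n: "1 \<le> n" by (cases N) auto
  have \<sigma>: "\<sigma> \<in> configs (tree_ball k n)" using \<sigma> N by simp
  let ?M = "\<lambda>\<sigma> \<omega>. merge (tree_ball k n) (level k (Suc n)) (\<sigma>, \<omega>)"
  \<comment> \<open>Each vertex of \<open>level k n\<close> contributes one factor \<open>l\<close>,
    whatever its spin, so summing out the next level multiplies all weights and the partition
    function by the same \<open>d\<close>.\<close>
  define d where "d = l ^ card (level k n)"
  have step: "(\<Sum>\<omega>\<in>configs (level k (Suc n)). gibbs_weight k J J1 h (Suc n) (?M \<sigma> \<omega>))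
      = d * gibbs_weight k J J1 h n \<sigma>" if \<sigma>: "\<sigma> \<in> configs (tree_ball k n)" for \<sigma>
  proof -
    have "edge_sum (padic_exp J) (padic_exp J1) g (\<sigma> (butlast x)) (\<sigma> x) ^ k = l * g (\<sigma> (butlast x)) (\<sigma> x)"
      if x: "x \<in> level k n" for x
    proof -
      have "x \<in> tree_ball k n" "butlast x \<in> tree_ball k n"
        using x by (auto simp: tree_ball_eq level_eq dest!: in_set_butlastD)
      thus ?thesis using configs_values[OF \<sigma>] by (intro l)
    qed
    thus ?thesis unfolding sum_gibbs_weight[OF n \<sigma> fact] gibbs_weight_factorized[OF fact \<sigma> n]
      by (simp add: prod.distrib d_def mult_ac)
  qed
  have Z: "partition_function k J J1 h (Suc n) = d * partition_function k J J1 h n"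
    unfolding partition_function_Suc by (simp add: step partition_function_def sum_distrib_left)
  hence "d \<noteq> 0" using partition_function_nonzero[OF h, of "Suc n"] by auto
  have "(\<Sum>\<omega>\<in>configs (level k (Suc n)). finite_gibbs k J J1 h (Suc n) (?M \<sigma> \<omega>))
      = d * gibbs_weight k J J1 h n \<sigma> / (d * partition_function k J J1 h n)"
    by (simp add: finite_gibbs_def step[OF \<sigma>] Z flip: sum_divide_distrib)
  also have "\<dots> = finite_gibbs k J J1 h n \<sigma>" using \<open>d \<noteq> 0\<close> by (simp add: finite_gibbs_def)
  finally show "(\<Sum>\<omega>\<in>configs (level k N). finite_gibbs k J J1 h N
      (merge (tree_ball k (N - 1)) (level k N) (\<sigma>, \<omega>))) = finite_gibbs k J J1 h (N - 1) \<sigma>"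
    by (simp add: N)
qed

text \<open>
  Only the compatibility condition between the first two levels is needed: on configurations that
  are constant on \<open>W\<^sub>1\<close> it says that the \<open>k\<close>-th power of \<open>edge_sum \<dots> ^ k / g\<close> is constant, and
  \<open>padic_E\<close> is torsion-free.
\<close>

lemma fixed_point_of_compatible:
  assumes k: "1 \<le> k" and comp: "compatible k J J1 h"
    and h: "\<forall>(x, y)\<in>tree_edges k. \<forall>s\<in>{-1, 1}. \<forall>t\<in>{-1, 1}. h x y s t \<in> padic_E"
    and fact: "edge_factorization k h c g"
    and c: "\<And>x y. (x, y) \<in> tree_edges k \<Longrightarrow> c y \<noteq> 0"
    and g: "\<And>s t. s \<in> {-1, 1} \<Longrightarrow> t \<in> {-1, 1} \<Longrightarrow> g s t \<in> padic_E"
  shows "\<exists>l. \<forall>s\<in>{-1, 1}. \<forall>t\<in>{-1, 1}. edge_sum (padic_exp J) (padic_exp J1) g s t ^ k = l * g s t"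
proof -
  let ?F = "edge_sum (padic_exp J) (padic_exp J1) g"
  let ?Z = "partition_function k J J1 h"
  let ?C = "\<lambda>n. \<Prod>y\<in>level k n. c y"
  define q where "q = (\<lambda>s t. ?F s t ^ k / g s t)"
  have Z: "?Z 1 \<noteq> 0" "?Z 2 \<noteq> 0" by (intro partition_function_nonzero[OF h]; simp)+
  have C: "?C (Suc n) \<noteq> 0" for n
    using c by (auto simp: finite_level tree_edges_iff)
  have level1: "card (level k (Suc 0)) = k"
  proof -
    have root: "[] \<in> level k 0" by (simp add: level_eq)
    have "successors k [] = level k (Suc 0)"
      unfolding successors_eq[OF root] by (auto simp: level_eq length_Suc_conv)
    thus ?thesis using card_successors[OF root] by simp
  qed
  have qk: "q s t ^ k = ?C 1 * ?Z 2 / (?C 2 * ?Z 1)" if s: "s \<in> {-1, 1}" and t: "t \<in> {-1, 1}" for s t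
  proof -
    \<comment> \<open>The sign \<open>s\<close> at the root and \<open>t\<close> on all of the first
      level: each of the \<open>k\<close> edges then carries the pair (s, t), and the products over
      the level become k-th powers.\<close>
    define \<sigma> where "\<sigma> = restrict (\<lambda>x. if x = [] then s else t) (tree_ball k 1)"
    have \<sigma>: "\<sigma> \<in> configs (tree_ball k 1)" using s t by (auto simp: \<sigma>_def configs_def)
    have vals: "\<sigma> (butlast x) = s" "\<sigma> x = t" if "x \<in> level k 1" for x
      using that by (auto simp: \<sigma>_def level_eq tree_ball_eq length_Suc_conv)
    let ?M = "\<lambda>\<omega>. merge (tree_ball k 1) (level k 2) (\<sigma>, \<omega>)"
    let ?e = "padic_exp (hamiltonian k J J1 1 \<sigma>)"
    have e: "?e \<noteq> 0" by (intro padic_E_nonzero[OF p3] padic_exp_in_E[OF p3] hamiltonian_norm)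
    have gnz: "g s t \<noteq> 0" using g s t padic_E_nonzero[OF p3] by blast
    have "(\<Sum>\<omega>\<in>configs (level k 2). finite_gibbs k J J1 h 2 (?M \<omega>)) = finite_gibbs k J J1 h 1 \<sigma>"
      using comp \<sigma> unfolding compatible_def by (metis diff_Suc_1 numeral_2_eq_2 One_nat_def order_refl)
    hence "(\<Sum>\<omega>\<in>configs (level k 2). gibbs_weight k J J1 h 2 (?M \<omega>)) / ?Z 2
        = gibbs_weight k J J1 h 1 \<sigma> / ?Z 1"
      by (simp add: finite_gibbs_def sum_divide_distrib)
    moreover have "(\<Sum>\<omega>\<in>configs (level k 2). gibbs_weight k J J1 h 2 (?M \<omega>))
        = ?e * ?C 2 * (\<Prod>x\<in>level k 1. ?F (\<sigma> (butlast x)) (\<sigma> x) ^ k)"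
      using sum_gibbs_weight[of 1, OF _ \<sigma> fact] by (simp add: numeral_2_eq_2)
    moreover have "(\<Prod>x\<in>level k 1. ?F (\<sigma> (butlast x)) (\<sigma> x) ^ k) = (?F s t ^ k) ^ k"
      using vals level1 by simp
    moreover have "gibbs_weight k J J1 h 1 \<sigma> = ?e * ?C 1 * g s t ^ k"
      using gibbs_weight_factorized[OF fact \<sigma>, of J J1] vals level1 by simp
    ultimately have "?e * ?C 2 * (?F s t ^ k) ^ k / ?Z 2 = ?e * ?C 1 * g s t ^ k / ?Z 1" by simp
    hence "?e * ?C 2 * (?F s t ^ k) ^ k * ?Z 1 = ?e * ?C 1 * g s t ^ k * ?Z 2"
      by (rule iffD1[OF frac_eq_eq[OF Z(2) Z(1)]])
    hence "?C 2 * (?F s t ^ k) ^ k * ?Z 1 = ?C 1 * g s t ^ k * ?Z 2" using e by (simp add: mult.assoc)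
    thus ?thesis using Z C[of 1] gnz unfolding q_def power_divide
      by (simp add: field_simps numeral_2_eq_2)
  qed
  have "q s t = q 1 1" if s: "s \<in> {-1, 1}" and t: "t \<in> {-1, 1}" for s t
  proof -
    have ab: "padic_exp J \<in> padic_E" "padic_exp J1 \<in> padic_E" by (intro padic_exp_in_E[OF p3] J J1)+
    have 1: "(1 :: int) \<in> {-1, 1}" by simp
    obtain x y where xy: "x \<in> padic_E" "y \<in> padic_E" "?F s t = x + y"
      using edge_sum_summands[OF ab, of g t s] g t by blast
    obtain z w where zw: "z \<in> padic_E" "w \<in> padic_E" "?F 1 1 = z + w"
      using edge_sum_summands[OF ab, of g 1 1] g 1 by blast
    \<comment> \<open>\<open>q\<close> itself is only congruent to \<open>2 ^ k\<close>; the torsion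
      argument needs the quotient, which lies in \<open>padic_E\<close>.\<close>
    have "q s t / q 1 1 = (?F s t / ?F 1 1) ^ k / (g s t / g 1 1)" by (simp add: q_def power_divide)
    also have "\<dots> \<in> padic_E" unfolding xy(3) zw(3)
      by (intro padic_E_divide[OF p3] padic_E_power[OF p3] padic_E_sum_divide[OF p3] xy zw g s t 1)
    finally have E: "q s t / q 1 1 \<in> padic_E" .
    have "q 1 1 \<noteq> 0" using E padic_E_nonzero[OF p3] by fastforce
    moreover have "q s t ^ k = q 1 1 ^ k" by (simp only: qk[OF s t] qk[OF 1 1])
    ultimately have "(q s t / q 1 1) ^ k = 1" by (simp add: power_divide)
    hence "q s t / q 1 1 = 1" by (rule padic_E_power_eq_1[OF p3 E k])
    thus ?thesis by (simp add: divide_eq_1_iff)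
  qed
  moreover have "?F s t ^ k = q s t * g s t" if "s \<in> {-1, 1}" "t \<in> {-1, 1}" for s t
    using g[OF that] padic_E_nonzero[OF p3] by (simp add: q_def)
  ultimately have "\<forall>s\<in>{-1, 1}. \<forall>t\<in>{-1, 1}. ?F s t ^ k = q 1 1 * g s t" by metis
  thus ?thesis by blast
qed

lemma factorization_of_translation_invariant:
  assumes k: "1 \<le> k" and u: "u_translation_invariant k (boundary_u J h)"
    and h: "\<forall>(x, y)\<in>tree_edges k. \<forall>s\<in>{-1, 1}. \<forall>t\<in>{-1, 1}. h x y s t \<in> padic_E"
  obtains c g where "edge_factorization k h c g" "\<And>x y. (x, y) \<in> tree_edges k \<Longrightarrow> c y \<noteq> 0"
    "\<And>s t. s \<in> {-1, 1} \<Longrightarrow> t \<in> {-1, 1} \<Longrightarrow> g s t \<in> padic_E" "g (-1) 1 = 1"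
proof -
  \<comment> \<open>The edge from the root to \<open>[0]\<close>, present since
    \<open>k >= 1\<close>, serves as reference. Multiplying by \<open>h [] [0] (-1) 1\<close> makes
    \<open>g (-1) 1\<close> equal to 1, since that component enters with exponent -1.\<close>
  define g where "g = (\<lambda>s t. h [] [0] s t powi (s * t) * h [] [0] (-1) 1)"
  define c where "c = (\<lambda>y. inverse (h (butlast y) y (-1) 1))"
  have "[0] \<in> level k (Suc 0)" using k by (simp add: level_eq)
  hence e0: "([], [0]) \<in> tree_edges k" by (auto simp: tree_edges_iff)
  have E: "h x y s t \<in> padic_E" if "(x, y) \<in> tree_edges k" "s \<in> {-1, 1}" "t \<in> {-1, 1}" for x y s t
    using h that by blast
  have nz: "h x y s t \<noteq> 0" if "(x, y) \<in> tree_edges k" "s \<in> {-1, 1}" "t \<in> {-1, 1}" for x y s t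
    using E[OF that] padic_E_nonzero[OF p3] by blast
  have nz0: "h [] [0] 1 1 \<noteq> 0" "h [] [0] 1 (-1) \<noteq> 0" "h [] [0] (-1) 1 \<noteq> 0" "h [] [0] (-1) (-1) \<noteq> 0"
    by (intro nz e0; simp)+
  have J0: "padic_exp J \<noteq> 0" by (intro padic_E_nonzero[OF p3] padic_exp_in_E[OF p3] J)
  have c_nz: "c y \<noteq> 0" if "(x, y) \<in> tree_edges k" for x y
  proof -
    have "x = butlast y" using that by (auto simp: tree_edges_iff)
    thus ?thesis using nz[OF that, of "-1" 1] by (simp add: c_def)
  qed
  have g_E: "g s t \<in> padic_E" if "s \<in> {-1, 1}" "t \<in> {-1, 1}" for s t
    unfolding g_def by (intro padic_E_mult[OF p3] padic_E_powi[OF p3] E e0 that) simp_all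
  have g_norm: "g (-1) 1 = 1" using nz0 by (simp add: g_def power_int_minus)
  have "h x y s t powi (s * t) = c y * g s t"
    if xy: "(x, y) \<in> tree_edges k" and s: "s \<in> {-1, 1}" and t: "t \<in> {-1, 1}" for x y s t
  proof -
    have x: "x = butlast y" using xy by (auto simp: tree_edges_iff)
    have nz1: "h x y 1 1 \<noteq> 0" "h x y 1 (-1) \<noteq> 0" "h x y (-1) 1 \<noteq> 0" "h x y (-1) (-1) \<noteq> 0"
      by (intro nz xy; simp)+
    have "boundary_u J h x y = boundary_u J h [] [0]"
      using u xy e0 unfolding u_translation_invariant_def by blast
    hence u: "h x y 1 1 * h x y (-1) 1 = h [] [0] 1 1 * h [] [0] (-1) 1"
      "h x y (-1) (-1) * h x y (-1) 1 = h [] [0] (-1) (-1) * h [] [0] (-1) 1"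
      "h x y 1 1 * h x y 1 (-1) = h [] [0] 1 1 * h [] [0] 1 (-1)"
      using J0 by (simp_all add: boundary_u_def)
    \<comment> \<open>The value g(+,-) is not a component of \<open>u\<close>, but it is the
      quotient of the first component by the third.\<close>
    have "h x y (-1) 1 / h x y 1 (-1) = (h x y 1 1 * h x y (-1) 1) / (h x y 1 1 * h x y 1 (-1))"
      using nz1 by simp
    also have "\<dots> = h [] [0] (-1) 1 / h [] [0] 1 (-1)"
      unfolding u using nz0 by simp
    finally have u3: "h x y (-1) 1 / h x y 1 (-1) = h [] [0] (-1) 1 / h [] [0] 1 (-1)" .
    have c: "c y = inverse (h x y (-1) 1)" by (simp add: c_def x)
    have g: "g 1 1 = h x y 1 1 * h x y (-1) 1" "g (-1) (-1) = h x y (-1) (-1) * h x y (-1) 1"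
      "g 1 (-1) = h x y (-1) 1 / h x y 1 (-1)" "g (-1) 1 = 1"
      unfolding u u3 by (simp_all add: g_def power_int_minus divide_inverse mult.commute nz0)
    show ?thesis using s t nz1 by (auto simp: c g power_int_minus field_simps)
  qed
  hence "edge_factorization k h c g" unfolding edge_factorization_def by blast
  thus thesis using c_nz g_E g_norm by (rule that)
qed

end

end

section \<open>Measures on cylinder sets\<close>

definition cylinder :: "nat \<Rightarrow> nat \<Rightarrow> (vertex \<Rightarrow> int) set \<Rightarrow> (vertex \<Rightarrow> int) set" where
  "cylinder k n B = {\<sigma> \<in> configs (tree_vertices k). restrict \<sigma> (tree_ball k n) \<in> B}"

text \<open>Every configuration on a ball extends to the tree, for instance by 1, so the base of a
  cylinder at a given level can be read off from the cylinder.\<close>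

lemma restrict_image_cylinder:
  assumes "B \<subseteq> configs (tree_ball k n)"
  shows "(\<lambda>\<sigma>. restrict \<sigma> (tree_ball k n)) ` cylinder k n B = B"
proof
  show "B \<subseteq> (\<lambda>\<sigma>. restrict \<sigma> (tree_ball k n)) ` cylinder k n B"
  proof
    fix s assume s: "s \<in> B"
    define \<sigma> where "\<sigma> = restrict (\<lambda>x. if x \<in> tree_ball k n then s x else 1) (tree_vertices k)"
    have s': "s \<in> configs (tree_ball k n)" using s assms by blast
    have "\<sigma> \<in> configs (tree_vertices k)"
      using configs_values[OF s'] by (auto simp: \<sigma>_def configs_def)
    moreover have "restrict \<sigma> (tree_ball k n) = s"
    proof
      fix x show "restrict \<sigma> (tree_ball k n) x = s x"
        using s' tree_ball_subset[of k n] by (auto simp: \<sigma>_def configs_def PiE_iff extensional_def)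
    qed
    ultimately show "s \<in> (\<lambda>\<sigma>. restrict \<sigma> (tree_ball k n)) ` cylinder k n B"
      using s by (intro image_eqI[of _ _ \<sigma>]) (auto simp: cylinder_def)
  qed
qed (auto simp: cylinder_def)

lemma cylinder_lift:
  assumes "m \<le> n"
  shows "cylinder k m B = cylinder k n {s \<in> configs (tree_ball k n). restrict s (tree_ball k m) \<in> B}"
proof -
  have "restrict (restrict \<sigma> (tree_ball k n)) (tree_ball k m) = restrict \<sigma> (tree_ball k m)"
    for \<sigma> :: "vertex \<Rightarrow> int"
    using tree_ball_mono[OF assms, of k] by (simp add: Int_absorb1)
  thus ?thesis using restrict_configs[OF _ tree_ball_subset] by (auto simp: cylinder_def)
qed

lemma cylinder_in_cylinder_sets:
  "B \<subseteq> configs (tree_ball k n) \<Longrightarrow> cylinder k n B \<in> cylinder_sets k"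
  by (auto simp: cylinder_sets_def cylinder_def)

text \<open>Stated for all levels from some \<open>m\<close> on, so that two cylinders can be
  brought to a common level.\<close>

lemma cylinder_setsE:
  assumes "A \<in> cylinder_sets k"
  obtains m where "\<And>n. m \<le> n \<Longrightarrow> \<exists>B\<subseteq>configs (tree_ball k n). A = cylinder k n B"
proof -
  obtain m B where A: "A = cylinder k m B"
    using assms by (auto simp: cylinder_sets_def cylinder_def)
  have "\<exists>B\<subseteq>configs (tree_ball k n). A = cylinder k n B" if "m \<le> n" for n
    unfolding A cylinder_lift[OF that]
    by (rule exI[of _ "{s \<in> configs (tree_ball k n). restrict s (tree_ball k m) \<in> B}"]) simp
  thus thesis by (rule that)
qed

lemma cylinder_sets_common_level:
  assumes "A \<in> cylinder_sets k" "A' \<in> cylinder_sets k"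
  obtains n B B' where "1 \<le> n" "B \<subseteq> configs (tree_ball k n)" "A = cylinder k n B"
    "B' \<subseteq> configs (tree_ball k n)" "A' = cylinder k n B'"
proof -
  obtain m where m: "\<And>n. m \<le> n \<Longrightarrow> \<exists>B\<subseteq>configs (tree_ball k n). A = cylinder k n B"
    using cylinder_setsE[OF assms(1)] by metis
  obtain m' where m': "\<And>n. m' \<le> n \<Longrightarrow> \<exists>B\<subseteq>configs (tree_ball k n). A' = cylinder k n B"
    using cylinder_setsE[OF assms(2)] by metis
  define n where "n = Suc (max m m')"
  have "1 \<le> n" "m \<le> n" "m' \<le> n" by (simp_all add: n_def)
  thus thesis using m m' that by metis
qed

lemma cylinder_Un: "cylinder k n B \<union> cylinder k n C = cylinder k n (B \<union> C)"
  by (auto simp: cylinder_def)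

lemma cylinder_Compl: "configs (tree_vertices k) - cylinder k n B = cylinder k n (configs (tree_ball k n) - B)"
  using restrict_configs[OF _ tree_ball_subset] by (auto simp: cylinder_def)

lemma cylinder_empty: "cylinder k n {} = {}"
  by (simp add: cylinder_def)

lemma cylinder_UNIV: "cylinder k n (configs (tree_ball k n)) = configs (tree_vertices k)"
  using restrict_configs[OF _ tree_ball_subset] by (auto simp: cylinder_def)

lemma cylinder_disjoint:
  assumes "B \<subseteq> configs (tree_ball k n)" "C \<subseteq> configs (tree_ball k n)" "cylinder k n B \<inter> cylinder k n C = {}"
  shows "B \<inter> C = {}"
proof -
  have "cylinder k n (B \<inter> C) = {}" using assms(3) by (auto simp: cylinder_def)
  thus ?thesis using restrict_image_cylinder[of "B \<inter> C" k n] assms(1) by auto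
qed

lemma algebra_cylinder_sets: "Sigma_Algebra.algebra (configs (tree_vertices k)) (cylinder_sets k)"
  unfolding algebra_iff_Un
proof (intro conjI ballI)
  show "cylinder_sets k \<subseteq> Pow (configs (tree_vertices k))" by (auto simp: cylinder_sets_def)
  show "{} \<in> cylinder_sets k" using cylinder_in_cylinder_sets[of "{}"] by (simp add: cylinder_empty)
  fix A assume A: "A \<in> cylinder_sets k"
  show "configs (tree_vertices k) - A \<in> cylinder_sets k"
    by (rule cylinder_sets_common_level[OF A A]) (simp add: cylinder_Compl cylinder_in_cylinder_sets)
  fix A' assume A': "A' \<in> cylinder_sets k"
  show "A \<union> A' \<in> cylinder_sets k"
    by (rule cylinder_sets_common_level[OF A A']) (simp add: cylinder_Un cylinder_in_cylinder_sets)
qed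

lemma measure_cylinder:
  fixes \<mu> :: "(vertex \<Rightarrow> int) set \<Rightarrow> 'p::prime_card padic"
  assumes add: "Measure_Space.additive (cylinder_sets k) \<mu>"
    and single: "\<And>s. s \<in> configs (tree_ball k n) \<Longrightarrow>
      \<mu> {\<sigma> \<in> configs (tree_vertices k). restrict \<sigma> (tree_ball k n) = s} = f s"
    and B: "B \<subseteq> configs (tree_ball k n)"
  shows "\<mu> (cylinder k n B) = sum f B"
proof -
  have "finite B" using B finite_configs[OF finite_tree_ball] by (rule finite_subset)
  thus ?thesis using B
  proof (induction B rule: finite_induct)
    case empty
    have "\<mu> ({} \<union> {}) = \<mu> {} + \<mu> {}"
      using add cylinder_in_cylinder_sets[of "{}" k n]
      unfolding Measure_Space.additive_def by (metis Int_empty_left cylinder_empty empty_subsetI)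
    thus ?case by (simp add: cylinder_empty)
  next
    case (insert s B)
    have "cylinder k n (insert s B) = cylinder k n {s} \<union> cylinder k n B"
      by (simp add: cylinder_Un)
    moreover have "cylinder k n {s} \<inter> cylinder k n B = {}"
      using insert.hyps by (auto simp: cylinder_def)
    moreover have "cylinder k n {s} \<in> cylinder_sets k" "cylinder k n B \<in> cylinder_sets k"
      using insert.prems by (auto intro: cylinder_in_cylinder_sets)
    ultimately have "\<mu> (cylinder k n (insert s B)) = \<mu> (cylinder k n {s}) + \<mu> (cylinder k n B)"
      using add unfolding Measure_Space.additive_def by metis
    thus ?case using insert single[of s] by (simp add: cylinder_def)
  qed
qed

lemma measure_eqI_cylinder:
  fixes \<mu> \<nu> :: "(vertex \<Rightarrow> int) set \<Rightarrow> 'p::prime_card padic"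
  assumes "Measure_Space.additive (cylinder_sets k) \<mu>" "Measure_Space.additive (cylinder_sets k) \<nu>"
    and ext: "\<mu> \<in> extensional (cylinder_sets k)" "\<nu> \<in> extensional (cylinder_sets k)"
    and eq: "\<And>n s. 1 \<le> n \<Longrightarrow> s \<in> configs (tree_ball k n) \<Longrightarrow>
      \<mu> {\<sigma> \<in> configs (tree_vertices k). restrict \<sigma> (tree_ball k n) = s} =
      \<nu> {\<sigma> \<in> configs (tree_vertices k). restrict \<sigma> (tree_ball k n) = s}"
  shows "\<mu> = \<nu>"
proof (rule extensionalityI[OF ext])
  fix A assume A: "A \<in> cylinder_sets k"
  obtain n B where n: "1 \<le> n" and B: "B \<subseteq> configs (tree_ball k n)" "A = cylinder k n B"
    using cylinder_sets_common_level[OF A A] by metis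
  show "\<mu> A = \<nu> A" unfolding B(2)
    using measure_cylinder[OF assms(1) eq[OF n] B(1)] measure_cylinder[OF assms(2) refl B(1)] by simp
qed

text \<open>Additivity is finite, so it reduces to disjoint bases at one common level; consistency
  makes the value independent of that level.\<close>

lemma padic_kolmogorov_extension:
  fixes f :: "nat \<Rightarrow> (vertex \<Rightarrow> int) \<Rightarrow> 'p::prime_card padic"
  assumes total: "(\<Sum>s\<in>configs (tree_ball k 1). f 1 s) = 1"
    and consistent: "\<And>n s. 1 \<le> n \<Longrightarrow> s \<in> configs (tree_ball k n) \<Longrightarrow>
      (\<Sum>\<omega>\<in>configs (level k (Suc n)). f (Suc n) (merge (tree_ball k n) (level k (Suc n)) (s, \<omega>))) = f n s"
  shows "\<exists>\<mu>. \<mu> \<in> extensional (cylinder_sets k) \<and>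
    padic_prob (configs (tree_vertices k)) (cylinder_sets k) \<mu> \<and>
    (\<forall>n\<ge>1. \<forall>s\<in>configs (tree_ball k n).
      \<mu> {\<sigma> \<in> configs (tree_vertices k). restrict \<sigma> (tree_ball k n) = s} = f n s)"
proof -
  \<comment> \<open>The base is recovered by projecting \<open>A\<close>, which avoids choosing
    one.\<close>
  define V where "V = (\<lambda>n A. sum (f n) ((\<lambda>\<sigma>. restrict \<sigma> (tree_ball k n)) ` A))"
  have V_cyl: "V n (cylinder k n B) = sum (f n) B" if "B \<subseteq> configs (tree_ball k n)" for n B
    by (simp add: V_def restrict_image_cylinder[OF that])
  have V_Suc: "V (Suc n) (cylinder k n B) = V n (cylinder k n B)"
    if n: "1 \<le> n" and B: "B \<subseteq> configs (tree_ball k n)" for n B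
  proof -
    let ?S = "{s \<in> configs (tree_ball k (Suc n)). restrict s (tree_ball k n) \<in> B}"
    have fin: "finite ?S" "finite B"
      using finite_configs[OF finite_tree_ball] finite_subset[OF B] by auto
    have "V (Suc n) (cylinder k n B) = sum (f (Suc n)) ?S"
      unfolding cylinder_lift[OF le_SucI[OF order_refl], of k n] by (rule V_cyl) blast
    also have "\<dots> = (\<Sum>s\<in>B. \<Sum>\<tau> | \<tau> \<in> ?S \<and> restrict \<tau> (tree_ball k n) = s. f (Suc n) \<tau>)"
      by (rule sum.group[symmetric]) (use fin in auto)
    also have "\<dots> = (\<Sum>s\<in>B. f n s)"
    proof (rule sum.cong[OF refl])
      fix s assume s: "s \<in> B"
      hence "{\<tau>. \<tau> \<in> ?S \<and> restrict \<tau> (tree_ball k n) = s}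
          = {\<tau>. \<tau> \<in> configs (tree_ball k n \<union> level k (Suc n)) \<and> restrict \<tau> (tree_ball k n) = s}"
        by (auto simp: tree_ball_Suc)
      moreover have s': "s \<in> configs (tree_ball k n)" using s B by blast
      ultimately show "(\<Sum>\<tau> | \<tau> \<in> ?S \<and> restrict \<tau> (tree_ball k n) = s. f (Suc n) \<tau>) = f n s"
        using sum_configs_fibre[OF tree_ball_level_disjoint s', of "f (Suc n)"] consistent[OF n s'] by simp
    qed
    finally show ?thesis using V_cyl[OF B] by simp
  qed
  have V_mono: "V m (cylinder k n B) = V n (cylinder k n B)"
    if "1 \<le> n" "B \<subseteq> configs (tree_ball k n)" "n \<le> m" for n m B
    using that(3)
  proof (induction m rule: dec_induct)
    case (step m)
    show ?case
      using V_Suc[of m "{s \<in> configs (tree_ball k m). restrict s (tree_ball k n) \<in> B}"] step that(1)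
      by (simp flip: cylinder_lift)
  qed simp
  define P where "P = (\<lambda>A n. 1 \<le> n \<and> (\<exists>B\<subseteq>configs (tree_ball k n). A = cylinder k n B))"
  \<comment> \<open>The chosen level is immaterial by \<open>V_mono\<close>. The clause
    \<open>1 <= n\<close> in \<open>P\<close> matters because \<open>f\<close> is controlled only
    from level 1 on.\<close>
  define \<mu> where "\<mu> = restrict (\<lambda>A. V (SOME n. P A n) A) (cylinder_sets k)"
  have \<mu>: "\<mu> (cylinder k n B) = sum (f n) B" if n: "1 \<le> n" and B: "B \<subseteq> configs (tree_ball k n)" for n B
  proof -
    let ?A = "cylinder k n B"
    define m where "m = (SOME n. P ?A n)"
    have "P ?A n" using n B by (auto simp: P_def)
    hence "P ?A m" unfolding m_def by (rule someI)
    then obtain C where C: "1 \<le> m" "C \<subseteq> configs (tree_ball k m)" "?A = cylinder k m C"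
      by (auto simp: P_def)
    have "\<mu> ?A = V m ?A" using cylinder_in_cylinder_sets[OF B] by (simp add: \<mu>_def m_def)
    also have "\<dots> = V (max m n) ?A" unfolding C(3) by (rule V_mono[OF C(1,2), symmetric]) simp
    also have "\<dots> = V n ?A" by (rule V_mono[OF n B]) simp
    finally show ?thesis using V_cyl[OF B] by simp
  qed
  have "\<mu> \<in> extensional (cylinder_sets k)" by (simp add: \<mu>_def)
  moreover have "Measure_Space.additive (cylinder_sets k) \<mu>"
    unfolding Measure_Space.additive_def
  proof (intro ballI impI)
    fix A A' assume A: "A \<in> cylinder_sets k" "A' \<in> cylinder_sets k" and disj: "A \<inter> A' = {}"
    obtain n B B' where n: "1 \<le> n" and B: "B \<subseteq> configs (tree_ball k n)" "A = cylinder k n B"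
      and B': "B' \<subseteq> configs (tree_ball k n)" "A' = cylinder k n B'"
      using cylinder_sets_common_level[OF A] by metis
    have "B \<inter> B' = {}" using cylinder_disjoint B B' disj by simp
    moreover have "finite B" "finite B'"
      using finite_subset[OF B(1)] finite_subset[OF B'(1)] finite_configs[OF finite_tree_ball] by auto
    moreover have "\<mu> (A \<union> A') = sum (f n) (B \<union> B')"
      using \<mu>[OF n, of "B \<union> B'"] B B' by (simp add: cylinder_Un)
    ultimately show "\<mu> (A \<union> A') = \<mu> A + \<mu> A'"
      using \<mu>[OF n B(1)] \<mu>[OF n B'(1)] B(2) B'(2) by (simp add: sum.union_disjoint)
  qed
  moreover have "\<mu> (configs (tree_vertices k)) = 1"
    using \<mu>[of 1 "configs (tree_ball k 1)"] total by (simp add: cylinder_UNIV)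
  moreover have "\<mu> {\<sigma> \<in> configs (tree_vertices k). restrict \<sigma> (tree_ball k n) = s} = f n s"
    if "1 \<le> n" "s \<in> configs (tree_ball k n)" for n s
    using \<mu>[of n "{s}"] that by (simp add: cylinder_def)
  ultimately show ?thesis
    unfolding padic_prob_def padic_measure_def using algebra_cylinder_sets by blast
qed

section \<open>Existence and uniqueness\<close>

theorem corollary5p2:
  fixes J J1 :: "'p::prime_card padic" and k :: nat
  assumes "CARD('p) \<ge> 3"
    and "k \<ge> 1"
    and "padic_norm J \<le> 1 / real CARD('p)"
    and "0 < padic_norm J1"
    and "padic_norm J1 \<le> 1 / real CARD('p)"
  shows "\<exists>!\<mu>. translation_invariant_gibbs_measure k J J1 \<mu>"
proof -
  note p3 = assms(1) and k = assms(2) and J = assms(3) and J1 = assms(5)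
  have ab: "padic_exp J \<in> padic_E" "padic_exp J1 \<in> padic_E" by (intro padic_exp_in_E[OF p3] J J1)+
  have "\<exists>\<mu>. translation_invariant_gibbs_measure k J J1 \<mu>"
  proof -
    obtain g l where g: "\<And>s t. g s t \<in> padic_E"
      and l: "\<And>s t. s \<in> {-1, 1} \<Longrightarrow> t \<in> {-1, 1} \<Longrightarrow>
                edge_sum (padic_exp J) (padic_exp J1) g s t ^ k = l * g s t"
      using edge_sum_fixed_point_exists[OF p3 ab, of k] by metis
    \<comment> \<open>The exponent is its own inverse: raising \<open>h\<close> to the power
      \<open>s * t\<close> again returns \<open>g\<close>, since
      \<open>(s * t)^2 = 1\<close>.\<close>
    define h where "h = (\<lambda>(x :: vertex) (y :: vertex) s t. g s t powi (s * t))"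
    have h: "\<forall>(x, y)\<in>tree_edges k. \<forall>s\<in>{-1, 1}. \<forall>t\<in>{-1, 1}. h x y s t \<in> padic_E"
      by (simp add: h_def padic_E_powi[OF p3] g)
    have fact: "edge_factorization k h (\<lambda>_. 1) g"
      by (auto simp: edge_factorization_def h_def power_int_minus)
    have comp: "compatible k J J1 h" by (rule compatible_of_fixed_point[OF p3 J J1 h fact l])
    have total: "(\<Sum>s\<in>configs (tree_ball k 1). finite_gibbs k J J1 h 1 s) = 1"
      using partition_function_nonzero[OF p3 J J1 h, of 1]
      by (simp add: finite_gibbs_def partition_function_def flip: sum_divide_distrib)
    have consistent: "(\<Sum>\<omega>\<in>configs (level k (Suc n)).
        finite_gibbs k J J1 h (Suc n) (merge (tree_ball k n) (level k (Suc n)) (s, \<omega>))) = finite_gibbs k J J1 h n s"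
      if "1 \<le> n" "s \<in> configs (tree_ball k n)" for n s
      using comp[unfolded compatible_def, rule_format, of "Suc n" s] that by simp
    obtain \<mu> where \<mu>: "\<mu> \<in> extensional (cylinder_sets k)"
      "padic_prob (configs (tree_vertices k)) (cylinder_sets k) \<mu>"
      "\<forall>n\<ge>1. \<forall>s\<in>configs (tree_ball k n).
        \<mu> {\<sigma> \<in> configs (tree_vertices k). restrict \<sigma> (tree_ball k n) = s} = finite_gibbs k J J1 h n s"
      using padic_kolmogorov_extension[of "finite_gibbs k J J1 h" k, OF total consistent] by blast
    have "gibbs_measure k J J1 h \<mu>"
      unfolding gibbs_measure_def quasi_gibbs_measure_def
      using boundary_defined_in_E[OF p3 J J1 h] comp \<mu> h by blast
    moreover have "u_translation_invariant k (boundary_u J h)"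
      by (simp add: u_translation_invariant_def boundary_u_def h_def case_prod_unfold)
    ultimately show ?thesis unfolding translation_invariant_gibbs_measure_def by blast
  qed
  moreover have "\<mu> = \<nu>"
    if \<mu>: "translation_invariant_gibbs_measure k J J1 \<mu>" and \<nu>: "translation_invariant_gibbs_measure k J J1 \<nu>"
    for \<mu> \<nu>
  proof -
    have data: "\<exists>h c g l. quasi_gibbs_measure k J J1 h \<mu> \<and> edge_factorization k h c g \<and>
        (\<forall>(x, y)\<in>tree_edges k. c y \<noteq> 0) \<and> g (-1) 1 = 1 \<and>
        (\<forall>s\<in>{-1, 1}. \<forall>t\<in>{-1, 1}. g s t \<in> padic_E \<and>
           edge_sum (padic_exp J) (padic_exp J1) g s t ^ k = l * g s t)"
      if \<mu>: "translation_invariant_gibbs_measure k J J1 \<mu>" for \<mu>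
    proof -
      obtain h where q: "quasi_gibbs_measure k J J1 h \<mu>" and u: "u_translation_invariant k (boundary_u J h)"
        and h: "\<forall>(x, y)\<in>tree_edges k. \<forall>s\<in>{-1, 1}. \<forall>t\<in>{-1, 1}. h x y s t \<in> padic_E"
        using \<mu> unfolding translation_invariant_gibbs_measure_def gibbs_measure_def by blast
      obtain c g where f: "edge_factorization k h c g"
        and c: "\<And>x y. (x, y) \<in> tree_edges k \<Longrightarrow> c y \<noteq> 0"
        and g: "\<And>s t. s \<in> {-1, 1} \<Longrightarrow> t \<in> {-1, 1} \<Longrightarrow> g s t \<in> padic_E" "g (-1) 1 = 1"
        using factorization_of_translation_invariant[OF p3 J J1 k u h] by metis
      have comp: "compatible k J J1 h" using q by (simp add: quasi_gibbs_measure_def)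
      have "\<exists>l. \<forall>s\<in>{-1, 1}. \<forall>t\<in>{-1, 1}. edge_sum (padic_exp J) (padic_exp J1) g s t ^ k = l * g s t"
        by (rule fixed_point_of_compatible[OF p3 J J1 k comp h f]) (fact c, fact g(1))
      then obtain l where "\<forall>s\<in>{-1, 1}. \<forall>t\<in>{-1, 1}. edge_sum (padic_exp J) (padic_exp J1) g s t ^ k = l * g s t" ..
      thus ?thesis using q f c g by (intro exI[of _ h] exI[of _ c] exI[of _ g] exI[of _ l]) blast
    qed
    obtain h c g l where 1: "quasi_gibbs_measure k J J1 h \<mu>" "edge_factorization k h c g"
      "\<And>x y. (x, y) \<in> tree_edges k \<Longrightarrow> c y \<noteq> 0" "g (-1) 1 = 1"
      "\<And>s t. s \<in> {-1, 1} \<Longrightarrow> t \<in> {-1, 1} \<Longrightarrow> g s t \<in> padic_E"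
      "\<And>s t. s \<in> {-1, 1} \<Longrightarrow> t \<in> {-1, 1} \<Longrightarrow> edge_sum (padic_exp J) (padic_exp J1) g s t ^ k = l * g s t"
      using data[OF \<mu>] by blast
    obtain h' c' g' l' where 2: "quasi_gibbs_measure k J J1 h' \<nu>" "edge_factorization k h' c' g'"
      "\<And>x y. (x, y) \<in> tree_edges k \<Longrightarrow> c' y \<noteq> 0" "g' (-1) 1 = 1"
      "\<And>s t. s \<in> {-1, 1} \<Longrightarrow> t \<in> {-1, 1} \<Longrightarrow> g' s t \<in> padic_E"
      "\<And>s t. s \<in> {-1, 1} \<Longrightarrow> t \<in> {-1, 1} \<Longrightarrow> edge_sum (padic_exp J) (padic_exp J1) g' s t ^ k = l' * g' s t"
      using data[OF \<nu>] by blast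
    have "g s t = g' s t" if "s \<in> {-1, 1}" "t \<in> {-1, 1}" for s t
      by (rule edge_sum_fixed_point_unique[OF p3 ab, of g g']) (fact 1(5) 2(5) 1(6) 2(6) 1(4) 2(4) that)+
    \<comment> \<open>After normalization both solutions share one \<open>g\<close>, so
      \<open>h\<close> and \<open>h'\<close> differ only in their edgewise scalars and have the same
      finite-volume measures.\<close>
    hence fact: "edge_factorization k h' c' g"
      using 2(2) unfolding edge_factorization_def by fastforce
    have "finite_gibbs k J J1 h n s = finite_gibbs k J J1 h' n s"
      if "1 \<le> n" "s \<in> configs (tree_ball k n)" for n s
      by (rule finite_gibbs_cong_factorization[OF 1(2) fact]) (fact 1(3) 2(3) that)+
    thus ?thesis using 1(1) 2(1)
      by (intro measure_eqI_cylinder[of k])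
        (simp_all add: quasi_gibbs_measure_def padic_prob_def padic_measure_def)
  qed
  ultimately show ?thesis by blast
qed

end
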